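(* Let $\mathcal{T}$ be the labelled family of simply generated trees associated to a degree-weight sequence $(\varphi_\ell)_{\ell\ge 0}$ (nonnegative reals, $\varphi_0>0$). Assume that $\varphi(t)=\sum_{\ell\ge0}\varphi_\ell t^\ell$ has positive radius of convergence $R$ (possibly $R=\infty$) and that the equation $t\varphi'(t)=\varphi(t)$ has a minimal positive solution $\tau<R$. Put $\rho=\tau/\varphi(\tau)$ and $d=\gcd\{\ell:\varphi_\ell>0\}$. For $1\le j\le n$ let $I_{n,j}$ be the number of inversions of the kind $(i,j)$, with $i>j$ an ancestor of $j$, in a random tree of size $n$ of $\mathcal{T}$. Let $j=j(n)$ with $1\le j(n)\le n$, and let $n\to\infty$ with $n\equiv1\pmod d$. Then: (1) If $n-j\gg\sqrt n$, then $\frac{\sqrt n}{n-j}I_{n,j}\xrightarrow{(d)}X_\sigma$, where $X_\sigma$ is Rayleigh distributed with parameter $\sigma=\frac{1}{\sqrt{\rho\tau\varphi''(\tau)}}$. (2) If $n-j\sim\alpha\sqrt n$ with $\alpha\in\mathbb{R}^+$, then $I_{n,j}$ converges in distribution to a discrete random variable $Y_\gamma$ with $$\mathbb{P}\{Y_\gamma=k\}=\frac{\gamma^k}{k!}\int_0^\infty x^{k+1}e^{-\frac{x^2}{2}-\gamma x}\,dx,\quad k\ge0,\qquad \gamma=\frac{\alpha}{\sqrt{\rho\tau\varphi''(\tau)}}.$$ (3) If $n-j\ll\sqrt n$, then $I_{n,j}\xrightarrow{(d)}0$, i.e. $I_{n,j}$ converges in distribution to a random variable with all its mass concentrated at $0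$.
   Context: Trees are rooted ordered trees (the children of each node are linearly ordered) whose $|T|$ vertices are labelled with the distinct integers $1,\dots,|T|$ (all labellings allowed); $|T|$ is the number of vertices. The weight of $T$ is $w(T)=\prod_{v\in T}\varphi_{d(v)}$, where $d(v)$ is the number of children of $v$. The simply generated family $\mathcal{T}$ consists of all such trees together with their weights; $T_n=\sum_{|T|=n}w(T)$ is the total weight of trees of size $n$. A random tree of size $n$ (defined when $T_n>0$) is chosen with probability $w(T)/T_n$. Vertices are identified with their labels; $i$ is an ancestor of $j$ if $i\ne j$ lies on the path from the root to $j$. The Rayleigh distribution with parameter $\sigma>0$ has density $f_\sigma(x)=\frac{x}{\sigma^2}e^{-x^2/(2\sigma^2)}$, $x>0$. Notation: $a_n\gg b_n$ means $b_n=o(a_n)$; $a_n\ll b_n$ means $a_n=o(b_n)$; $a_n\sim b_n$ means $a_n/b_n\to1$; $\xrightarrow{(d)}$ denotes convergence in distribution. *)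

theory Defs
  imports "HOL-Probability.Probability"
begin

datatype 'a otree = Node 'a "'a otree list"

primrec vertices :: "'a otree \<Rightarrow> 'a list" where
  "vertices (Node x ts) = x # concat (map vertices ts)"

definition labelled_trees :: "nat \<Rightarrow> nat otree set" where
  "labelled_trees n = {t. distinct (vertices t) \<and> set (vertices t) = {1..n}}"

primrec weight :: "(nat \<Rightarrow> real) \<Rightarrow> 'a otree \<Rightarrow> real" where
  "weight \<phi> (Node x ts) = \<phi> (length ts) * prod_list (map (weight \<phi>) ts)"

definition total_weight :: "(nat \<Rightarrow> real) \<Rightarrow> nat \<Rightarrow> real" where
  "total_weight \<phi> n = (\<Sum>t\<in>labelled_trees n. weight \<phi> t)"

(* Meaningful only if the total weight is positive; see pmf_random_tree below.
   For a total weight of 0 this is an unspecified distribution. *)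
definition random_tree :: "(nat \<Rightarrow> real) \<Rightarrow> nat \<Rightarrow> nat otree pmf" where
  "random_tree \<phi> n =
    embed_pmf (\<lambda>t. if t \<in> labelled_trees n then weight \<phi> t / total_weight \<phi> n else 0)"

(* root_path t p: p lists the labels on the path from the root of t down to some vertex. *)
inductive root_path :: "'a otree \<Rightarrow> 'a list \<Rightarrow> bool" where
  "root_path (Node x ts) [x]"
| "t \<in> set ts \<Longrightarrow> root_path t p \<Longrightarrow> root_path (Node x ts) (x # p)"

(* Vertices are identified with their labels, so this is meant for trees with distinct labels. *)
definition ancestor :: "'a otree \<Rightarrow> 'a \<Rightarrow> 'a \<Rightarrow> bool" where
  "ancestor t i j \<longleftrightarrow> i \<noteq> j \<and> (\<exists>p. root_path t p \<and> last p = j \<and> i \<in> set p)"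

definition inversions :: "nat otree \<Rightarrow> nat \<Rightarrow> nat" where
  "inversions t j = card {i. i > j \<and> ancestor t i j}"

definition gen_fun :: "(nat \<Rightarrow> real) \<Rightarrow> real \<Rightarrow> real" where
  "gen_fun \<phi> t = (\<Sum>l. \<phi> l * t ^ l)"

definition rayleigh_density :: "real \<Rightarrow> real \<Rightarrow> real" where
  "rayleigh_density \<sigma> x = (if x > 0 then x / \<sigma>\<^sup>2 * exp (- x\<^sup>2 / (2 * \<sigma>\<^sup>2)) else 0)"

definition rayleigh :: "real \<Rightarrow> real measure" where
  "rayleigh \<sigma> = density lborel (\<lambda>x. ennreal (rayleigh_density \<sigma> x))"

definition law :: "'a pmf \<Rightarrow> ('a \<Rightarrow> real) \<Rightarrow> real measure" where
  "law p X = distr (measure_pmf p) borel X"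

lemma vertices_neq_Nil [simp]: "vertices t \<noteq> []"
  by (cases t) simp

lemma weight_nonneg: "(\<And>l. \<phi> l \<ge> 0) \<Longrightarrow> weight \<phi> t \<ge> 0"
  by (induction t) (auto intro!: mult_nonneg_nonneg prod_list_nonneg)

lemma finite_otrees_bounded:
  assumes "finite A"
  shows "finite {t. length (vertices t) \<le> k \<and> set (vertices t) \<subseteq> A}" (is "finite (?S k)")
proof (induction k)
  case (Suc k)
  let ?L = "{ts. set ts \<subseteq> ?S k \<and> length ts \<le> k}"
  have "?S (Suc k) \<subseteq> (\<lambda>(x, ts). Node x ts) ` (A \<times> ?L)"
  proof
    fix t assume t: "t \<in> ?S (Suc k)"
    obtain x ts where tt: "t = Node x ts" by (cases t)
    have len: "length (concat (map vertices ts)) \<le> k" and x: "x \<in> A"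
      using t tt by auto
    have "set ts \<subseteq> ?S k"
    proof
      fix s assume s: "s \<in> set ts"
      have "length (vertices s) \<le> (\<Sum>u\<leftarrow>ts. length (vertices u))"
        using s by (intro member_le_sum_list) auto
      also have "\<dots> \<le> k" using len by (simp add: length_concat o_def)
      finally show "s \<in> ?S k" using s t tt by auto
    qed
    moreover have "length ts \<le> length (concat (map vertices us))" if "us = ts" for us
      unfolding that
    proof (induction ts)
      case (Cons u us)
      moreover have "length (vertices u) \<ge> 1" by (simp add: Suc_le_eq)
      ultimately show ?case by simp
    qed simp
    ultimately have "ts \<in> ?L" using len by force
    thus "t \<in> (\<lambda>(x, ts). Node x ts) ` (A \<times> ?L)" using tt x by auto
  qed
  moreover have "finite ?L" using Suc.IH by (rule finite_lists_length_le)
  ultimately show ?case using assms by (meson finite_SigmaI finite_imageI finite_subset)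
qed simp

lemma finite_labelled_trees: "finite (labelled_trees n)"
proof (rule finite_subset)
  show "labelled_trees n \<subseteq> {t. length (vertices t) \<le> n \<and> set (vertices t) \<subseteq> {1..n}}"
    by (auto simp: labelled_trees_def simp flip: distinct_card)
qed (simp add: finite_otrees_bounded)

lemma pmf_random_tree:
  assumes "\<And>l. \<phi> l \<ge> 0" and pos: "total_weight \<phi> n > 0"
  shows "pmf (random_tree \<phi> n) t =
    (if t \<in> labelled_trees n then weight \<phi> t / total_weight \<phi> n else 0)" (is "_ = ?f t")
  unfolding random_tree_def
proof (rule pmf_embed_pmf)
  show nonneg: "?f t \<ge> 0" for t using assms by (auto intro!: divide_nonneg_pos weight_nonneg)
  have "(\<integral>\<^sup>+ t. ennreal (?f t) \<partial>count_space UNIV) = (\<Sum>t\<in>labelled_trees n. ennreal (?f t))"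
    by (rule nn_integral_count_space') (auto simp: finite_labelled_trees)
  also have "\<dots> = ennreal (\<Sum>t\<in>labelled_trees n. ?f t)"
    using nonneg by (rule sum_ennreal)
  also have "(\<Sum>t\<in>labelled_trees n. ?f t) = 1"
    using pos by (simp add: total_weight_def flip: sum_divide_distrib)
  finally show "(\<integral>\<^sup>+ t. ennreal (?f t) \<partial>count_space UNIV) = 1" by simp
qed

end

theory Submission
  imports Defs "HOL-Real_Asymp.Real_Asymp"
begin

text \<open>
  The number of inversions at \<open>j\<close> is determined by the set of ancestors of \<open>j\<close>. By symmetry under
  relabelling, this set is, given its size \<open>D\<close> (the depth of \<open>j\<close>), a uniformly random \<open>D\<close>-subset of
  the other \<open>n - 1\<close> labels. Of these labels \<open>n - j\<close> are larger than \<open>j\<close>, so the number of inversions is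
  a hypergeometric variable with random sample size \<open>D\<close> (\<open>inversions_mixed_hypergeometric\<close>).

  By the same symmetry \<open>D\<close> is distributed like the depth of a uniformly chosen vertex. Multiplying
  the weights by the powers of \<open>\<tau>\<close> and normalising does not change the random tree
  (\<open>random_tree_tilt\<close>), so \<open>\<phi>\<close> may be assumed to be a probability distribution \<open>p\<close> with mean 1; its
  variance is then \<open>\<sigma>\<^sup>2 = \<rho> * \<tau> * \<phi>''(\<tau>)\<close>. If \<open>P\<close> is the generating function of \<open>p\<close> and \<open>T\<close> that of
  trees, then that of trees with a marked vertex of depth at least \<open>h\<close> is \<open>(X * P'(T)) ^ h * X * T'\<close>, and Lagrange inversion turns this
  into the exact formula
  \<open>P(D \<ge> h) = P(S(n - h) + S\<^sup>*(h) = n - 1) / P(S(n) = n - 1)\<close>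
  (\<open>depth_tail\<close>, \<open>deep_gf_closed_form\<close>), where \<open>S(k)\<close> is a sum of \<open>k\<close> independent variables with law \<open>p\<close>
  and \<open>S\<^sup>*(k)\<close> one of \<open>k\<close> variables with the size-biased law \<open>k * p k\<close>. As the size-biased law has mean
  \<open>1 + \<sigma>\<^sup>2\<close>, for \<open>h \<sim> x * sqrt n\<close> the numerator is asymptotically proportional to the density of a Gaussian of
  variance \<open>n * \<sigma>\<^sup>2\<close> at distance \<open>x * \<sigma>\<^sup>2 * sqrt n\<close> from its centre, and the denominator to the same
  density at the centre (\<open>local_limit\<close>, by Fourier inversion), so the ratio tends
  to \<open>exp (- x\<^sup>2 * \<sigma>\<^sup>2 / 2)\<close>. Thus \<open>\<sigma> * D / sqrt n\<close> converges to the standard Rayleigh law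
  (\<open>depth_converges_to_rayleigh\<close>).

  It remains to combine the two facts. Given \<open>D \<sim> y * sqrt n / \<sigma>\<close>, the hypergeometric variable has
  mean about \<open>(n - j) * y / (\<sigma> * sqrt n)\<close>. If \<open>n - j\<close> dominates \<open>sqrt n\<close>, it concentrates around this
  mean by Chebyshev's inequality; if \<open>n - j \<sim> \<alpha> * sqrt n\<close>, it is asymptotically Poisson with parameter
  \<open>\<alpha> * y / \<sigma>\<close>; the third regime is the case \<open>\<alpha> = 0\<close> of the second. Integrating over \<open>y\<close> with respect to
  the Rayleigh law is justified by \<open>weak_conv_integral_varying\<close>.
\<close>

unbundle no vec_syntax
unbundle fps_syntax

section \<open>Lagrange inversion\<close>

text \<open>
  Writing \<open>G = G(0) + X * G\<^sub>1\<close> gives \<open>G(T) = G(0) + X * (P * G\<^sub>1)(T)\<close>, which moves one coefficient down and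
  turns \<open>G\<close> into \<open>P * G\<^sub>1\<close>. So the formula for all \<open>G\<close> follows by induction on the coefficient; the
  induction step is the product rule for \<open>G\<^sub>1 * P ^ (m + 2)\<close>.
\<close>

lemma lagrange_inversion:
  fixes P T G :: "'a::field_char_0 fps"
  assumes T: "T = fps_X * (P oo T)"
  shows "of_nat (Suc m) * (G oo T) $ Suc m = (fps_deriv G * P ^ Suc m) $ m"
proof (induction m arbitrary: G)
  have T0: "T $ 0 = 0" by (subst T) simp
  have step: "(G oo T) $ Suc m = ((P * fps_shift 1 G) oo T) $ m" for G m
  proof -
    have "G = fps_const (G $ 0) + fps_X * fps_shift 1 G"
      by (rule fps_ext) (simp add: fps_X_mult_nth)
    then have "G oo T = fps_const (G $ 0) + T * (fps_shift 1 G oo T)"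
      by (metis T0 fps_X_fps_compose_startby0 fps_compose_add_distrib fps_compose_mult_distrib fps_const_compose)
    also have "\<dots> = fps_const (G $ 0) + fps_X * ((P * fps_shift 1 G) oo T)"
      using T by (simp add: fps_compose_mult_distrib[OF T0] mult.assoc[symmetric])
    finally show ?thesis by simp
  qed
  {
    case 0
    show ?case by (simp add: step)
  next
    case (Suc m)
    define F where "F = fps_shift 1 G"
    have G': "fps_deriv G = F + fps_X * fps_deriv F"
      by (rule fps_ext) (auto simp: F_def fps_X_mult_nth algebra_simps)
    have A: "of_nat (Suc m) * (F * P ^ Suc (Suc m)) $ Suc m
        = (fps_deriv F * P ^ Suc (Suc m)) $ m + of_nat (Suc (Suc m)) * (F * fps_deriv P * P ^ Suc m) $ m"
    proof -
      have "of_nat (Suc m) * (F * P ^ Suc (Suc m)) $ Suc m = fps_deriv (F * P ^ Suc (Suc m)) $ m"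
        by (simp only: fps_deriv_nth Suc_eq_plus1)
      also have "fps_deriv (F * P ^ Suc (Suc m)) = fps_deriv F * P ^ Suc (Suc m) + of_nat (Suc (Suc m)) * (F * fps_deriv P * P ^ Suc m)"
        by (simp only: fps_deriv_mult fps_deriv_power fps_of_nat diff_Suc_1 mult_ac add_ac)
      finally show ?thesis
        by (simp only: fps_add_nth fps_of_nat[symmetric] fps_mult_left_const_nth)
    qed
    have distr: "of_nat (Suc (Suc m)) * (x + y) = (x + of_nat (Suc (Suc m)) * y) + of_nat (Suc m) * x"
      for x y :: 'a by (simp add: algebra_simps)
    have "of_nat (Suc m) * (of_nat (Suc (Suc m)) * (G oo T) $ Suc (Suc m))
        = of_nat (Suc (Suc m)) * (of_nat (Suc m) * ((P * F) oo T) $ Suc m)"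
      by (simp only: step F_def mult_ac)
    also have "\<dots> = of_nat (Suc (Suc m)) * (fps_deriv (P * F) * P ^ Suc m) $ m"
      by (simp only: Suc.IH)
    also have "fps_deriv (P * F) * P ^ Suc m = fps_deriv F * P ^ Suc (Suc m) + F * fps_deriv P * P ^ Suc m"
      by (simp add: algebra_simps)
    also have "of_nat (Suc (Suc m)) * (\<dots>) $ m = of_nat (Suc m) * (F * P ^ Suc (Suc m)) $ Suc m
        + of_nat (Suc m) * (fps_deriv F * P ^ Suc (Suc m)) $ m"
      by (simp only: A fps_add_nth distr)
    also have "\<dots> = of_nat (Suc m) * (fps_deriv G * P ^ Suc (Suc m)) $ Suc m"
      by (simp only: G' distrib_left distrib_right mult.assoc) (simp add: algebra_simps)
    finally show ?case by (metis mult_left_cancel of_nat_neq_0)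
  }
qed

section \<open>Generating functions of trees and deep vertices\<close>

text \<open>
  The number of vertices of depth at least \<open>h\<close>. Compared with depth exactly \<open>h\<close>, this gives the tail of
  the depth without a summation, and for \<open>h = 0\<close> it counts all vertices, so that the generating function
  is \<open>X * T'\<close>; the derivative \<open>T'\<close> is what makes Lagrange inversion applicable later on.
\<close>

primrec num_deep :: "nat \<Rightarrow> 'a otree \<Rightarrow> nat" where
  "num_deep 0 t = length (vertices t)"
| "num_deep (Suc h) t = (case t of Node x ts \<Rightarrow> (\<Sum>s\<leftarrow>ts. num_deep h s))"

text \<open>
  Weights and depths do not see the labels, so trees with labels in \<open>unit\<close> serve as unlabelled trees.
\<close>

definition shapes :: "nat \<Rightarrow> unit otree set" where
  "shapes n = {s. length (vertices s) = n}"

definition forests :: "nat \<Rightarrow> nat \<Rightarrow> unit otree list set" where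
  "forests l n = {ss. length ss = l \<and> length (concat (map vertices ss)) = n}"

lemma finite_shapes [simp]: "finite (shapes n)"
  by (rule finite_subset[OF _ finite_otrees_bounded[of UNIV n]]) (auto simp: shapes_def)

lemma shapes_0 [simp]: "shapes 0 = {}"
  by (auto simp: shapes_def)

lemma forests_0: "forests 0 n = (if n = 0 then {[]} else {})"
  by (auto simp: forests_def)

lemma forests_Suc: "forests (Suc l) n = (\<Union>i\<in>{0..n}. (\<lambda>(s, ss). s # ss) ` (shapes i \<times> forests l (n - i)))"
proof (intro set_eqI iffI)
  fix ss assume "ss \<in> forests (Suc l) n"
  then show "ss \<in> (\<Union>i\<in>{0..n}. (\<lambda>(s, ss). s # ss) ` (shapes i \<times> forests l (n - i)))"
    by (cases ss) (auto simp: forests_def shapes_def intro!: bexI[of _ "length (vertices (hd ss))"])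
qed (auto simp: forests_def shapes_def)

lemma finite_forests [simp]: "finite (forests l n)"
  by (induction l arbitrary: n) (auto simp: forests_0 forests_Suc)

lemma sum_forests_Suc:
  "(\<Sum>ss\<in>forests (Suc l) n. F ss) = (\<Sum>i=0..n. \<Sum>s\<in>shapes i. \<Sum>ss\<in>forests l (n - i). F (s # ss))"
proof -
  have "(\<Sum>ss\<in>forests (Suc l) n. F ss)
      = (\<Sum>i=0..n. \<Sum>ss\<in>(\<lambda>(s, ss). s # ss) ` (shapes i \<times> forests l (n - i)). F ss)"
    unfolding forests_Suc
    by (rule sum.UNION_disjoint) (auto, auto simp: shapes_def)
  then show ?thesis
    by (simp add: sum.reindex inj_on_def case_prod_unfold sum.cartesian_product)
qed

lemma forests_length: "ss \<in> forests l n \<Longrightarrow> l \<le> n"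
proof -
  have "length ss \<le> length (concat (map vertices ss))" for ss :: "unit otree list"
  proof (induction ss)
    case (Cons u us)
    moreover have "length (vertices u) \<ge> 1" by (simp add: Suc_le_eq)
    ultimately show ?case by simp
  qed simp
  then show "ss \<in> forests l n \<Longrightarrow> l \<le> n" by (auto simp: forests_def)
qed

lemma sum_shapes_Suc:
  "(\<Sum>s\<in>shapes (Suc n). F s) = (\<Sum>l=0..n. \<Sum>ss\<in>forests l n. F (Node () ss))"
proof -
  have "shapes (Suc n) = (\<Union>l\<in>{0..n}. Node () ` forests l n)"
  proof (intro set_eqI iffI)
    fix s assume s: "s \<in> shapes (Suc n)"
    obtain u ss where [simp]: "s = Node u ss" by (cases s)
    have "ss \<in> forests (length ss) n" using s by (auto simp: shapes_def forests_def)
    then show "s \<in> (\<Union>l\<in>{0..n}. Node () ` forests l n)" using forests_length by fastforce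
  qed (auto simp: forests_def shapes_def)
  then show ?thesis
    by (simp only:) (subst sum.UNION_disjoint, auto simp: sum.reindex inj_on_def, auto simp: forests_def)
qed

definition tree_gf :: "(nat \<Rightarrow> real) \<Rightarrow> real fps" where
  "tree_gf \<phi> = Abs_fps (\<lambda>n. \<Sum>s\<in>shapes n. weight \<phi> s)"

definition deep_gf :: "(nat \<Rightarrow> real) \<Rightarrow> nat \<Rightarrow> real fps" where
  "deep_gf \<phi> h = Abs_fps (\<lambda>n. \<Sum>s\<in>shapes n. weight \<phi> s * real (num_deep h s))"

lemma tree_gf_nth: "tree_gf \<phi> $ n = (\<Sum>s\<in>shapes n. weight \<phi> s)"
  by (simp add: tree_gf_def)

lemma deep_gf_nth: "deep_gf \<phi> h $ n = (\<Sum>s\<in>shapes n. weight \<phi> s * real (num_deep h s))"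
  by (simp add: deep_gf_def)

lemma tree_gf_0 [simp]: "tree_gf \<phi> $ 0 = 0" and deep_gf_0 [simp]: "deep_gf \<phi> h $ 0 = 0"
  by (auto simp: tree_gf_def deep_gf_def)

lemma tree_gf_power_nth:
  "(tree_gf \<phi> ^ l) $ n = (\<Sum>ss\<in>forests l n. prod_list (map (weight \<phi>) ss))"
proof (induction l arbitrary: n)
  case (Suc l)
  show ?case
    by (simp add: fps_mult_nth Suc sum_forests_Suc tree_gf_nth sum_product)
qed (auto simp: forests_0)

text \<open>
  A deep vertex of a forest lies in one of its \<open>l\<close> trees, and the other \<open>l - 1\<close> trees are arbitrary:
  this is the product rule for the \<open>l\<close>-th power.
\<close>

lemma deep_gf_forest_nth:
  "(of_nat l * tree_gf \<phi> ^ (l - 1) * deep_gf \<phi> h) $ n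
     = (\<Sum>ss\<in>forests l n. prod_list (map (weight \<phi>) ss) * real (\<Sum>s\<leftarrow>ss. num_deep h s))"
proof (induction l arbitrary: n)
  case (Suc l)
  have eq: "of_nat (Suc l) * tree_gf \<phi> ^ (Suc l - 1) * deep_gf \<phi> h
     = deep_gf \<phi> h * tree_gf \<phi> ^ l + tree_gf \<phi> * (of_nat l * tree_gf \<phi> ^ (l - 1) * deep_gf \<phi> h)"
    by (cases l) (simp_all add: algebra_simps)
  show ?case
    unfolding eq fps_add_nth fps_mult_nth[of "deep_gf \<phi> h"] fps_mult_nth[of "tree_gf \<phi>" "_ * _ * _"] Suc
      tree_gf_power_nth sum_forests_Suc deep_gf_nth tree_gf_nth sum_product sum.distrib[symmetric]
    by (intro sum.cong refl) (simp add: algebra_simps)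
qed (auto simp: forests_0)

lemma tree_gf_eq: "tree_gf \<phi> = fps_X * (Abs_fps \<phi> oo tree_gf \<phi>)"
proof (rule fps_ext)
  fix n show "tree_gf \<phi> $ n = (fps_X * (Abs_fps \<phi> oo tree_gf \<phi>)) $ n"
  proof (cases n)
    case (Suc k)
    have "tree_gf \<phi> $ Suc k = (\<Sum>l=0..k. \<phi> l * (tree_gf \<phi> ^ l) $ k)"
      unfolding tree_gf_power_nth by (simp add: tree_gf_nth sum_shapes_Suc sum_distrib_left) (simp add: forests_def)
    then show ?thesis by (simp add: Suc fps_compose_nth)
  qed simp
qed

text \<open>
  Removing the root lowers all depths by one; the derivative of \<open>\<phi>\<close> marks the child below which the
  deep vertex lies.
\<close>

lemma deep_gf_Suc:
  "deep_gf \<phi> (Suc h) = fps_X * (fps_deriv (Abs_fps \<phi>) oo tree_gf \<phi>) * deep_gf \<phi> h"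
proof (rule fps_ext)
  fix n show "deep_gf \<phi> (Suc h) $ n = (fps_X * (fps_deriv (Abs_fps \<phi>) oo tree_gf \<phi>) * deep_gf \<phi> h) $ n"
  proof (cases n)
    case (Suc k)
    let ?T = "tree_gf \<phi>" and ?W = "deep_gf \<phi> h"
    have "deep_gf \<phi> (Suc h) $ Suc k = (\<Sum>l=0..k. \<phi> l * (of_nat l * ?T ^ (l - 1) * ?W) $ k)"
      unfolding deep_gf_forest_nth
      by (simp add: deep_gf_nth sum_shapes_Suc sum_distrib_left mult.assoc) (simp add: forests_def)
    also have "\<dots> = (\<Sum>l\<le>k. real (Suc l) * \<phi> (Suc l) * (?T ^ l * ?W) $ k)"
    proof (cases k)
      case (Suc k')
      have "(\<Sum>l=0..k. \<phi> l * (of_nat l * ?T ^ (l - 1) * ?W) $ k) =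
        (\<Sum>l\<le>k'. \<phi> (Suc l) * (of_nat (Suc l) * ?T ^ l * ?W) $ k)"
        unfolding Suc atLeast0AtMost by (subst sum.atMost_Suc_shift) simp
      also have "\<dots> = (\<Sum>l\<le>k'. real (Suc l) * \<phi> (Suc l) * (?T ^ l * ?W) $ k)"
        by (rule sum.cong) (simp_all add: fps_of_nat[symmetric] mult.assoc del: of_nat_Suc)
      \<comment> \<open>The additional term vanishes: \<open>?T ^ k\<close> starts at degree \<open>k\<close> and \<open>?W\<close> has no constant term.\<close>
      also have "\<dots> = (\<Sum>l\<le>k. real (Suc l) * \<phi> (Suc l) * (?T ^ l * ?W) $ k)"
      proof -
        have "(?T ^ k * ?W) $ k = 0"
          unfolding fps_mult_nth
        proof (intro sum.neutral ballI)
          fix i assume "i \<in> {0..k}"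
          then show "(?T ^ k) $ i * ?W $ (k - i) = 0"
            by (cases "i = k") (auto simp: startsby_zero_power_prefix[of ?T])
        qed
        then show ?thesis by (simp add: Suc)
      qed
      finally show ?thesis .
    qed simp
    also have "\<dots> = ((fps_deriv (Abs_fps \<phi>) oo ?T) * ?W) $ k"
    proof -
      have "((fps_deriv (Abs_fps \<phi>) oo ?T) * ?W) $ k
          = (\<Sum>i=0..k. (\<Sum>l=0..i. real (Suc l) * \<phi> (Suc l) * (?T ^ l) $ i) * ?W $ (k - i))"
        by (simp add: fps_mult_nth fps_compose_nth)
      also have "\<dots> = (\<Sum>i=0..k. (\<Sum>l\<le>k. real (Suc l) * \<phi> (Suc l) * (?T ^ l) $ i) * ?W $ (k - i))"
        by (intro sum.cong refl arg_cong2[where f="(*)"] sum.mono_neutral_left)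
           (auto simp: startsby_zero_power_prefix[of ?T])
      also have "\<dots> = (\<Sum>l\<le>k. real (Suc l) * \<phi> (Suc l) * (?T ^ l * ?W) $ k)"
        unfolding fps_mult_nth sum_distrib_left sum_distrib_right
        by (subst sum.swap) (simp add: mult_ac)
      finally show ?thesis by simp
    qed
    finally show ?thesis by (simp add: Suc mult.assoc)
  qed simp
qed

lemma deep_gf_0_eq: "deep_gf \<phi> 0 = fps_X * fps_deriv (tree_gf \<phi>)"
proof (rule fps_ext)
  fix n show "deep_gf \<phi> 0 $ n = (fps_X * fps_deriv (tree_gf \<phi>)) $ n"
    by (cases n) (auto simp: deep_gf_def tree_gf_def shapes_def sum_distrib_left mult_ac)
qed

lemma deep_gf_eq:
  "deep_gf \<phi> h = fps_X ^ Suc h * ((fps_deriv (Abs_fps \<phi>) ^ h oo tree_gf \<phi>) * fps_deriv (tree_gf \<phi>))"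
proof (induction h)
  case 0 show ?case by (simp add: deep_gf_0_eq)
next
  case (Suc h)
  show ?case unfolding deep_gf_Suc Suc
    by (simp add: fps_compose_mult_distrib mult_ac)
qed

text \<open>
  Iterating the recursion gives \<open>(X * \<phi>'(T)) ^ h * X * T'\<close>. The factor \<open>T'\<close> makes this a derivative of a
  series in \<open>T\<close>, so Lagrange inversion applies and yields one coefficient of an ordinary product.
  If \<open>\<phi>\<close> is a probability distribution with mean 1, this coefficient is the probability that a sum of \<open>h\<close>
  size-biased and \<open>n - h\<close> plain offspring numbers equals \<open>n - 1\<close>.
\<close>

lemma deep_gf_closed_form:
  assumes "n \<ge> 1"
  shows "deep_gf \<phi> h $ n =
    (if h \<le> n then ((fps_X * fps_deriv (Abs_fps \<phi>)) ^ h * Abs_fps \<phi> ^ (n - h)) $ (n - 1) else 0)"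
proof -
  let ?P = "Abs_fps \<phi>" and ?T = "tree_gf \<phi>"
  consider "h < n" | "h = n" | "h > n" by linarith
  then show ?thesis
  proof cases
    case 1
    define m where "m = n - Suc h"
    have n: "n = Suc (h + m)" using 1 by (simp add: m_def)
    define G where "G = fps_integral (fps_deriv ?P ^ h) 0"
    have G: "fps_deriv G = fps_deriv ?P ^ h" by (simp add: G_def fps_deriv_fps_integral)
    have "deep_gf \<phi> h $ n = ((fps_deriv ?P ^ h oo ?T) * fps_deriv ?T) $ m"
      unfolding deep_gf_eq fps_X_power_mult_nth by (simp add: n)
    also have "(fps_deriv ?P ^ h oo ?T) * fps_deriv ?T = fps_deriv (G oo ?T)"
      by (simp add: G fps_compose_deriv)
    also have "\<dots> $ m = of_nat (Suc m) * (G oo ?T) $ Suc m" by simp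
    also have "\<dots> = (fps_deriv ?P ^ h * ?P ^ Suc m) $ m"
      using lagrange_inversion[OF tree_gf_eq[of \<phi>], of m G] G by simp
    also have "\<dots> = (fps_X ^ h * (fps_deriv ?P ^ h * ?P ^ Suc m)) $ (h + m)"
      by (simp add: fps_X_power_mult_nth)
    also have "\<dots> = ((fps_X * fps_deriv ?P) ^ h * ?P ^ Suc m) $ (h + m)"
      by (simp add: power_mult_distrib mult.assoc)
    finally show ?thesis by (simp add: n)
  next
    case 2
    then show ?thesis using assms unfolding deep_gf_eq fps_X_power_mult_nth
      by (simp add: power_mult_distrib fps_X_power_mult_nth)
  next
    case 3
    then show ?thesis unfolding deep_gf_eq fps_X_power_mult_nth by simp
  qed
qed

section \<open>Labelled trees and relabelling\<close>

lemma vertices_map_otree [simp]: "vertices (map_otree f t) = map f (vertices t)"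
  by (induction t) (simp add: map_concat o_def cong: map_cong)

lemma weight_map_otree [simp]: "weight \<phi> (map_otree f t) = weight \<phi> t"
  by (induction t) (simp add: o_def cong: map_cong)

lemma num_deep_map_otree [simp]: "num_deep h (map_otree f t) = num_deep h t"
  by (induction h arbitrary: t) (auto simp: o_def split: otree.split)

abbreviation shape :: "'a otree \<Rightarrow> unit otree" where
  "shape \<equiv> map_otree (\<lambda>_. ())"

lemma otree_eqI:
  assumes "shape t = shape t'" "vertices t = vertices t'"
  shows "t = t'"
  using assms
proof (induction t arbitrary: t')
  case (Node x ts)
  obtain y us where t': "t' = Node y us" by (cases t')
  have sh: "map shape ts = map shape us" and x: "x = y"
    and c: "concat (map vertices ts) = concat (map vertices us)"
    using Node.prems by (auto simp: t')
  have len: "length ts = length us" using sh by (metis length_map)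
  have shi: "shape (ts ! i) = shape (us ! i)" if "i < length ts" for i
    using sh that len by (metis nth_map)
  have "map vertices ts = map vertices us"
  proof (rule concat_injective[OF c])
    have "length (vertices (ts ! i)) = length (vertices (us ! i))" if "i < length ts" for i
      using arg_cong[OF shi[OF that], of "\<lambda>s. length (vertices s)"] by simp
    then show "\<forall>(x, y)\<in>set (zip (map vertices ts) (map vertices us)). length x = length y"
      using len by (auto simp: set_zip)
  qed (simp add: len)
  then have vi: "vertices (ts ! i) = vertices (us ! i)" if "i < length ts" for i
    using that len by (metis nth_map)
  have "ts ! i = us ! i" if "i < length ts" for i
    by (rule Node.IH[OF nth_mem[OF that] shi[OF that] vi[OF that]])
  then show ?case using len by (simp add: t' x list_eq_iff_nth_eq)
qed

lemma otree_exists: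
  fixes xs :: "'a list"
  assumes "length xs = length (vertices s)"
  shows "\<exists>t. shape t = s \<and> vertices t = xs"
  using assms
proof (induction s arbitrary: xs)
  case (Node u ss)
  have "\<exists>ts. map shape ts = ss \<and> concat (map vertices ts) = ys"
    if "length ys = length (concat (map vertices ss))" for ys :: "'a list"
    using Node.IH that
  proof (induction ss arbitrary: ys)
    case (Cons s ss)
    let ?k = "length (vertices s)"
    have len: "length (take ?k ys) = ?k" "length (drop ?k ys) = length (concat (map vertices ss))"
      using Cons.prems(2) by auto
    obtain t where "shape t = s" "vertices t = take ?k ys"
      using Cons.prems(1)[OF list.set_intros(1) len(1)] by blast
    moreover obtain ts where "map shape ts = ss" "concat (map vertices ts) = drop ?k ys"
      using Cons.IH[OF Cons.prems(1)[OF list.set_intros(2)] len(2)] by blast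
    ultimately
    have "map shape (t # ts) = s # ss \<and> concat (map vertices (t # ts)) = ys"
      by simp
    then show ?case by (rule exI)
  qed auto
  moreover obtain x ys where "xs = x # ys" "length ys = length (concat (map vertices ss))"
    using Node.prems by (cases xs) auto
  ultimately obtain ts where "map shape ts = ss" "concat (map vertices ts) = ys"
    by blast
  then have "shape (Node x ts) = Node u ss \<and> vertices (Node x ts) = xs"
    using \<open>xs = x # ys\<close> by simp
  then show ?case by blast
qed

text \<open>
  A labelled tree is an unlabelled one together with the list of its labels in preorder, and every
  list of the right length occurs. So each unlabelled tree with \<open>n\<close> vertices carries \<open>n!\<close> labellings.
\<close>

lemma sum_labelled_trees_shape:
  fixes f :: "unit otree \<Rightarrow> real"
  shows "(\<Sum>t\<in>labelled_trees n. f (shape t)) = fact n * (\<Sum>s\<in>shapes n. f s)"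
proof -
  have bij: "bij_betw (\<lambda>t. (shape t, vertices t)) (labelled_trees n)
      (shapes n \<times> permutations_of_set {1..n})"
    unfolding bij_betw_def
  proof (intro conjI set_eqI iffI)
    show "inj_on (\<lambda>t. (shape t, vertices t)) (labelled_trees n)"
      by (auto intro!: inj_onI otree_eqI)
  next
    fix z assume "z \<in> (\<lambda>t. (shape t, vertices t)) ` labelled_trees n"
    then show "z \<in> shapes n \<times> permutations_of_set {1..n}"
      by (auto simp: labelled_trees_def shapes_def permutations_of_set_def simp flip: distinct_card)
  next
    fix z assume "z \<in> shapes n \<times> permutations_of_set {1..n}"
    then obtain s xs where z: "z = (s, xs)" "length (vertices s) = n"
      "distinct xs" "set xs = {1..n}"
      by (auto simp: shapes_def permutations_of_set_def)
    then have "length xs = length (vertices s)" by (metis card_atLeastAtMost diff_Suc_1 distinct_card)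
    then obtain t where "shape t = s" "vertices t = xs" using otree_exists by blast
    then show "z \<in> (\<lambda>t. (shape t, vertices t)) ` labelled_trees n"
      using z by (auto simp: labelled_trees_def intro!: image_eqI[of _ _ t])
  qed
  have "(\<Sum>t\<in>labelled_trees n. f (fst (shape t, vertices t)))
      = (\<Sum>z\<in>shapes n \<times> permutations_of_set {1..n}. f (fst z))"
    by (rule sum.reindex_bij_betw[OF bij])
  also have "\<dots> = (\<Sum>s\<in>shapes n. \<Sum>xs\<in>permutations_of_set {1..n}. f s)"
    by (subst sum.cartesian_product) (simp add: case_prod_unfold)
  finally show ?thesis by (simp add: sum_distrib_left)
qed

lemma total_weight_eq: "total_weight \<phi> n = fact n * tree_gf \<phi> $ n"
  using sum_labelled_trees_shape[of "weight \<phi>" n] by (simp add: total_weight_def tree_gf_nth)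

lemma sum_weight_deep:
  "(\<Sum>t\<in>labelled_trees n. weight \<phi> t * real (num_deep h t)) = fact n * deep_gf \<phi> h $ n"
  using sum_labelled_trees_shape[of "\<lambda>s. weight \<phi> s * real (num_deep h s)" n] by (simp add: deep_gf_nth)

definition ancestors :: "'a otree \<Rightarrow> 'a \<Rightarrow> 'a set" where
  "ancestors t j = {i. ancestor t i j}"

definition depth :: "'a otree \<Rightarrow> 'a \<Rightarrow> nat" where
  "depth t j = card (ancestors t j)"

lemma root_path_vertices: "root_path t p \<Longrightarrow> p \<noteq> [] \<and> set p \<subseteq> set (vertices t)"
  by (induction rule: root_path.induct) auto

lemma root_path_exists: "j \<in> set (vertices t) \<Longrightarrow> \<exists>p. root_path t p \<and> last p = j"
proof (induction t)
  case (Node x ts)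
  show ?case
  proof (cases "j = x")
    case False
    then obtain s where "s \<in> set ts" "j \<in> set (vertices s)"
      using Node.prems by auto
    then obtain p where "s \<in> set ts" "root_path s p" "last p = j"
      using Node.IH by blast
    then have "root_path (Node x ts) (x # p)" "last (x # p) = j"
      using root_path_vertices by (auto intro: root_path.intros)
    then show ?thesis by blast
  qed (auto intro!: root_path.intros exI[of _ "[x]"])
qed

lemma ancestors_subset: "ancestors t j \<subseteq> set (vertices t) - {j}"
  using root_path_vertices by (fastforce simp: ancestors_def ancestor_def)

lemma finite_ancestors [simp]: "finite (ancestors t j)"
  by (rule finite_subset[OF ancestors_subset]) simp

lemma distinct_subtrees:
  assumes "distinct (concat (map vertices ts))"
  shows "distinct ts" "s \<in> set ts \<Longrightarrow> distinct (vertices s)"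
    "s \<in> set ts \<Longrightarrow> s' \<in> set ts \<Longrightarrow> s \<noteq> s' \<Longrightarrow> set (vertices s) \<inter> set (vertices s') = {}"
proof -
  have "removeAll [] (map vertices ts) = map vertices ts" by (metis ex_map_conv removeAll_id vertices_neq_Nil)
  then have *: "distinct (map vertices ts)" using assms by (metis distinct_concat_iff)
  then show "distinct ts" by (simp add: distinct_map)
  have inj: "inj_on vertices (set ts)" using * by (simp add: distinct_map)
  show "s \<in> set ts \<Longrightarrow> distinct (vertices s)" using assms by (auto simp: distinct_concat_iff)
  show "s \<in> set ts \<Longrightarrow> s' \<in> set ts \<Longrightarrow> s \<noteq> s' \<Longrightarrow> set (vertices s) \<inter> set (vertices s') = {}"
    using assms inj unfolding distinct_concat_iff inj_on_def by (metis image_eqI list.set_map)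
qed

lemma ancestors_root:
  assumes "distinct (vertices (Node x ts))"
  shows "ancestors (Node x ts) x = {}"
proof -
  have "p = [x]" if "root_path (Node x ts) p" "last p = x" for p
    using that
  proof (cases rule: root_path.cases)
    case (2 t q)
    then have "x \<in> set (vertices t)" using root_path_vertices[of t q] that(2) by auto
    then show ?thesis using assms 2 by auto
  qed auto
  then have "ancestor (Node x ts) i x = False" for i
    unfolding ancestor_def by (metis empty_iff empty_set set_ConsD)
  then show ?thesis by (simp add: ancestors_def)
qed

lemma ancestors_child:
  assumes dist: "distinct (vertices (Node x ts))" and s: "s \<in> set ts" and j: "j \<in> set (vertices s)"
  shows "ancestors (Node x ts) j = insert x (ancestors s j)"
proof (intro set_eqI iffI)
  have "x \<noteq> j" using assms by auto
  fix i assume "i \<in> ancestors (Node x ts) j"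
  then obtain p where i: "i \<noteq> j" "root_path (Node x ts) p" "last p = j" "i \<in> set p"
    by (auto simp: ancestors_def ancestor_def)
  from i(2) show "i \<in> insert x (ancestors s j)"
  proof (cases rule: root_path.cases)
    case 1 then show ?thesis using i by auto
  next
    case (2 t q)
    have q: "q \<noteq> []" "set q \<subseteq> set (vertices t)" using root_path_vertices 2 by blast+
    then have "last q = j" "j \<in> set (vertices t)" using i 2 by auto
    then have "t = s" using distinct_subtrees(3)[of ts t s] dist 2 s j by auto
    then show ?thesis using i 2 \<open>last q = j\<close> by (auto simp: ancestors_def ancestor_def)
  qed
next
  have xj: "x \<noteq> j" using assms by auto
  fix i assume i: "i \<in> insert x (ancestors s j)"
  have "\<exists>p. root_path s p \<and> last p = j \<and> (i = x \<or> i \<noteq> j \<and> i \<in> set p)"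
    using i root_path_exists[OF j] by (auto simp: ancestors_def ancestor_def)
  then obtain p where p: "root_path s p" "last p = j" "i = x \<or> i \<noteq> j \<and> i \<in> set p" by blast
  then have "root_path (Node x ts) (x # p)" "last (x # p) = j"
    using root_path_vertices[OF p(1)] s by (auto intro: root_path.intros)
  then show "i \<in> ancestors (Node x ts) j" using p xj unfolding ancestors_def ancestor_def
    by (auto intro!: exI[of _ "x # p"])
qed

text \<open>
  Links the depth of a label, defined through its set of ancestors, to the recursion over subtrees:
  below the root, every vertex has one ancestor more than in its own subtree.
\<close>

lemma card_deep_vertices:
  "distinct (vertices t) \<Longrightarrow> card {j \<in> set (vertices t). h \<le> depth t j} = num_deep h t"
proof (induction h arbitrary: t)
  case 0 then show ?case by (simp add: distinct_card)
next
  case (Suc h)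
  obtain x ts where t: "t = Node x ts" by (cases t)
  have dist: "distinct (vertices (Node x ts))" using Suc.prems t by simp
  then have dc: "distinct (concat (map vertices ts))" by simp
  note d = distinct_subtrees[OF dc]
  have dep: "depth t j = Suc (depth s j)" if "s \<in> set ts" "j \<in> set (vertices s)" for s j
  proof -
    have "x \<notin> ancestors s j" using ancestors_subset[of s j] dist that by auto
    then show ?thesis using ancestors_child[OF dist that] by (simp add: depth_def t)
  qed
  have "depth t x = 0" using ancestors_root[OF dist] by (simp add: depth_def t)
  then have eq: "{j \<in> set (vertices t). Suc h \<le> depth t j}
      = (\<Union>s\<in>set ts. {j \<in> set (vertices s). h \<le> depth s j})"
    using dep by (auto simp: t)
  have "card {j \<in> set (vertices t). Suc h \<le> depth t j}
      = (\<Sum>s\<in>set ts. card {j \<in> set (vertices s). h \<le> depth s j})"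
    unfolding eq by (rule card_UN_disjoint) (use d(3) in fastforce)+
  also have "\<dots> = (\<Sum>s\<in>set ts. num_deep h s)"
    using Suc.IH d(2) by (intro sum.cong) auto
  also have "\<dots> = num_deep (Suc h) t"
    using d(1) by (simp add: t sum_list_distinct_conv_sum_set)
  finally show ?case .
qed

lemma root_path_map_otree: "root_path t p \<Longrightarrow> root_path (map_otree f t) (map f p)"
proof (induction rule: root_path.induct)
  case (2 t ts p x)
  then show ?case using root_path.intros(2)[of "map_otree f t" "map (map_otree f) ts" "map f p" "f x"]
    by simp
qed (simp add: root_path.intros)

lemma map_otree_inv:
  assumes "bij f" shows "map_otree (inv f) (map_otree f t) = t" "map_otree f (map_otree (inv f) u) = u"
  using bij_is_inj[OF assms] bij_is_surj[OF assms]
  by (simp_all add: otree.map_comp surj_iff otree.map_id)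

lemma ancestor_map_otree_imp:
  assumes "inj f" "ancestor t i j"
  shows "ancestor (map_otree f t) (f i) (f j)"
proof -
  obtain p where p: "i \<noteq> j" "root_path t p" "last p = j" "i \<in> set p"
    using assms by (auto simp: ancestor_def)
  have "root_path (map_otree f t) (map f p)" "last (map f p) = f j" "f i \<in> set (map f p)"
    using p root_path_map_otree[OF p(2)] root_path_vertices[OF p(2)] by (auto simp: last_map)
  moreover have "f i \<noteq> f j" using p assms by (auto dest: injD)
  ultimately show ?thesis unfolding ancestor_def by blast
qed

lemma ancestors_map_otree:
  assumes f: "bij f"
  shows "ancestors (map_otree f t) (f j) = f ` ancestors t j"
proof -
  have "ancestor (map_otree f t) i (f j) \<longleftrightarrow> i \<in> f ` ancestors t j" for i
  proof
    assume "ancestor (map_otree f t) i (f j)"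
    from ancestor_map_otree_imp[OF _ this, of "inv f"]
    have "ancestor t (inv f i) j"
      using bij_is_inj[OF bij_imp_bij_inv[OF f]] bij_is_inj[OF f] map_otree_inv(1)[OF f] by simp
    then show "i \<in> f ` ancestors t j"
      using f by (auto simp: ancestors_def intro!: image_eqI[of _ _ "inv f i"] simp: surj_f_inv_f bij_is_surj)
  qed (auto simp: ancestors_def intro: ancestor_map_otree_imp[OF bij_is_inj[OF f]])
  then show ?thesis by (auto simp: ancestors_def)
qed

lemma depth_map_otree: "bij f \<Longrightarrow> depth (map_otree f t) (f j) = depth t j"
  by (simp add: depth_def ancestors_map_otree card_image inj_on_subset[OF bij_is_inj subset_UNIV])

lemma map_otree_labelled_trees:
  assumes "\<pi> permutes {1..n}" "t \<in> labelled_trees n"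
  shows "map_otree \<pi> t \<in> labelled_trees n"
  using assms permutes_image[OF assms(1)]
  by (auto simp: labelled_trees_def distinct_map permutes_inj_on)

text \<open>
  The symmetry of the model: permuting the labels permutes the labelled trees, and weights are
  unchanged.
\<close>

lemma sum_relabel:
  assumes \<pi>: "\<pi> permutes {1..n}"
  shows "(\<Sum>t\<in>labelled_trees n. f t) = (\<Sum>t\<in>labelled_trees n. f (map_otree \<pi> t))"
proof -
  note b = permutes_bij[OF \<pi>]
  show ?thesis
    by (rule sum.reindex_bij_witness[of _ "map_otree \<pi>" "map_otree (inv \<pi>)"])
       (auto simp: map_otree_inv[OF b] intro: map_otree_labelled_trees \<pi> permutes_inv)
qed

section \<open>Inversions and depth in a random tree\<close>

text \<open>
  For \<open>K \<le> N\<close> and \<open>h \<le> N\<close>, the law of the number of marked elements in a uniformly chosen \<open>h\<close>-subset of a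
  set of \<open>N\<close> elements, \<open>K\<close> of which are marked.
\<close>

definition hypergeometric :: "nat \<Rightarrow> nat \<Rightarrow> nat \<Rightarrow> nat pmf" where
  "hypergeometric N K h = embed_pmf (\<lambda>k. if k \<le> h
     then real (K choose k) * real ((N - K) choose (h - k)) / real (N choose h) else 0)"

lemma pmf_hypergeometric:
  assumes "K \<le> N" "h \<le> N"
  shows "pmf (hypergeometric N K h) k = (if k \<le> h
     then real (K choose k) * real ((N - K) choose (h - k)) / real (N choose h) else 0)" (is "_ = ?f k")
  unfolding hypergeometric_def
proof (rule pmf_embed_pmf)
  have "(\<Sum>k\<le>h. real (K choose k) * real ((N - K) choose (h - k))) = real (N choose h)"
    using vandermonde[of K "N - K" h] assms by (simp flip: of_nat_mult of_nat_sum)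
  then have 1: "(\<Sum>k\<le>h. ?f k) = 1" using assms by (simp flip: sum_divide_distrib)
  have "(\<integral>\<^sup>+ k. ennreal (?f k) \<partial>count_space UNIV) = (\<Sum>k\<le>h. ennreal (?f k))"
    by (rule nn_integral_count_space') auto
  also have "\<dots> = ennreal (\<Sum>k\<le>h. ?f k)" by (rule sum_ennreal) auto
  finally show "(\<integral>\<^sup>+ k. ennreal (?f k) \<partial>count_space UNIV) = 1" using 1 by simp
qed auto

lemma card_subsets_inter:
  assumes "finite U" "G \<subseteq> U" "k \<le> h"
  shows "card {B. B \<subseteq> U \<and> card B = h \<and> card (B \<inter> G) = k}
    = (card G choose k) * (card (U - G) choose (h - k))"
proof -
  have fin: "finite G" "finite (U - G)" using assms finite_subset by auto
  have "bij_betw (\<lambda>(X, Y). X \<union> Y) ({X. X \<subseteq> G \<and> card X = k} \<times> {Y. Y \<subseteq> U - G \<and> card Y = h - k})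
     {B. B \<subseteq> U \<and> card B = h \<and> card (B \<inter> G) = k}"
  proof (rule bij_betwI[where g = "\<lambda>B. (B \<inter> G, B - G)"])
    show "(\<lambda>(X, Y). X \<union> Y) \<in> {X. X \<subseteq> G \<and> card X = k} \<times> {Y. Y \<subseteq> U - G \<and> card Y = h - k} \<rightarrow>
        {B. B \<subseteq> U \<and> card B = h \<and> card (B \<inter> G) = k}"
    proof (clarsimp, intro conjI)
      fix X Y assume *: "X \<subseteq> G" "Y \<subseteq> U - G" "card Y = h - card X" "k = card X"
      show "X \<subseteq> U" "Y \<subseteq> U" using * assms by auto
      have "finite X" "finite Y" "X \<inter> Y = {}"
        using * finite_subset[OF *(1) fin(1)] finite_subset[OF *(2) fin(2)] by auto
      then show "card (X \<union> Y) = h" using * assms by (simp add: card_Un_disjoint)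
      have "(X \<union> Y) \<inter> G = X" using * by auto
      then show "card ((X \<union> Y) \<inter> G) = card X" by simp
    qed
    show "(\<lambda>B. (B \<inter> G, B - G)) \<in> {B. B \<subseteq> U \<and> card B = h \<and> card (B \<inter> G) = k} \<rightarrow>
       {X. X \<subseteq> G \<and> card X = k} \<times> {Y. Y \<subseteq> U - G \<and> card Y = h - k}"
      using assms finite_subset by (auto simp: card_Diff_subset_Int)
  qed (use assms in auto)
  then have "card {B. B \<subseteq> U \<and> card B = h \<and> card (B \<inter> G) = k}
      = card ({X. X \<subseteq> G \<and> card X = k} \<times> {Y. Y \<subseteq> U - G \<and> card Y = h - k})"
    by (simp add: bij_betw_same_card)
  then show ?thesis by (simp add: card_cartesian_product n_subsets fin)
qed

lemma exists_permutes_image: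
  assumes "finite U" "B \<subseteq> U" "C \<subseteq> U" "card B = card C"
  obtains \<pi> where "\<pi> permutes U" "\<pi> ` B = C"
proof -
  have fin: "finite B" "finite C" using assms finite_subset by auto
  obtain f where f: "bij_betw f B C" using finite_same_card_bij[OF fin] assms by blast
  have "card (U - B) = card (U - C)" using assms fin by (simp add: card_Diff_subset)
  then obtain g where g: "bij_betw g (U - B) (U - C)"
    using finite_same_card_bij[of "U - B" "U - C"] assms by blast
  define \<pi> where "\<pi> x = (if x \<in> B then f x else if x \<in> U then g x else x)" for x
  have "bij_betw \<pi> B C" using f by (rule bij_betw_cong[THEN iffD1, rotated]) (simp add: \<pi>_def)
  moreover have "bij_betw \<pi> (U - B) (U - C)"
    using g by (rule bij_betw_cong[THEN iffD1, rotated]) (simp add: \<pi>_def)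
  ultimately have "bij_betw \<pi> (B \<union> (U - B)) (C \<union> (U - C))"
    by (rule bij_betw_combine) auto
  then have "\<pi> permutes U" using assms
    by (intro bij_imp_permutes) (auto simp: Un_absorb1 \<pi>_def)
  with \<open>bij_betw \<pi> B C\<close> that show ?thesis by (auto simp: bij_betw_def)
qed

text \<open>
  Given its size, the ancestor set of \<open>j\<close> is a uniformly chosen subset of the other labels, because
  the relabellings that fix \<open>j\<close> act transitively on the sets of a given size. The constant \<open>c\<close> is the
  total weight of the trees with one particular ancestor set.
\<close>

lemma sum_by_ancestor_set:
  assumes j: "j \<in> {1..n}"
  shows "\<exists>c. \<forall>F :: nat set \<Rightarrow> real. (\<Sum>t\<in>{t\<in>labelled_trees n. depth t j = h}. F (ancestors t j) * weight \<phi> t)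
    = c * (\<Sum>B\<in>{B. B \<subseteq> {1..n} - {j} \<and> card B = h}. F B)"
proof -
  let ?U = "{1..n} - {j}" and ?L = "labelled_trees n"
  let ?\<B> = "{B. B \<subseteq> ?U \<and> card B = h}"
  have finB: "finite ?\<B>" by (rule finite_subset[of _ "Pow ?U"]) auto
  define N where "N B = (\<Sum>t\<in>{t\<in>?L. ancestors t j = B}. weight \<phi> t)" for B
  have N: "N B = N C" if BC: "B \<in> ?\<B>" "C \<in> ?\<B>" for B C
  proof -
    obtain \<pi> where \<pi>: "\<pi> permutes ?U" "\<pi> ` B = C"
      using exists_permutes_image[of ?U B C] BC by auto
    have \<pi>n: "\<pi> permutes {1..n}" using \<pi>(1) by (rule permutes_subset) auto
    have \<pi>j: "\<pi> j = j" using \<pi>(1) by (auto simp: permutes_def)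
    have inj: "inj \<pi>" using \<pi>(1) by (rule permutes_inj)
    have "N C = (\<Sum>t\<in>?L. if ancestors t j = C then weight \<phi> t else 0)"
      by (simp add: N_def sum.inter_filter finite_labelled_trees)
    also have "\<dots> = (\<Sum>t\<in>?L. if ancestors (map_otree \<pi> t) j = C then weight \<phi> t else 0)"
      by (subst sum_relabel[OF \<pi>n]) (simp cong: if_cong)
    also have "\<dots> = (\<Sum>t\<in>?L. if ancestors t j = B then weight \<phi> t else 0)"
    proof (intro sum.cong refl)
      fix t
      have "ancestors (map_otree \<pi> t) j = \<pi> ` ancestors t j"
        using ancestors_map_otree[OF permutes_bij[OF \<pi>n], of t j] \<pi>j by simp
      then show "(if ancestors (map_otree \<pi> t) j = C then weight \<phi> t else 0)
         = (if ancestors t j = B then weight \<phi> t else 0)"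
        using \<pi>(2) inj by (metis inj_image_eq_iff)
    qed
    also have "\<dots> = N B"
      by (simp add: N_def sum.inter_filter finite_labelled_trees)
    finally show ?thesis by simp
  qed
  define c where "c = N (SOME B. B \<in> ?\<B>)"
  have c: "N B = c" if "B \<in> ?\<B>" for B
    unfolding c_def by (rule N[OF that someI[of "\<lambda>B. B \<in> ?\<B>", OF that]])
  have "(\<Sum>t\<in>{t\<in>?L. depth t j = h}. F (ancestors t j) * weight \<phi> t) = c * (\<Sum>B\<in>?\<B>. F B)" for F
  proof -
    have "(\<Sum>t\<in>{t\<in>?L. depth t j = h}. F (ancestors t j) * weight \<phi> t)
      = (\<Sum>B\<in>?\<B>. \<Sum>t\<in>{t\<in>{t\<in>?L. depth t j = h}. ancestors t j = B}. F (ancestors t j) * weight \<phi> t)"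
    proof (rule sum.group[symmetric])
      show "(\<lambda>t. ancestors t j) ` {t \<in> ?L. depth t j = h} \<subseteq> ?\<B>"
        using ancestors_subset[of _ j] by (fastforce simp: labelled_trees_def depth_def)
    qed (use finB finite_labelled_trees in auto)
    also have "\<dots> = (\<Sum>B\<in>?\<B>. F B * N B)"
    proof (intro sum.cong refl)
      fix B assume "B \<in> ?\<B>"
      then have "{t\<in>{t\<in>?L. depth t j = h}. ancestors t j = B} = {t\<in>?L. ancestors t j = B}"
        by (auto simp: depth_def)
      then show "(\<Sum>t\<in>{t\<in>{t\<in>?L. depth t j = h}. ancestors t j = B}. F (ancestors t j) * weight \<phi> t)
          = F B * N B"
        by (simp add: N_def sum_distrib_left)
    qed
    also have "\<dots> = c * (\<Sum>B\<in>?\<B>. F B)"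
      by (simp add: c sum_distrib_left mult.commute)
    finally show ?thesis .
  qed
  then show ?thesis by blast
qed

lemma depth_less:
  assumes "t \<in> labelled_trees n" "j \<in> {1..n}"
  shows "depth t j \<le> n - 1"
proof -
  have "ancestors t j \<subseteq> {1..n} - {j}"
    using ancestors_subset[of t j] assms by (auto simp: labelled_trees_def)
  then have "depth t j \<le> card ({1..n} - {j})" unfolding depth_def by (rule card_mono[rotated]) simp
  then show ?thesis using assms by simp
qed

lemma inversions_eq:
  assumes "t \<in> labelled_trees n"
  shows "inversions t j = card (ancestors t j \<inter> {j<..n})"
proof -
  have "{i. i > j \<and> ancestor t i j} = ancestors t j \<inter> {j<..n}"
    using ancestors_subset[of t j] assms by (fastforce simp: labelled_trees_def ancestors_def)
  then show ?thesis by (simp add: inversions_def)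
qed

context
  fixes \<phi> :: "nat \<Rightarrow> real" and n :: nat
  assumes \<phi>: "\<And>l. \<phi> l \<ge> 0" and pos: "total_weight \<phi> n > 0"
begin

lemma expectation_random_tree:
  fixes f :: "nat otree \<Rightarrow> real"
  shows "measure_pmf.expectation (random_tree \<phi> n) f
    = (\<Sum>t\<in>labelled_trees n. f t * weight \<phi> t) / total_weight \<phi> n"
proof -
  have "measure_pmf.expectation (random_tree \<phi> n) f
      = (\<Sum>t\<in>labelled_trees n. f t * pmf (random_tree \<phi> n) t)"
    by (rule integral_measure_pmf_real)
       (auto simp: finite_labelled_trees set_pmf_eq pmf_random_tree[OF \<phi> pos] split: if_splits)
  then show ?thesis by (simp add: pmf_random_tree[OF \<phi> pos] sum_divide_distrib)
qed

text \<open>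
  Inversions at \<open>j\<close> count the labels above \<open>j\<close> in the ancestor set. There are \<open>n - j\<close> such labels
  among the \<open>n - 1\<close> candidates, so a uniform ancestor set of given size leads to a hypergeometric law.
\<close>

theorem inversions_mixed_hypergeometric:
  assumes j: "j \<in> {1..n}"
  shows "map_pmf (\<lambda>t. inversions t j) (random_tree \<phi> n)
    = bind_pmf (random_tree \<phi> n) (\<lambda>t. hypergeometric (n - 1) (n - j) (depth t j))"
proof (rule pmf_eqI)
  fix k
  let ?L = "labelled_trees n" and ?H = "\<lambda>h. pmf (hypergeometric (n - 1) (n - j) h) k"
  have eq: "(\<Sum>t\<in>{t\<in>?L. depth t j = h}. indicator {k} (inversions t j) * weight \<phi> t)
    = (\<Sum>t\<in>{t\<in>?L. depth t j = h}. ?H h * weight \<phi> t)" if h: "h \<le> n - 1" for h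
  proof -
    let ?U = "{1..n} - {j}" and ?G = "{j<..n}"
    let ?\<B> = "{B. B \<subseteq> ?U \<and> card B = h}"
    have finB: "finite ?\<B>" by (rule finite_subset[of _ "Pow ?U"]) auto
    obtain c where c: "\<And>F. (\<Sum>t\<in>{t\<in>?L. depth t j = h}. F (ancestors t j) * weight \<phi> t)
      = c * (\<Sum>B\<in>?\<B>. F B)"
      using sum_by_ancestor_set[OF j] by blast
    have "(\<Sum>t\<in>{t\<in>?L. depth t j = h}. indicator {k} (inversions t j) * weight \<phi> t)
      = (\<Sum>t\<in>{t\<in>?L. depth t j = h}. indicator {k} (card (ancestors t j \<inter> ?G)) * weight \<phi> t)"
      by (intro sum.cong) (auto simp: inversions_eq)
    also have "\<dots> = c * (\<Sum>B\<in>?\<B>. indicator {k} (card (B \<inter> ?G)))"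
      by (rule c)
    also have "(\<Sum>B\<in>?\<B>. indicator {k} (card (B \<inter> ?G)) :: real)
        = real (card {B. B \<subseteq> ?U \<and> card B = h \<and> card (B \<inter> ?G) = k})"
    proof -
      have "{B. B \<subseteq> ?U \<and> card B = h \<and> card (B \<inter> ?G) = k} = {B\<in>?\<B>. card (B \<inter> ?G) = k}" by auto
      then show ?thesis using finB by (simp add: indicator_def sum.If_cases Int_def conj_ac)
    qed
    also have "\<dots> = ?H h * real ((n - 1) choose h)"
    proof (cases "k \<le> h")
      case True
      have le: "n - j \<le> n - 1" using j by (intro diff_le_mono2) simp
      have "?U - ?G = {1..<j}" using j by auto
      then have "card (?U - ?G) = n - 1 - (n - j)" using j by simp
      moreover have "?G \<subseteq> ?U" by auto
      ultimately have "card {B. B \<subseteq> ?U \<and> card B = h \<and> card (B \<inter> ?G) = k}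
          = ((n - j) choose k) * ((n - 1 - (n - j)) choose (h - k))"
        using card_subsets_inter[of ?U ?G k h] True by simp
      then show ?thesis using True h le by (simp only: pmf_hypergeometric if_True) simp
    next
      case False
      have le: "n - j \<le> n - 1" using j by (intro diff_le_mono2) simp
      have none: "{B. B \<subseteq> ?U \<and> card B = h \<and> card (B \<inter> ?G) = k} = {}"
      proof safe
        fix B assume "B \<subseteq> ?U" "h = card B" "k = card (B \<inter> ?G)"
        moreover have "finite B" using \<open>B \<subseteq> ?U\<close> finite_subset by blast
        ultimately show "B \<in> {}" using False card_mono[of B "B \<inter> ?G"] by auto
      qed
      show ?thesis unfolding none using False h le
        by (simp only: pmf_hypergeometric if_False) simp
    qed
    also have "c * (?H h * real ((n - 1) choose h)) = ?H h * (c * (\<Sum>B\<in>?\<B>. 1))"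
    proof -
      have "(\<Sum>B\<in>?\<B>. 1 :: real) = real ((n - 1) choose h)"
        using j n_subsets[of ?U h] by simp
      then show ?thesis by (simp only: mult_ac)
    qed
    also have "\<dots> = ?H h * (\<Sum>t\<in>{t\<in>?L. depth t j = h}. 1 * weight \<phi> t)"
      by (simp only: c[of "\<lambda>_. 1"])
    finally show ?thesis by (simp add: sum_distrib_left)
  qed
  have grp: "(\<Sum>t\<in>?L. g t) = (\<Sum>h\<le>n-1. \<Sum>t\<in>{t\<in>?L. depth t j = h}. g t)" for g :: "nat otree \<Rightarrow> real"
    by (rule sum.group[symmetric]) (use depth_less j in \<open>auto simp: finite_labelled_trees\<close>)
  have "pmf (map_pmf (\<lambda>t. inversions t j) (random_tree \<phi> n)) k
     = measure_pmf.expectation (random_tree \<phi> n) (\<lambda>t. indicator {k} (inversions t j))"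
    unfolding map_pmf_def pmf_bind by (simp add: pmf_return indicator_def eq_commute)
  also have "\<dots> = (\<Sum>t\<in>?L. indicator {k} (inversions t j) * weight \<phi> t) / total_weight \<phi> n"
    by (rule expectation_random_tree)
  also have "(\<Sum>t\<in>?L. indicator {k} (inversions t j) * weight \<phi> t) = (\<Sum>t\<in>?L. ?H (depth t j) * weight \<phi> t)"
  proof -
    have "(\<Sum>t\<in>?L. indicator {k} (inversions t j) * weight \<phi> t)
      = (\<Sum>h\<le>n-1. \<Sum>t\<in>{t\<in>?L. depth t j = h}. indicator {k} (inversions t j) * weight \<phi> t)"
      by (rule grp)
    also have "\<dots> = (\<Sum>h\<le>n-1. \<Sum>t\<in>{t\<in>?L. depth t j = h}. ?H h * weight \<phi> t)"
      by (rule sum.cong[OF refl], rule eq) simp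
    also have "\<dots> = (\<Sum>h\<le>n-1. \<Sum>t\<in>{t\<in>?L. depth t j = h}. ?H (depth t j) * weight \<phi> t)"
      by (intro sum.cong refl) simp
    also have "\<dots> = (\<Sum>t\<in>?L. ?H (depth t j) * weight \<phi> t)"
      by (rule grp[symmetric])
    finally show ?thesis .
  qed
  also have "\<dots> / total_weight \<phi> n = pmf (bind_pmf (random_tree \<phi> n) (\<lambda>t. hypergeometric (n - 1) (n - j) (depth t j))) k"
    by (simp only: pmf_bind expectation_random_tree)
  finally show "pmf (map_pmf (\<lambda>t. inversions t j) (random_tree \<phi> n)) k = \<dots>" .
qed

text \<open>
  By symmetry all labels have the same depth distribution, so the probability for \<open>j\<close> is the average
  over all vertices, which is a ratio of two coefficients.
\<close>

theorem depth_tail: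
  assumes j: "j \<in> {1..n}"
  shows "measure_pmf.prob (random_tree \<phi> n) {t. h \<le> depth t j} = deep_gf \<phi> h $ n / deep_gf \<phi> 0 $ n"
proof -
  let ?L = "labelled_trees n"
  have prob: "measure_pmf.prob (random_tree \<phi> n) {t. h \<le> depth t i}
     = (\<Sum>t\<in>?L. of_bool (h \<le> depth t i) * weight \<phi> t) / total_weight \<phi> n" for i
  proof -
    have "measure_pmf.prob (random_tree \<phi> n) {t. h \<le> depth t i}
       = measure_pmf.expectation (random_tree \<phi> n) (\<lambda>t. of_bool (h \<le> depth t i))"
    proof -
      have "(\<lambda>t. of_bool (h \<le> depth t i) :: real) = indicator {t. h \<le> depth t i}"
        by (auto simp: indicator_def)
      then show ?thesis by simp
    qed
    then show ?thesis by (simp add: expectation_random_tree)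
  qed
  have sym: "measure_pmf.prob (random_tree \<phi> n) {t. h \<le> depth t i}
     = measure_pmf.prob (random_tree \<phi> n) {t. h \<le> depth t j}" if i: "i \<in> {1..n}" for i
  proof -
    define \<pi> where "\<pi> = Transposition.transpose i j"
    have \<pi>: "\<pi> permutes {1..n}" unfolding \<pi>_def using i j by (rule permutes_swap_id)
    have "depth (map_otree \<pi> t) i = depth t j" for t :: "nat otree"
      using depth_map_otree[OF permutes_bij[OF \<pi>], of t j] by (simp add: \<pi>_def)
    then show ?thesis unfolding prob by (subst sum_relabel[OF \<pi>]) simp
  qed
  have "real n * measure_pmf.prob (random_tree \<phi> n) {t. h \<le> depth t j}
     = (\<Sum>i\<in>{1..n}. measure_pmf.prob (random_tree \<phi> n) {t. h \<le> depth t i})"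
    using sym by simp
  also have "\<dots> = (\<Sum>t\<in>?L. weight \<phi> t * (\<Sum>i\<in>{1..n}. of_bool (h \<le> depth t i))) / total_weight \<phi> n"
    unfolding prob sum_divide_distrib[symmetric] sum_distrib_left by (subst sum.swap) (simp add: mult.commute)
  also have "(\<Sum>t\<in>?L. weight \<phi> t * (\<Sum>i\<in>{1..n}. of_bool (h \<le> depth t i))) = (\<Sum>t\<in>?L. weight \<phi> t * real (num_deep h t))"
  proof (intro sum.cong refl)
    fix t assume t: "t \<in> ?L"
    have "card {i\<in>{1..n}. h \<le> depth t i} = num_deep h t"
      using card_deep_vertices[of t h] t by (simp add: labelled_trees_def)
    then have "(\<Sum>i\<in>{1..n}. of_bool (h \<le> depth t i)) = real (num_deep h t)"
      by (simp add: of_bool_def sum.If_cases Int_def conj_ac)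
    then show "weight \<phi> t * (\<Sum>i\<in>{1..n}. of_bool (h \<le> depth t i)) = weight \<phi> t * real (num_deep h t)" by simp
  qed
  also have "\<dots> / total_weight \<phi> n = deep_gf \<phi> h $ n / tree_gf \<phi> $ n"
    by (simp add: sum_weight_deep total_weight_eq)
  finally have eq: "real n * measure_pmf.prob (random_tree \<phi> n) {t. h \<le> depth t j}
     = deep_gf \<phi> h $ n / tree_gf \<phi> $ n" .
  have "deep_gf \<phi> 0 $ n = real n * tree_gf \<phi> $ n"
    using j by (cases n) (simp_all add: deep_gf_0_eq)
  moreover have "measure_pmf.prob (random_tree \<phi> n) {t. h \<le> depth t j}
     = real n * measure_pmf.prob (random_tree \<phi> n) {t. h \<le> depth t j} / real n"
    using j by simp
  ultimately show ?thesis unfolding eq by simp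
qed

end

section \<open>Power series on the unit circle\<close>

text \<open>
  The logarithm of the left-hand side is \<open>k * z\<close> times \<open>Ln (1 + z) / z\<close>, and the quotient tends to 1.
\<close>

lemma power_tendsto_exp:
  fixes z :: "nat \<Rightarrow> complex" and k :: "nat \<Rightarrow> nat"
  assumes kz: "(\<lambda>m. of_nat (k m) * z m) \<longlonglongrightarrow> w" and z: "z \<longlonglongrightarrow> 0"
  shows "(\<lambda>m. (1 + z m) ^ k m) \<longlonglongrightarrow> exp w"
proof -
  define g where "g h = (if h = 0 then 1 else Ln (1 + h) / h)" for h :: complex
  have "((\<lambda>h. Ln (1 + h)) has_field_derivative 1) (at 0)"
    by (auto intro!: derivative_eq_intros simp: complex_nonpos_Reals_iff)
  then have "((\<lambda>h. Ln (1 + h) / h) \<longlongrightarrow> 1) (at 0)"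
    by (simp add: DERIV_def)
  then have "(g \<longlongrightarrow> 1) (at 0)"
    by (rule Lim_transform_eventually) (auto simp: g_def eventually_at_filter)
  moreover have "g 0 = 1" by (simp add: g_def)
  ultimately have "(g \<longlongrightarrow> g 0) (at 0)" by simp
  then have "(\<lambda>m. g (z m)) \<longlonglongrightarrow> g 0"
    by (intro isCont_tendsto_compose[OF _ z]) (simp add: isCont_def)
  then have "(\<lambda>m. exp ((of_nat (k m) * z m) * g (z m))) \<longlonglongrightarrow> exp (w * 1)"
    by (intro tendsto_intros kz) (simp add: g_def)
  moreover have "eventually (\<lambda>m. norm (z m) < 1) sequentially"
    using tendstoD[OF z, of 1] by (simp add: dist_norm)
  then have "eventually (\<lambda>m. exp ((of_nat (k m) * z m) * g (z m)) = (1 + z m) ^ k m) sequentially"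
  proof eventually_elim
    case (elim m)
    then have ne: "1 + z m \<noteq> 0" by (metis add.inverse_unique norm_minus_cancel norm_one order_less_irrefl)
    have "z m * g (z m) = Ln (1 + z m)" by (simp add: g_def)
    then have "exp ((of_nat (k m) * z m) * g (z m)) = exp (of_nat (k m) * Ln (1 + z m))"
      by (simp add: mult.assoc)
    then show ?case using ne by (simp add: exp_of_nat_mult)
  qed
  ultimately show ?thesis by (auto intro: Lim_transform_eventually)
qed

text \<open>
  If the coefficients form a probability distribution, this is its characteristic function.
\<close>

definition circle_val :: "real fps \<Rightarrow> real \<Rightarrow> complex" where
  "circle_val f t = eval_fps (Abs_fps (\<lambda>n. complex_of_real (f $ n))) (cis t)"

lemma fps_conv_radius_complex:
  "fps_conv_radius (Abs_fps (\<lambda>n. complex_of_real (f $ n))) = fps_conv_radius f"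
  by (simp add: fps_conv_radius_def conv_radius_def)

lemma fps_complex_mult: "Abs_fps (\<lambda>n. complex_of_real ((f * g) $ n))
    = Abs_fps (\<lambda>n. complex_of_real (f $ n)) * Abs_fps (\<lambda>n. complex_of_real (g $ n))"
  by (rule fps_ext) (simp add: fps_mult_nth)

lemma circle_val_mult:
  assumes "fps_conv_radius f > 1" "fps_conv_radius g > 1"
  shows "circle_val (f * g) t = circle_val f t * circle_val g t"
  unfolding circle_val_def fps_complex_mult
  by (rule eval_fps_mult) (use assms in \<open>auto simp: fps_conv_radius_complex one_ereal_def\<close>)

lemma fps_conv_radius_mult_gt:
  assumes "fps_conv_radius f > r" "fps_conv_radius g > r"
  shows "fps_conv_radius (f * g) > r"
  using assms fps_conv_radius_mult[of f g] by (meson less_le_trans min_less_iff_conj)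

lemma fps_conv_radius_power_gt:
  assumes "fps_conv_radius f > r" shows "fps_conv_radius (f ^ n) > r"
  using assms fps_conv_radius_power[of f n] by (meson less_le_trans)

lemma circle_val_power:
  assumes "fps_conv_radius f > 1"
  shows "circle_val (f ^ n) t = circle_val f t ^ n"
proof (induction n)
  case 0
  have "Abs_fps (\<lambda>n. complex_of_real ((1 :: real fps) $ n)) = 1" by (rule fps_ext) auto
  then show ?case by (simp add: circle_val_def)
next
  case (Suc n)
  then show ?case using assms by (simp add: circle_val_mult fps_conv_radius_power_gt)
qed

lemma summable_coeffs:
  fixes f :: "real fps"
  assumes "fps_conv_radius f > 1"
  shows "summable (\<lambda>k. \<bar>f $ k\<bar>)"
  using norm_summable_fps[of 1 f] assms by (simp add: one_ereal_def)

lemma circle_val_sums: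
  assumes "fps_conv_radius f > 1"
  shows "(\<lambda>k. complex_of_real (f $ k) * cis (real k * t)) sums circle_val f t"
  using sums_eval_fps[of "cis t" "Abs_fps (\<lambda>n. complex_of_real (f $ n))"] assms
  by (simp add: fps_conv_radius_complex one_ereal_def circle_val_def Complex.DeMoivre)

lemma continuous_circle_val:
  assumes "fps_conv_radius f > 1"
  shows "continuous_on A (circle_val f)"
  unfolding circle_val_def
  by (intro continuous_on_compose2[OF continuous_on_eval_fps] continuous_intros)
     (use assms in \<open>auto simp: fps_conv_radius_complex one_ereal_def in_eball_iff\<close>)

lemma integral_cis:
  fixes k m d :: nat
  assumes d: "d > 0" "d dvd k" "d dvd m"
  shows "(LBINT t:{-pi/d..pi/d}. cis (real k * t) * cis (- (real m * t))) = (if k = m then 2 * pi / d else 0)"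
proof (cases "k = m")
  case True
  then show ?thesis using d by (simp add: cis_mult set_lebesgue_integral_def scaleR_conv_of_real)
next
  case False
  define a where "a = real k - real m"
  have a: "a \<noteq> 0" using False by (simp add: a_def)
  have eq: "cis (real k * t) * cis (- (real m * t)) = cis (a * t)" for t
    by (simp add: cis_mult a_def algebra_simps)
  have "(LBINT t:{-pi/d..pi/d}. cis (a * t)) = cis (a * (pi / d)) / (\<i> * a) - cis (a * (- pi / d)) / (\<i> * a)"
    unfolding set_lebesgue_integral_def
  proof (rule integral_FTC_atLeastAtMost)
    show "- pi / real d \<le> pi / real d" by simp
    fix t
    show "((\<lambda>t. cis (a * t) / (\<i> * a)) has_vector_derivative cis (a * t)) (at t within {- pi / real d..pi / real d})"
    proof -
      have "((\<lambda>z. exp (\<i> * (of_real a * z)) / (\<i> * a)) has_field_derivative exp (\<i> * (of_real a * of_real t)))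
          (at (of_real t))"
        by (auto intro!: derivative_eq_intros simp: a complex_eq_iff)
      from has_vector_derivative_real_field[OF this] show ?thesis by (simp add: cis_conv_exp)
    qed
  qed (intro continuous_intros)
  also have "\<dots> = 0"
  proof -
    obtain q r where "k = d * q" "m = d * r" using d by (auto elim!: dvdE)
    then have "a * (pi / d) = pi * of_int (int q - int r)" using d by (simp add: a_def field_simps)
    then have "sin (a * (pi / d)) = 0" by (simp only: sin_npi_int)
    then have "cis (a * (pi / d)) = cis (a * (- pi / d))" by (simp add: complex_eq_iff)
    then show ?thesis by simp
  qed
  finally show ?thesis using False by (simp add: eq)
qed

text \<open>
  A series supported on the multiples of \<open>d\<close> is periodic with period \<open>2 * pi / d\<close> on the circle, so
  integrating over one period already recovers its coefficients. On this smaller interval the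
  characteristic function of a distribution of span \<open>d\<close> with an atom at 0 has modulus 1 only at 0.
\<close>

lemma fourier_coefficient:
  fixes f :: "real fps" and m d :: nat
  assumes rad: "fps_conv_radius f > 1" and d: "d > 0" "d dvd m"
    and supp: "\<And>k. f $ k \<noteq> 0 \<Longrightarrow> d dvd k"
  shows "(LBINT t:{-pi/d..pi/d}. circle_val f t * cis (- (real m * t))) = 2 * pi / d * f $ m"
proof -
  let ?I = "{-pi/d..pi/d}"
  define F where "F k t = indicator ?I t *\<^sub>R (complex_of_real (f $ k) * (cis (real k * t) * cis (- (real m * t))))" for k t
  have int: "integrable lborel (F k)" for k
    unfolding F_def
    by (rule borel_integrable_atLeastAtMost'[unfolded set_integrable_def]) (intro continuous_intros)
  have nrm: "norm (F k t) = indicator ?I t * \<bar>f $ k\<bar>" for k t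
    by (simp add: F_def norm_mult indicator_def)
  have "(\<lambda>k. integral\<^sup>L lborel (F k)) sums (\<integral>t. (\<Sum>k. F k t) \<partial>lborel)"
  proof (rule sums_integral[OF int])
    show "AE t in lborel. summable (\<lambda>k. norm (F k t))"
      unfolding nrm by (intro AE_I2 summable_mult summable_coeffs rad)
    show "summable (\<lambda>k. \<integral>t. norm (F k t) \<partial>lborel)"
      unfolding nrm by (simp add: summable_mult summable_coeffs rad)
  qed
  moreover have "(\<Sum>k. F k t) = indicator ?I t *\<^sub>R (circle_val f t * cis (- (real m * t)))" for t
  proof -
    have "(\<lambda>k. F k t) sums (indicator ?I t *\<^sub>R (circle_val f t * cis (- (real m * t))))"
      unfolding F_def mult.assoc[symmetric]
      by (intro sums_scaleR_right sums_mult2 circle_val_sums rad)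
    then show ?thesis by (simp add: sums_iff)
  qed
  moreover have "integral\<^sup>L lborel (F k) = (if k = m then 2 * pi / d * f $ m else 0)" for k
  proof (cases "f $ k = 0")
    case False
    have "integral\<^sup>L lborel (F k) = f $ k * (LBINT t:?I. cis (real k * t) * cis (- (real m * t)))"
      unfolding F_def set_lebesgue_integral_def scaleR_conv_of_real
      by (subst integral_mult_right_zero[symmetric]) (simp add: mult_ac)
    then show ?thesis using integral_cis[OF d(1) supp[OF False] d(2)] by simp
  next
    case True
    then have "F k = (\<lambda>_. 0)" by (auto simp: F_def)
    then show ?thesis using True by auto
  qed
  ultimately have "(\<lambda>k. complex_of_real (if k = m then 2 * pi / d * f $ m else 0)) sums
      (LBINT t:?I. circle_val f t * cis (- (real m * t)))"
    by (simp add: set_lebesgue_integral_def)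
  moreover have "(\<lambda>k. complex_of_real (if k = m then 2 * pi / d * f $ m else 0)) sums complex_of_real (2 * pi / d * f $ m)"
  proof -
    have "(\<lambda>k. complex_of_real (if k = m then 2 * pi / d * f $ m else 0))
        = (\<lambda>k. if k = m then complex_of_real (2 * pi / d * f $ m) else 0)" by auto
    then show ?thesis by (simp only:) (rule sums_single)
  qed
  ultimately show ?thesis by (rule sums_unique2)
qed

lemma fps_support_mult:
  fixes f g :: "real fps"
  assumes "\<And>k. f $ k \<noteq> 0 \<Longrightarrow> d dvd k" "\<And>k. g $ k \<noteq> 0 \<Longrightarrow> d dvd k" "(f * g) $ k \<noteq> 0"
  shows "d dvd k"
proof -
  obtain i where "i \<in> {0..k}" "f $ i * g $ (k - i) \<noteq> 0"
    using assms(3) unfolding fps_mult_nth by (meson sum.not_neutral_contains_not_neutral)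
  then have "d dvd i" "d dvd k - i" "i \<le> k" using assms(1,2) by auto
  then show ?thesis by (metis dvd_add le_add_diff_inverse)
qed

lemma fps_support_power:
  fixes f :: "real fps"
  assumes "\<And>k. f $ k \<noteq> 0 \<Longrightarrow> d dvd k" "(f ^ n) $ k \<noteq> 0"
  shows "d dvd k"
  using assms(2)
proof (induction n arbitrary: k)
  case 0 then show ?case by (cases k) auto
next
  case (Suc n)
  then show ?case using fps_support_mult[of f d "f ^ n" k] assms(1) by auto
qed

text \<open>
  \<open>X * d/dX\<close> multiplies the \<open>k\<close>-th coefficient by \<open>k\<close> and does not decrease the radius of convergence.
\<close>

lemma summable_moments:
  fixes p :: "nat \<Rightarrow> real"
  assumes "conv_radius p > 1"
  shows "summable (\<lambda>k. \<bar>real k ^ r * p k\<bar>)"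
proof -
  have "fps_conv_radius (Abs_fps (\<lambda>k. real k ^ r * p k)) > 1"
  proof (induction r)
    case 0 then show ?case using assms by (simp add: fps_conv_radius_def)
  next
    case (Suc r)
    have "Abs_fps (\<lambda>k. real k ^ Suc r * p k) = fps_X * fps_deriv (Abs_fps (\<lambda>k. real k ^ r * p k))"
      by (rule fps_ext) (auto simp: fps_X_mult_nth mult_ac)
    then show ?case
      using Suc fps_conv_radius_deriv[of "Abs_fps (\<lambda>k. real k ^ r * p k)"]
      by (auto intro!: fps_conv_radius_mult_gt simp: less_le_trans)
  qed
  then show ?thesis using summable_coeffs by fastforce
qed


section \<open>Characteristic functions of a critical distribution\<close>

lemma cis_taylor1: "norm (cis y - (1 + \<i> * y)) \<le> y\<^sup>2 / 2"
  using iexp_approx1[of y 1] by (simp add: cis_conv_exp power2_eq_square abs_mult)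

lemma cis_taylor2: "norm (cis y - (1 + \<i> * y - y\<^sup>2 / 2)) \<le> \<bar>y\<bar> ^ 3 / 6"
  using iexp_approx1[of y 2]
  by (simp add: cis_conv_exp power_mult_distrib numeral_3_eq_3 eval_nat_numeral algebra_simps)

lemma cis_eq_1_small:
  assumes "cis x = 1" "\<bar>x\<bar> \<le> pi"
  shows "x = 0"
proof -
  have "cos x = 1" using assms(1) by (simp add: complex_eq_iff)
  then obtain n :: int where n: "x = of_int n * 2 * pi" using cos_one_2pi_int by blast
  have "\<bar>real_of_int n\<bar> * (2 * pi) \<le> 1/2 * (2 * pi)" using assms(2) by (simp add: n abs_mult)
  then have "\<bar>real_of_int n\<bar> \<le> 1/2" by (subst (asm) mult_le_cancel_right) (use pi_gt_zero in linarith)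
  then have "n = 0" by linarith
  then show ?thesis by (simp add: n)
qed

text \<open>
  The frequencies \<open>k\<close> with \<open>cis (k * t) = 1\<close> are the multiples of the least positive one, which
  therefore divides the greatest common divisor of \<open>S\<close>.
\<close>

lemma cis_Gcd_eq_1:
  fixes S :: "nat set"
  assumes S: "\<And>k. k \<in> S \<Longrightarrow> cis (real k * t) = 1" and ne: "Gcd S > 0"
  shows "cis (real (Gcd S) * t) = 1"
proof -
  let ?K = "{k. k > 0 \<and> cis (real k * t) = 1}"
  have "\<exists>k\<in>S. k \<noteq> 0"
  proof (rule ccontr)
    assume "\<not> ?thesis"
    then have "S \<subseteq> {0}" by auto
    then have "Gcd S = 0" by (rule Gcd_0_iff[THEN iffD2])
    with ne show False by linarith
  qed
  then have "\<exists>k. k \<in> ?K" using S by auto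
  define g where "g = (LEAST k. k \<in> ?K)"
  have g: "g > 0" "cis (real g * t) = 1" using LeastI_ex[OF \<open>\<exists>k. k \<in> ?K\<close>] by (auto simp: g_def)
  have min: "\<not> k < g" if "k > 0" "cis (real k * t) = 1" for k
    using not_less_Least[of k "\<lambda>k. k \<in> ?K"] that by (auto simp: g_def)
  have mult: "cis (real (g * q) * t) = 1" for q
    using Complex.DeMoivre[of "real g * t" q] g by (simp add: mult_ac)
  have "g dvd k" if "k \<in> S" for k
  proof -
    have "real k = real (k mod g) + real (g * (k div g))"
      by (simp only: of_nat_add[symmetric] mod_mult_div_eq)
    from arg_cong[OF this, of "\<lambda>x. x * t"]
    have "real k * t = real (k mod g) * t + real (g * (k div g)) * t"
      by (simp only: distrib_right)
    then have "cis (real k * t) = cis (real (k mod g) * t) * cis (real (g * (k div g)) * t)"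
      by (simp only: cis_mult)
    then have "cis (real (k mod g) * t) = 1" using S[OF that] by (simp only: mult mult_1_right)
    then have "k mod g = 0" using min[of "k mod g"] g(1) by (meson mod_less_divisor neq0_conv)
    then show ?thesis by auto
  qed
  then have "g dvd Gcd S" by (rule Gcd_greatest)
  then obtain q where "Gcd S = g * q" by (auto elim: dvdE)
  then show ?thesis using mult by simp
qed

text \<open>
  An offspring distribution with mean 1 and some exponential moment; \<open>s2\<close> is its variance and \<open>d\<close> the
  span of its lattice. \<open>P\<close> is its generating function and \<open>Q\<close> that of the size-biased distribution.
\<close>

locale critical_distribution =
  fixes p :: "nat \<Rightarrow> real"
  assumes p_nonneg: "p k \<ge> 0" and p_0: "p 0 > 0"
    and radius: "conv_radius p > 1"
    and sums_1: "p sums 1" and mean_1: "(\<lambda>k. real k * p k) sums 1"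
begin

definition s2 :: real where "s2 = (\<Sum>k. (real k - 1)\<^sup>2 * p k)"
definition d :: nat where "d = Gcd {k. p k > 0}"
definition P :: "real fps" where "P = Abs_fps p"
definition Q :: "real fps" where "Q = fps_X * fps_deriv P"

lemma Q_nth: "Q $ k = real k * p k"
  by (cases k) (auto simp: Q_def P_def)

lemma radius_P: "fps_conv_radius P > 1"
  using radius by (simp add: P_def fps_conv_radius_def)

lemma radius_Q: "fps_conv_radius Q > 1"
  unfolding Q_def using radius_P fps_conv_radius_deriv[of P]
  by (auto intro!: fps_conv_radius_mult_gt simp: less_le_trans)

lemma moment: "summable (\<lambda>k. real k ^ r * p k)"
  using summable_moments[OF radius, of r] by (rule summable_rabs_cancel)

lemma centred_moment: "summable (\<lambda>k. \<bar>real k - 1\<bar> ^ r * p k)"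
proof (rule summable_comparison_test)
  have "norm (\<bar>real k - 1\<bar> ^ r * p k) \<le> real k ^ r * p k + p k" for k
  proof (cases k)
    case (Suc l)
    have "real l ^ r \<le> (1 + real l) ^ r" by (rule power_mono) auto
    then have "real l ^ r * p k \<le> (1 + real l) ^ r * p k" by (rule mult_right_mono) (rule p_nonneg)
    then show ?thesis using Suc p_nonneg[of k] by (simp add: abs_mult)
  qed (auto simp: p_nonneg)
  then show "\<exists>N. \<forall>k\<ge>N. norm (\<bar>real k - 1\<bar> ^ r * p k) \<le> real k ^ r * p k + p k" by blast
  show "summable (\<lambda>k. real k ^ r * p k + p k)"
    using moment[of r] sums_1 by (intro summable_add) (auto simp: sums_iff)
qed

lemma variance_sums: "(\<lambda>k. (real k - 1)\<^sup>2 * p k) sums s2"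
  using centred_moment[of 2] by (simp add: s2_def summable_sums)

lemma s2_pos: "s2 > 0"
  unfolding s2_def
  by (rule suminf_pos2[of _ 0]) (use variance_sums p_nonneg p_0 in \<open>auto simp: sums_iff\<close>)

lemma d_dvd: "p k \<noteq> 0 \<Longrightarrow> d dvd k"
  unfolding d_def using p_nonneg[of k] by (intro Gcd_dvd) auto

lemma d_pos: "d > 0"
proof (rule ccontr)
  assume "\<not> d > 0"
  then have "real k * p k = 0" for k using d_dvd[of k] by auto
  then have "(\<lambda>k. real k * p k) = (\<lambda>_. 0)" by blast
  then show False using mean_1 by (simp add: sums_iff)
qed

text \<open>
  \<open>A\<close> is the characteristic function of \<open>\<xi> - 1\<close> and \<open>B\<close> that of \<open>\<xi>\<^sup>* - 1\<close>, where \<open>\<xi>\<close> has law \<open>p\<close> and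
  \<open>\<xi>\<^sup>*\<close> the size-biased law \<open>k * p k\<close>. The shift is 1 for both, so \<open>B\<close> has the drift
  \<open>E \<xi>\<^sup>* - 1 = s2\<close>; it is this drift that makes deep vertices unlikely.
\<close>
definition A :: "real \<Rightarrow> complex" where "A t = circle_val P t * cis (- t)"
definition B :: "real \<Rightarrow> complex" where "B t = circle_val Q t * cis (- t)"

lemma A_sums: "(\<lambda>k. complex_of_real (p k) * cis ((real k - 1) * t)) sums A t"
proof -
  have "complex_of_real (P $ k) * cis (real k * t) * cis (- t) = complex_of_real (p k) * cis ((real k - 1) * t)" for k
    by (simp add: P_def mult.assoc cis_mult) (simp add: algebra_simps)
  then show ?thesis
    using sums_mult2[OF circle_val_sums[OF radius_P], of t "cis (- t)"] by (simp only: A_def)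
qed

lemma B_sums: "(\<lambda>k. complex_of_real (real k * p k) * cis ((real k - 1) * t)) sums B t"
proof -
  have "complex_of_real (Q $ k) * cis (real k * t) * cis (- t) = complex_of_real (real k * p k) * cis ((real k - 1) * t)" for k
    by (simp add: Q_nth mult.assoc cis_mult) (simp add: algebra_simps)
  then show ?thesis
    using sums_mult2[OF circle_val_sums[OF radius_Q], of t "cis (- t)"] by (simp only: B_def)
qed

lemma norm_A_le: "norm (A t) \<le> 1"
  using norm_suminf_le[of "\<lambda>k. complex_of_real (p k) * cis ((real k - 1) * t)" p] A_sums[of t] sums_1 p_nonneg
  by (simp add: sums_iff norm_mult)

lemma norm_B_le: "norm (B t) \<le> 1"
  using norm_suminf_le[of "\<lambda>k. complex_of_real (real k * p k) * cis ((real k - 1) * t)" "\<lambda>k. real k * p k"]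
    B_sums[of t] mean_1 p_nonneg
  by (simp add: sums_iff norm_mult)

lemma continuous_A: "continuous_on X A" and continuous_B: "continuous_on X B"
  unfolding A_def[abs_def] B_def[abs_def]
  by (intro continuous_intros continuous_circle_val radius_P radius_Q)+

lemma A_taylor: "\<exists>C\<ge>0. \<forall>t. norm (A t - (1 - s2 * t\<^sup>2 / 2)) \<le> C * \<bar>t\<bar> ^ 3"
proof -
  define C where "C = (\<Sum>k. \<bar>real k - 1\<bar> ^ 3 * p k) / 6"
  have "norm (A t - (1 - s2 * t\<^sup>2 / 2)) \<le> C * \<bar>t\<bar> ^ 3" for t
  proof -
    let ?y = "\<lambda>k. (real k - 1) * t"
    have "(\<lambda>k. complex_of_real (p k) + \<i> * complex_of_real (t * (real k * p k - p k)) - complex_of_real (t\<^sup>2 / 2 * ((real k - 1)\<^sup>2 * p k)))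
       sums (complex_of_real 1 + \<i> * complex_of_real (t * (1 - 1)) - complex_of_real (t\<^sup>2 / 2 * s2))"
      by (intro sums_add sums_diff sums_mult sums_of_real sums_1 mean_1 variance_sums)
    note S2 = this
    have eq: "complex_of_real (p k) * cis (?y k) - (complex_of_real (p k)
          + \<i> * complex_of_real (t * (real k * p k - p k)) - complex_of_real (t\<^sup>2 / 2 * ((real k - 1)\<^sup>2 * p k)))
        = complex_of_real (p k) * (cis (?y k) - (1 + \<i> * ?y k - (?y k)\<^sup>2 / 2))" for k
      by (simp add: power2_eq_square field_simps)
    have sums: "(\<lambda>k. complex_of_real (p k) * (cis (?y k) - (1 + \<i> * ?y k - (?y k)\<^sup>2 / 2)))
        sums (A t - (1 - s2 * t\<^sup>2 / 2))"
      using sums_diff[OF A_sums[of t] S2] unfolding eq by (simp add: mult.commute)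
    have bound: "norm (complex_of_real (p k) * (cis (?y k) - (1 + \<i> * ?y k - (?y k)\<^sup>2 / 2)))
        \<le> \<bar>t\<bar> ^ 3 / 6 * (\<bar>real k - 1\<bar> ^ 3 * p k)" for k
      using mult_left_mono[OF cis_taylor2[of "?y k"] p_nonneg[of k]] p_nonneg[of k]
      by (simp add: norm_mult abs_mult power_mult_distrib mult_ac)
    have "norm (\<Sum>k. complex_of_real (p k) * (cis (?y k) - (1 + \<i> * ?y k - (?y k)\<^sup>2 / 2)))
      \<le> (\<Sum>k. \<bar>t\<bar> ^ 3 / 6 * (\<bar>real k - 1\<bar> ^ 3 * p k))"
      by (rule norm_suminf_le[OF bound]) (intro summable_mult centred_moment)
    also have "\<dots> = C * \<bar>t\<bar> ^ 3"
      unfolding C_def by (subst suminf_mult[OF centred_moment]) simp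
    finally show ?thesis using sums by (simp add: sums_iff)
  qed
  moreover have "C \<ge> 0"
    unfolding C_def by (intro divide_nonneg_pos suminf_nonneg centred_moment mult_nonneg_nonneg) (auto simp: p_nonneg)
  ultimately show ?thesis by blast
qed

lemma B_taylor: "\<exists>C\<ge>0. \<forall>t. norm (B t - (1 + \<i> * (s2 * t))) \<le> C * t\<^sup>2"
proof -
  have summ: "summable (\<lambda>k. (real k - 1)\<^sup>2 * (real k * p k))"
  proof -
    have "(\<lambda>k. (real k - 1)\<^sup>2 * (real k * p k)) = (\<lambda>k. real k ^ 3 * p k - 2 * (real k ^ 2 * p k) + real k * p k)"
      by (auto simp: fun_eq_iff power2_eq_square power3_eq_cube algebra_simps)
    then show ?thesis using moment[of 3] moment[of 2] mean_1
      by (auto intro!: summable_add summable_diff summable_mult simp: sums_iff)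
  qed
  define C where "C = (\<Sum>k. (real k - 1)\<^sup>2 * (real k * p k)) / 2"
  have size_biased: "(\<lambda>k. (real k - 1) * (real k * p k)) sums s2"
    using sums_add[OF variance_sums sums_diff[OF mean_1 sums_1]]
    by (simp add: power2_eq_square algebra_simps)
  have "norm (B t - (1 + \<i> * (s2 * t))) \<le> C * t\<^sup>2" for t
  proof -
    let ?y = "\<lambda>k. (real k - 1) * t"
    have "(\<lambda>k. complex_of_real (real k * p k) + \<i> * complex_of_real (t * ((real k - 1) * (real k * p k))))
       sums (complex_of_real 1 + \<i> * complex_of_real (t * s2))"
      by (intro sums_add sums_mult sums_of_real mean_1 size_biased)
    from sums_diff[OF B_sums[of t] this]
    have sums: "(\<lambda>k. complex_of_real (real k * p k) * (cis (?y k) - (1 + \<i> * ?y k)))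
        sums (B t - (1 + \<i> * (s2 * t)))"
      by (simp add: algebra_simps)
    have bound: "norm (complex_of_real (real k * p k) * (cis (?y k) - (1 + \<i> * ?y k)))
        \<le> t\<^sup>2 / 2 * ((real k - 1)\<^sup>2 * (real k * p k))" for k
      using mult_left_mono[OF cis_taylor1[of "?y k"], of "real k * p k"] p_nonneg[of k]
      by (simp add: norm_mult abs_mult power_mult_distrib mult_ac)
    have "norm (\<Sum>k. complex_of_real (real k * p k) * (cis (?y k) - (1 + \<i> * ?y k)))
      \<le> (\<Sum>k. t\<^sup>2 / 2 * ((real k - 1)\<^sup>2 * (real k * p k)))"
      by (rule norm_suminf_le[OF bound]) (intro summable_mult summ)
    also have "\<dots> = C * t\<^sup>2"
      unfolding C_def by (subst suminf_mult[OF summ]) simp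
    finally show ?thesis using sums by (simp add: sums_iff)
  qed
  moreover have "C \<ge> 0"
    unfolding C_def by (intro divide_nonneg_pos suminf_nonneg summ mult_nonneg_nonneg) (auto simp: p_nonneg)
  ultimately show ?thesis by blast
qed

text \<open>
  Equality in the triangle inequality forces all numbers \<open>cis (k * t)\<close> with \<open>p k > 0\<close> to be equal. One
  of them belongs to \<open>k = 0\<close>, so all are 1, and then \<open>cis (d * t) = 1\<close>.
\<close>

lemma norm_A_less:
  assumes "t \<noteq> 0" "\<bar>t\<bar> \<le> pi / d"
  shows "norm (A t) < 1"
proof (rule ccontr)
  assume "\<not> norm (A t) < 1"
  define S where "S = circle_val P t"
  have nS: "norm S = 1" using \<open>\<not> norm (A t) < 1\<close> norm_A_le[of t] by (simp add: A_def S_def norm_mult)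
  let ?f = "\<lambda>k. p k * (1 - Re (cnj S * cis (real k * t)))"
  have "(\<lambda>k. p k - Re (cnj S * (complex_of_real (p k) * cis (real k * t)))) sums (1 - Re (cnj S * S))"
    using circle_val_sums[OF radius_P, of t]
    by (intro sums_diff sums_1 sums_Re sums_mult) (simp add: P_def S_def)
  moreover have "Re (cnj S * S) = 1" using nS using complex_norm_square[of S] by (simp add: mult.commute del: times_complex.sel)
  ultimately have f0: "?f sums 0" by (simp add: algebra_simps)
  have le1: "Re (cnj S * cis (real k * t)) \<le> 1" for k
    using complex_Re_le_cmod[of "cnj S * cis (real k * t)"] nS by (simp add: norm_mult)
  have f_nonneg: "?f k \<ge> 0" for k using le1[of k] p_nonneg[of k] by simp
  have cis_eq: "cis (real k * t) = S" if "p k > 0" for k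
  proof -
    have "?f k = 0" using f0 f_nonneg suminf_eq_zero_iff[of ?f] by (auto simp: sums_iff)
    then have re: "Re (cnj S * cis (real k * t)) = 1" using that by simp
    moreover have "norm (cnj S * cis (real k * t)) = 1" using nS by (simp add: norm_mult)
    ultimately have "Im (cnj S * cis (real k * t)) = 0"
      using cmod_power2[of "cnj S * cis (real k * t)"] by (simp del: times_complex.sel)
    with re have "cnj S * cis (real k * t) = 1" by (simp add: complex_eq_iff del: times_complex.sel)
    then have "S * (cnj S * cis (real k * t)) = S" by simp
    moreover have "S * cnj S = 1" using nS using complex_norm_square[of S] by simp
    ultimately show ?thesis by (metis mult.assoc mult_1_left)
  qed
  have "S = 1" using cis_eq[of 0] p_0 by simp
  then have "cis (real d * t) = 1"
    unfolding d_def by (intro cis_Gcd_eq_1) (use cis_eq d_pos in \<open>auto simp: d_def\<close>)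
  moreover have "\<bar>real d * t\<bar> \<le> pi"
    using assms(2) d_pos by (simp add: abs_mult field_simps)
  ultimately have "real d * t = 0" by (rule cis_eq_1_small)
  then show False using assms d_pos by simp
qed

text \<open>
  Near 0 the Taylor expansion gives the bound; on the rest of the period, a compact set, the modulus
  stays below some constant smaller than 1.
\<close>

lemma A_gaussian_bound: "\<exists>c>0. \<forall>t. \<bar>t\<bar> \<le> pi / d \<longrightarrow> norm (A t) \<le> exp (- c * t\<^sup>2)"
proof -
  obtain C where C: "C \<ge> 0" "\<And>t. norm (A t - (1 - s2 * t\<^sup>2 / 2)) \<le> C * \<bar>t\<bar> ^ 3"
    using A_taylor by blast
  \<comment> \<open>Within distance \<open>\<delta>\<close> of 0 the cubic error is at most half of the quadratic term.\<close>
  define \<delta> where "\<delta> = min 1 (min (1 / s2) (s2 / (4 * (C + 1))))"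
  have \<delta>: "\<delta> > 0" "\<delta> \<le> 1" "s2 * \<delta> \<le> 1" "C * \<delta> \<le> s2 / 4"
  proof -
    show "\<delta> > 0" "\<delta> \<le> 1" using s2_pos C by (auto simp: \<delta>_def)
    have "\<delta> \<le> 1 / s2" by (simp add: \<delta>_def)
    then show "s2 * \<delta> \<le> 1" using s2_pos by (simp add: field_simps)
    have "\<delta> \<le> s2 / (4 * (C + 1))" by (simp add: \<delta>_def)
    then have "(C + 1) * \<delta> \<le> s2 / 4" using C by (simp add: field_simps)
    then show "C * \<delta> \<le> s2 / 4" using \<open>\<delta> > 0\<close> by (simp add: algebra_simps)
  qed
  have near: "norm (A t) \<le> exp (- (s2 / 4) * t\<^sup>2)" if t: "\<bar>t\<bar> \<le> \<delta>" for t
  proof -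
    have t2: "t\<^sup>2 \<le> \<delta>"
    proof -
      have "\<bar>t\<bar> * \<bar>t\<bar> \<le> \<delta> * 1" using t \<delta> by (intro mult_mono) auto
      then show ?thesis by (simp add: power2_eq_square)
    qed
    have "C * \<bar>t\<bar> ^ 3 = C * \<bar>t\<bar> * t\<^sup>2" by (simp add: power3_eq_cube power2_eq_square)
    also have "\<dots> \<le> C * \<delta> * t\<^sup>2" using t C by (intro mult_right_mono mult_left_mono) auto
    also have "\<dots> \<le> s2 / 4 * t\<^sup>2" using \<delta>(4) by (intro mult_right_mono) auto
    finally have 1: "C * \<bar>t\<bar> ^ 3 \<le> s2 / 4 * t\<^sup>2" .
    have "s2 * t\<^sup>2 \<le> s2 * \<delta>" using t2 s2_pos by simp
    then have "s2 * t\<^sup>2 \<le> 1" using \<delta>(3) by simp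
    then have 2: "norm (complex_of_real (1 - s2 * t\<^sup>2 / 2)) = 1 - s2 * t\<^sup>2 / 2"
      unfolding norm_of_real by simp
    have "norm (A t) \<le> norm (complex_of_real (1 - s2 * t\<^sup>2 / 2)) + norm (A t - (1 - s2 * t\<^sup>2 / 2))"
      using norm_triangle_ineq[of "complex_of_real (1 - s2 * t\<^sup>2 / 2)" "A t - (1 - s2 * t\<^sup>2 / 2)"] by simp
    also have "\<dots> \<le> 1 + (- (s2 / 4) * t\<^sup>2)" using C(2)[of t] 1 2 by simp
    also have "\<dots> \<le> exp (- (s2 / 4) * t\<^sup>2)" by (rule exp_ge_add_one_self)
    finally show ?thesis .
  qed
  define K where "K = {-pi/d..pi/d} - {-\<delta><..<\<delta>}"
  have "compact K" unfolding K_def by (intro compact_diff) auto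
  have "\<exists>r<1. \<forall>t\<in>K. norm (A t) \<le> r"
  proof (cases "K = {}")
    case True then show ?thesis by (auto intro: exI[of _ 0])
  next
    case False
    have "continuous_on K (\<lambda>t. norm (A t))" by (intro continuous_intros continuous_A)
    then obtain t where t: "t \<in> K" "\<forall>u\<in>K. norm (A u) \<le> norm (A t)"
      using continuous_attains_sup[OF \<open>compact K\<close> False] by blast
    have "norm (A t) < 1" using t(1) \<delta> by (intro norm_A_less) (auto simp: K_def)
    then show ?thesis using t by blast
  qed
  then obtain r0 where r0: "r0 < 1" "\<And>t. t \<in> K \<Longrightarrow> norm (A t) \<le> r0" by blast
  \<comment> \<open>The maximum with 1/2 makes \<open>r\<close> positive, so that \<open>r = exp (ln r)\<close>.\<close>
  define r where "r = max r0 (1/2)"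
  have r: "0 < r" "r < 1" "\<And>t. t \<in> K \<Longrightarrow> norm (A t) \<le> r" using r0 by (force simp: r_def)+
  define c where "c = min (s2 / 4) (- ln r / (pi / d)\<^sup>2)"
  have "- ln r / (pi / d)\<^sup>2 > 0" using r d_pos by (intro divide_pos_pos) auto
  then have c: "c > 0" using s2_pos by (simp add: c_def)
  have "norm (A t) \<le> exp (- c * t\<^sup>2)" if t: "\<bar>t\<bar> \<le> pi / d" for t
  proof (cases "\<bar>t\<bar> < \<delta>")
    case True
    have "norm (A t) \<le> exp (- (s2 / 4) * t\<^sup>2)" using near True by simp
    also have "\<dots> \<le> exp (- c * t\<^sup>2)"
    proof -
      have "c \<le> s2 / 4" unfolding c_def by (rule min.cobounded1)
      then have "c * t\<^sup>2 \<le> s2 / 4 * t\<^sup>2" by (rule mult_right_mono) simp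
      then show ?thesis by simp
    qed
    finally show ?thesis .
  next
    case False
    then have "norm (A t) \<le> r" using t by (intro r(3)) (auto simp: K_def)
    also have "r = exp (ln r)" using r by simp
    also have "\<dots> \<le> exp (- c * t\<^sup>2)"
    proof -
      have "t\<^sup>2 \<le> (pi / d)\<^sup>2" using power_mono[OF t, of 2] by simp
      then have "c * t\<^sup>2 \<le> c * (pi / d)\<^sup>2" using c by simp
      also have "\<dots> \<le> (- ln r / (pi / d)\<^sup>2) * (pi / d)\<^sup>2" by (intro mult_right_mono) (auto simp: c_def)
      also have "\<dots> = - ln r" using d_pos by simp
      finally show ?thesis by simp
    qed
    finally show ?thesis .
  qed
  then show ?thesis using c by blast
qed

end

section \<open>A local limit theorem\<close>

text \<open>
  This is the characteristic function of the standard normal distribution after scaling by \<open>sqrt v\<close>.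
\<close>

lemma integral_gaussian_iexp:
  fixes v x :: real
  assumes v: "v > 0"
  shows "(LBINT u. complex_of_real (exp (- v * u\<^sup>2 / 2)) * cis (v * x * u))
    = complex_of_real (sqrt (2 * pi / v) * exp (- v * x\<^sup>2 / 2))"
proof -
  define s where "s = sqrt v"
  have s: "s > 0" "s\<^sup>2 = v" using v by (auto simp: s_def)
  have "complex_of_real (exp (- ((s * x)\<^sup>2) / 2)) = char std_normal_distribution (s * x)"
    by (simp add: char_std_normal_distribution)
  also have "\<dots> = (LBINT y. std_normal_density y *\<^sub>R iexp (s * x * y))"
    unfolding char_def by (subst integral_density) auto
  also have "\<dots> = \<bar>s\<bar> *\<^sub>R (LBINT u. std_normal_density (0 + s * u) *\<^sub>R iexp (s * x * (0 + s * u)))"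
    by (rule lborel_integral_real_affine) (use s in auto)
  also have "(\<lambda>u. std_normal_density (0 + s * u) *\<^sub>R iexp (s * x * (0 + s * u)))
      = (\<lambda>u. complex_of_real (1 / sqrt (2 * pi)) * (complex_of_real (exp (- v * u\<^sup>2 / 2)) * cis (v * x * u)))"
    using s by (auto simp: fun_eq_iff std_normal_density_def power_mult_distrib scaleR_conv_of_real cis_conv_exp
        power2_eq_square mult_ac)
  finally have "complex_of_real (exp (- v * x\<^sup>2 / 2)) = complex_of_real (s / sqrt (2 * pi)) *
      (LBINT u. complex_of_real (exp (- v * u\<^sup>2 / 2)) * cis (v * x * u))"
    using s by (simp add: scaleR_conv_of_real power_mult_distrib)
  then have "complex_of_real (sqrt (2 * pi / v)) * complex_of_real (exp (- v * x\<^sup>2 / 2))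
     = (complex_of_real (sqrt (2 * pi / v)) * complex_of_real (s / sqrt (2 * pi))) *
      (LBINT u. complex_of_real (exp (- v * u\<^sup>2 / 2)) * cis (v * x * u))"
    by (simp only: mult.assoc)
  moreover have "sqrt (2 * pi / v) * (s / sqrt (2 * pi)) = 1"
    using s v by (simp add: s_def real_sqrt_divide)
  then have "complex_of_real (sqrt (2 * pi / v)) * complex_of_real (s / sqrt (2 * pi)) = 1"
    by (simp only: of_real_mult[symmetric] of_real_1)
  ultimately show ?thesis by (simp only: mult_1_left of_real_mult)
qed

lemma integrable_gaussian:
  fixes c :: real
  assumes "c > 0"
  shows "integrable lborel (\<lambda>u. exp (- c * u\<^sup>2 / 2))"
proof -
  define s where "s = 1 / sqrt c"
  have s: "s > 0" "s\<^sup>2 = 1 / c" using assms by (auto simp: s_def power_divide)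
  have "integrable lborel (\<lambda>u. sqrt (2 * pi * s\<^sup>2) * normal_density 0 s u)"
    using s by (intro integrable_mult_right) (simp add: integrable_normal_density)
  moreover have "(\<lambda>u. sqrt (2 * pi * s\<^sup>2) * normal_density 0 s u) = (\<lambda>u. exp (- c * u\<^sup>2 / 2))"
    using s by (auto simp: fun_eq_iff normal_density_def)
  ultimately show ?thesis by simp
qed

context critical_distribution
begin

text \<open>
  Local limit theorem for a sum of \<open>n - h\<close> offspring numbers and \<open>h\<close> size-biased ones, at the point
  \<open>n - 1\<close>. After rescaling the frequency by \<open>sqrt n\<close>, the plain factors converge to a Gaussian, while
  \<open>h \<sim> x * sqrt n\<close> size-biased factors contribute the phase \<open>exp (i * s2 * x * u)\<close>, that is, a shift of
  the mean by \<open>s2 * x * sqrt n\<close>. So the limit is a Gaussian density away from its centre, which as a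
  function of \<open>x\<close> is proportional to a Rayleigh tail.
\<close>

theorem local_limit:
  fixes n h :: "nat \<Rightarrow> nat" and x :: real
  assumes n: "filterlim n at_top sequentially" and n_pos: "\<And>m. n m \<ge> 1" and dvd: "\<And>m. d dvd n m - 1"
    and h: "(\<lambda>m. real (h m) / sqrt (real (n m))) \<longlonglongrightarrow> x"
  shows "(\<lambda>m. sqrt (real (n m)) * (Q ^ h m * P ^ (n m - h m)) $ (n m - 1))
    \<longlonglongrightarrow> d / sqrt (2 * pi * s2) * exp (- x\<^sup>2 * s2 / 2)"
proof -
  define r where "r m = sqrt (real (n m))" for m
  have r_pos: "r m > 0" and r_sq: "r m * r m = real (n m)" for m using n_pos[of m] by (auto simp: r_def)
  have r_top: "filterlim r at_top sequentially"
    unfolding r_def by (intro filterlim_compose[OF sqrt_at_top] filterlim_compose[OF filterlim_real_sequentially n])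
  then have r_inv: "(\<lambda>m. c / r m) \<longlonglongrightarrow> 0" for c
    by (rule tendsto_divide_0[OF tendsto_const filterlim_at_top_imp_at_infinity])
  have h_r: "(\<lambda>m. real (h m) / r m) \<longlonglongrightarrow> x" using h by (simp add: r_def)
  have h_n: "(\<lambda>m. real (h m) / real (n m)) \<longlonglongrightarrow> 0"
    using tendsto_mult[OF h_r r_inv[of 1]] by (simp add: r_sq)
  have "eventually (\<lambda>m. real (h m) / real (n m) < 1 / 2) sequentially"
    by (rule order_tendstoD(2)[OF h_n]) simp
  then have small: "eventually (\<lambda>m. 2 * h m \<le> n m) sequentially"
  proof eventually_elim
    case (elim m) then show ?case using n_pos[of m] by (simp add: field_simps)
  qed
  let ?I = "{-pi/d..pi/d}"
  define G where "G m t = indicator ?I t *\<^sub>R (A t ^ (n m - h m) * B t ^ h m * cis t)" for m t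
  define F where "F m u = (if 2 * h m \<le> n m then G m (u / r m) else 0)" for m u
  define L where "L u = complex_of_real (exp (- s2 * u\<^sup>2 / 2)) * cis (s2 * x * u)" for u

  \<comment> \<open>\<open>circle_val ?f\<close> is \<open>A ^ (n - h) * B ^ h\<close> times a unimodular factor; the centring by 1 in
    each of the \<open>n\<close> factors almost cancels the frequency \<open>n - 1\<close>, and one factor \<open>cis t\<close> is left over.\<close>
  have exact: "r m * (Q ^ h m * P ^ (n m - h m)) $ (n m - 1) = complex_of_real (d / (2 * pi)) * integral\<^sup>L lborel (F m)"
    if hm: "2 * h m \<le> n m" for m
  proof -
    let ?f = "Q ^ h m * P ^ (n m - h m)"
    have supp: "d dvd k" if "?f $ k \<noteq> 0" for k
    proof (rule fps_support_mult[OF _ _ that])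
      show "\<And>k. (Q ^ h m) $ k \<noteq> 0 \<Longrightarrow> d dvd k"
        by (erule fps_support_power[rotated]) (auto simp: Q_nth intro: d_dvd)
      show "\<And>k. (P ^ (n m - h m)) $ k \<noteq> 0 \<Longrightarrow> d dvd k"
        by (erule fps_support_power[rotated]) (auto simp: P_def intro: d_dvd)
    qed
    have rad: "fps_conv_radius ?f > 1"
      by (intro fps_conv_radius_mult_gt fps_conv_radius_power_gt radius_P radius_Q)
    have eq: "circle_val ?f t * cis (- (real (n m - 1) * t)) = A t ^ (n m - h m) * B t ^ h m * cis t" for t
    proof -
      have "cis (- (real (n m - 1) * t)) = cis (- t) ^ (n m - h m) * cis (- t) ^ h m * cis t"
        unfolding Complex.DeMoivre cis_mult using hm n_pos[of m] by (simp add: of_nat_diff algebra_simps)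
      then show ?thesis
        by (simp add: circle_val_mult circle_val_power fps_conv_radius_power_gt radius_P radius_Q
            A_def B_def power_mult_distrib mult_ac)
    qed
    have "complex_of_real (2 * pi / d * ?f $ (n m - 1)) = integral\<^sup>L lborel (G m)"
      using fourier_coefficient[OF rad d_pos dvd supp, of m]
      unfolding eq G_def[abs_def] set_lebesgue_integral_def by (rule sym)
    also have "\<dots> = \<bar>1 / r m\<bar> *\<^sub>R (LBINT u. G m (0 + (1 / r m) * u))"
      by (rule lborel_integral_real_affine) (use r_pos[of m] in simp)
    also have "(\<lambda>u. G m (0 + (1 / r m) * u)) = F m" using hm by (simp add: F_def fun_eq_iff)
    finally show ?thesis using r_pos[of m] d_pos by (simp add: scaleR_conv_of_real field_simps)
  qed

  \<comment> \<open>At least half of the factors are copies of \<open>A\<close>, which gives an integrable Gaussian majorant.\<close>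
  obtain c where c: "c > 0" "\<And>t. \<bar>t\<bar> \<le> pi / d \<Longrightarrow> norm (A t) \<le> exp (- c * t\<^sup>2)"
    using A_gaussian_bound by blast
  have bound: "norm (F m u) \<le> exp (- c * u\<^sup>2 / 2)" for m u
  proof (cases "2 * h m \<le> n m \<and> \<bar>u / r m\<bar> \<le> pi / d")
    case True
    let ?t = "u / r m"
    have "norm (F m u) \<le> norm (A ?t) ^ (n m - h m) * norm (B ?t) ^ h m"
      using True by (simp add: F_def G_def norm_mult norm_power indicator_def)
    also have "\<dots> \<le> exp (- c * ?t\<^sup>2) ^ (n m - h m) * 1"
      using c(2)[of ?t] True by (intro mult_mono power_mono power_le_one norm_B_le) auto
    also have "\<dots> = exp (- (c * u\<^sup>2) * (real (n m - h m) / real (n m)))"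
      by (simp add: exp_of_nat_mult[symmetric] power_divide power2_eq_square[of "r m"] r_sq)
    also have "\<dots> \<le> exp (- (c * u\<^sup>2) * (1 / 2))"
    proof -
      have "1 / 2 \<le> real (n m - h m) / real (n m)" using True n_pos[of m] by (simp add: of_nat_diff field_simps)
      then have "(c * u\<^sup>2) * (1 / 2) \<le> (c * u\<^sup>2) * (real (n m - h m) / real (n m))"
        by (rule mult_left_mono) (use c(1) in simp)
      then show ?thesis by simp
    qed
    finally show ?thesis by simp
  next
    case False
    then have "F m u = 0" by (auto simp: F_def G_def indicator_def)
    then show ?thesis by simp
  qed
  have pointwise: "(\<lambda>m. F m u) \<longlonglongrightarrow> L u" for u
  proof -
    have t0: "(\<lambda>m. u / r m) \<longlonglongrightarrow> 0" by (rule r_inv)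
    obtain CA where CA: "\<And>t. norm (A t - (1 - complex_of_real (s2 * t\<^sup>2 / 2))) \<le> CA * \<bar>t\<bar> ^ 3"
      using A_taylor by auto
    have rearrange: "a * (b - 1) - (- y) = a * (b - (1 - z))" if "a * z = y" for a b y z :: complex
      using that by (simp add: algebra_simps)
    obtain CB where CB: "\<And>t. norm (B t - (1 + \<i> * (s2 * t))) \<le> CB * t\<^sup>2" using B_taylor by blast
    have "(\<lambda>m. of_nat (n m) * (A (u / r m) - 1) - (- complex_of_real (s2 * u\<^sup>2 / 2))) \<longlonglongrightarrow> 0"
    proof (rule Lim_null_comparison[OF always_eventually r_inv[of "CA * \<bar>u\<bar> ^ 3"]], rule allI)
      fix m
      have "of_nat (n m) * (A (u / r m) - 1) - (- complex_of_real (s2 * u\<^sup>2 / 2))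
          = of_nat (n m) * (A (u / r m) - (1 - complex_of_real (s2 * (u / r m)\<^sup>2 / 2)))"
      proof (rule rearrange)
        have "real (n m) * (s2 * (u / r m)\<^sup>2 / 2) = s2 * u\<^sup>2 / 2"
          using n_pos[of m] by (simp add: power_divide power2_eq_square[of "r m"] r_sq)
        from arg_cong[OF this, of complex_of_real]
        show "of_nat (n m) * complex_of_real (s2 * (u / r m)\<^sup>2 / 2) = complex_of_real (s2 * u\<^sup>2 / 2)"
          by (simp only: of_real_mult of_real_of_nat_eq)
      qed
      then have "norm (of_nat (n m) * (A (u / r m) - 1) - (- complex_of_real (s2 * u\<^sup>2 / 2)))
          \<le> real (n m) * (CA * \<bar>u / r m\<bar> ^ 3)"
        using CA[of "u / r m"] by (simp only: norm_mult norm_of_nat) (intro mult_left_mono, auto)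
      also have "\<dots> = CA * \<bar>u\<bar> ^ 3 / r m"
        using r_pos[of m] by (simp add: r_sq[symmetric] power3_eq_cube field_simps abs_mult)
      finally show "norm (of_nat (n m) * (A (u / r m) - 1) - (- complex_of_real (s2 * u\<^sup>2 / 2))) \<le> CA * \<bar>u\<bar> ^ 3 / r m" .
    qed
    then have nA: "(\<lambda>m. of_nat (n m) * (A (u / r m) - 1)) \<longlonglongrightarrow> - complex_of_real (s2 * u\<^sup>2 / 2)"
      by (rule LIM_zero_cancel)
    have "(\<lambda>m. r m * (B (u / r m) - 1) - \<i> * (s2 * u)) \<longlonglongrightarrow> 0"
    proof (rule Lim_null_comparison[OF always_eventually r_inv[of "CB * u\<^sup>2"]], rule allI)
      fix m
      have "r m * (B (u / r m) - 1) - \<i> * (s2 * u) = r m * (B (u / r m) - (1 + \<i> * (s2 * (u / r m))))"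
        using r_pos[of m] by (simp add: algebra_simps)
      then have "norm (r m * (B (u / r m) - 1) - \<i> * (s2 * u)) \<le> r m * (CB * (u / r m)\<^sup>2)"
        using CB[of "u / r m"] r_pos[of m] by (simp only: norm_mult norm_of_real) (auto intro!: mult_left_mono)
      also have "\<dots> = CB * u\<^sup>2 / r m"
        using r_pos[of m] by (simp add: power2_eq_square field_simps)
      finally show "norm (r m * (B (u / r m) - 1) - \<i> * (s2 * u)) \<le> CB * u\<^sup>2 / r m" .
    qed
    then have rB: "(\<lambda>m. r m * (B (u / r m) - 1)) \<longlonglongrightarrow> \<i> * (s2 * u)"
      by (rule LIM_zero_cancel)
    have to0: "(\<lambda>m. X (u / r m) - 1) \<longlonglongrightarrow> 0" if "X 0 = 1" "continuous_on UNIV X" for X :: "real \<Rightarrow> complex"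
      using isCont_tendsto_compose[OF _ t0, of X] that LIM_zero[of "\<lambda>m. X (u / r m)" 1]
      by (simp add: continuous_on_eq_continuous_at)
    have A0: "A 0 = 1" using CA[of 0] by simp
    have B0: "B 0 = 1" using CB[of 0] by simp
    have frac: "(\<lambda>m. complex_of_real (1 - real (h m) / real (n m))) \<longlonglongrightarrow> of_real (1 - 0)"
      by (intro tendsto_of_real tendsto_diff tendsto_const h_n)
    have "(\<lambda>m. of_nat (n m - h m) * (A (u / r m) - 1)) \<longlonglongrightarrow> of_real (1 - 0) * - complex_of_real (s2 * u\<^sup>2 / 2)"
    proof (rule Lim_transform_eventually[OF tendsto_mult[OF frac nA]])
      show "\<forall>\<^sub>F m in sequentially. complex_of_real (1 - real (h m) / real (n m)) * (of_nat (n m) * (A (u / r m) - 1))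
          = of_nat (n m - h m) * (A (u / r m) - 1)"
        using small
      proof eventually_elim
        case (elim m)
        have "(1 - real (h m) / real (n m)) * real (n m) = real (n m - h m)"
          using elim n_pos[of m] by (simp add: of_nat_diff field_simps)
        from arg_cong[OF this, of complex_of_real]
        have "complex_of_real (1 - real (h m) / real (n m)) * of_nat (n m) = of_nat (n m - h m)"
          by (simp only: of_real_mult of_real_of_nat_eq)
        then show ?case by (simp only: mult.assoc[symmetric])
      qed
    qed
    then have limA: "(\<lambda>m. (1 + (A (u / r m) - 1)) ^ (n m - h m)) \<longlonglongrightarrow> exp (of_real (1 - 0) * - complex_of_real (s2 * u\<^sup>2 / 2))"
      by (rule power_tendsto_exp[OF _ to0[OF A0 continuous_A]])
    have "(\<lambda>m. of_nat (h m) * (B (u / r m) - 1)) \<longlonglongrightarrow> of_real x * (\<i> * (s2 * u))"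
    proof (rule Lim_transform_eventually[OF tendsto_mult[OF tendsto_of_real[OF h_r] rB]])
      show "\<forall>\<^sub>F m in sequentially. complex_of_real (real (h m) / r m) * (r m * (B (u / r m) - 1))
          = of_nat (h m) * (B (u / r m) - 1)"
        using r_pos by (intro always_eventually allI) (simp add: less_imp_neq[THEN not_sym])
    qed
    then have limB: "(\<lambda>m. (1 + (B (u / r m) - 1)) ^ h m) \<longlonglongrightarrow> exp (of_real x * (\<i> * (s2 * u)))"
      by (rule power_tendsto_exp[OF _ to0[OF B0 continuous_B]])
    have limc: "(\<lambda>m. cis (u / r m)) \<longlonglongrightarrow> cis 0"
    proof (rule isCont_tendsto_compose[OF _ t0])
      have "continuous_on UNIV cis" by (intro continuous_intros)
      then show "isCont cis 0" by (simp add: continuous_on_eq_continuous_at)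
    qed
    have "(\<lambda>m. A (u / r m) ^ (n m - h m) * B (u / r m) ^ h m * cis (u / r m)) \<longlonglongrightarrow> L u"
      using tendsto_mult[OF tendsto_mult[OF limA limB] limc]
      by (simp add: L_def cis_conv_exp exp_of_real[symmetric] mult_ac)
    moreover have "eventually (\<lambda>m. \<bar>u / r m\<bar> < pi / d) sequentially"
      using tendstoD[OF t0, of "pi / d"] d_pos by (simp add: dist_norm)
    then have "eventually (\<lambda>m. A (u / r m) ^ (n m - h m) * B (u / r m) ^ h m * cis (u / r m) = F m u) sequentially"
      using small
    proof eventually_elim
      case (elim m)
      have "u / r m \<in> ?I"
        using elim(1) unfolding atLeastAtMost_iff minus_divide_left[symmetric] by linarith
      then have "indicator ?I (u / r m) = (1 :: real)" by (rule indicator_simps)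
      then show ?case using elim(2) by (simp only: F_def G_def if_True scaleR_one)
    qed
    ultimately show ?thesis by (rule Lim_transform_eventually)
  qed
  have measG: "G m \<in> borel_measurable borel" for m
  proof -
    have "continuous_on UNIV (\<lambda>t. A t ^ (n m - h m) * B t ^ h m * cis t)"
      by (intro continuous_intros continuous_A continuous_B)
    then have [measurable]: "(\<lambda>t. A t ^ (n m - h m) * B t ^ h m * cis t) \<in> borel_measurable borel"
      by (rule borel_measurable_continuous_onI)
    show ?thesis unfolding G_def[abs_def] by measurable
  qed
  have "(\<lambda>m. integral\<^sup>L lborel (F m)) \<longlonglongrightarrow> integral\<^sup>L lborel L"
  proof (rule integral_dominated_convergence)
    show "L \<in> borel_measurable lborel"
      unfolding L_def[abs_def] by (auto intro!: borel_measurable_continuous_onI continuous_intros)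
    show "F m \<in> borel_measurable lborel" for m
      unfolding F_def[abs_def] using measurable_compose[OF _ measG, of "\<lambda>u. u / r m" borel m] by auto
    show "integrable lborel (\<lambda>u. exp (- c * u\<^sup>2 / 2))" by (rule integrable_gaussian[OF c(1)])
  qed (use pointwise bound in auto)
  also have "integral\<^sup>L lborel L = complex_of_real (sqrt (2 * pi / s2) * exp (- s2 * x\<^sup>2 / 2))"
    unfolding L_def using integral_gaussian_iexp[OF s2_pos] by simp
  finally have "(\<lambda>m. complex_of_real (d / (2 * pi)) * integral\<^sup>L lborel (F m))
     \<longlonglongrightarrow> complex_of_real (d / (2 * pi)) * complex_of_real (sqrt (2 * pi / s2) * exp (- s2 * x\<^sup>2 / 2))"
    by (intro tendsto_mult tendsto_const)
  then have "(\<lambda>m. complex_of_real (r m * (Q ^ h m * P ^ (n m - h m)) $ (n m - 1)))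
     \<longlonglongrightarrow> complex_of_real (d / (2 * pi)) * complex_of_real (sqrt (2 * pi / s2) * exp (- s2 * x\<^sup>2 / 2))"
    by (rule Lim_transform_eventually) (use small exact in \<open>auto elim!: eventually_mono\<close>)
  moreover have "complex_of_real (d / (2 * pi)) * complex_of_real (sqrt (2 * pi / s2) * exp (- s2 * x\<^sup>2 / 2))
     = complex_of_real (d / sqrt (2 * pi * s2) * exp (- x\<^sup>2 * s2 / 2))"
  proof -
    have "(2 * pi / s2) * (2 * pi * s2) = (2 * pi)\<^sup>2"
      using s2_pos by (simp add: power2_eq_square)
    then have "sqrt (2 * pi / s2) * sqrt (2 * pi * s2) = sqrt ((2 * pi)\<^sup>2)"
      by (simp only: real_sqrt_mult[symmetric])
    also have "\<dots> = 2 * pi" by (rule real_sqrt_unique) simp_all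
    finally have "sqrt (2 * pi / s2) * sqrt (2 * pi * s2) = 2 * pi" .
    moreover have "sqrt (2 * pi * s2) > 0" using s2_pos by simp
    moreover have "y / c * a = y / b" if "a * b = c" "b > 0" "c > 0" for a b c y :: real
      using that by (auto simp: zero_less_mult_iff)
    ultimately have "d / (2 * pi) * sqrt (2 * pi / s2) = d / sqrt (2 * pi * s2)"
      using pi_gt_zero by simp
    moreover have "- s2 * x\<^sup>2 / 2 = - x\<^sup>2 * s2 / 2" by simp
    ultimately show ?thesis by (simp only: of_real_mult[symmetric] mult.assoc[symmetric])
  qed
  ultimately show ?thesis by (simp only: r_def tendsto_of_real_iff)
qed

end

section \<open>The Rayleigh law and weak convergence\<close>

lemma real_power_tendsto_exp:
  fixes z :: "nat \<Rightarrow> real" and k :: "nat \<Rightarrow> nat"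
  assumes "(\<lambda>m. real (k m) * z m) \<longlonglongrightarrow> w" "z \<longlonglongrightarrow> 0"
  shows "(\<lambda>m. (1 + z m) ^ k m) \<longlonglongrightarrow> exp w"
proof -
  have "(\<lambda>m. (1 + complex_of_real (z m)) ^ k m) \<longlonglongrightarrow> exp (complex_of_real w)"
  proof (rule power_tendsto_exp)
    show "(\<lambda>m. of_nat (k m) * complex_of_real (z m)) \<longlonglongrightarrow> complex_of_real w"
      using tendsto_of_real[OF assms(1), where ?'a = complex] by simp
    show "(\<lambda>m. complex_of_real (z m)) \<longlonglongrightarrow> 0"
      using tendsto_of_real[OF assms(2), where ?'a = complex] by simp
  qed
  then have "(\<lambda>m. complex_of_real ((1 + z m) ^ k m)) \<longlonglongrightarrow> complex_of_real (exp w)"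
    by (simp add: exp_of_real)
  then show ?thesis by (simp only: tendsto_of_real_iff)
qed

text \<open>
  Extended continuous mapping theorem. Skorohod's representation replaces weak convergence by
  pointwise convergence on one probability space, where dominated convergence applies even though
  the integrand varies with \<open>m\<close>.
\<close>

lemma weak_conv_integral_varying:
  fixes g :: "nat \<Rightarrow> real \<Rightarrow> real" and g0 :: "real \<Rightarrow> real"
  assumes \<mu>: "\<And>m. real_distribution (\<mu> m)" and M: "real_distribution M" and conv: "weak_conv_m \<mu> M"
    and [measurable]: "\<And>m. g m \<in> borel_measurable borel" "g0 \<in> borel_measurable borel"
    and bound: "\<And>m x. \<bar>g m x\<bar> \<le> K"
    and lim: "AE x in M. \<forall>y. y \<longlonglongrightarrow> x \<longrightarrow> (\<lambda>m. g m (y m)) \<longlonglongrightarrow> g0 x"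
  shows "(\<lambda>m. integral\<^sup>L (\<mu> m) (g m)) \<longlonglongrightarrow> integral\<^sup>L M g0"
proof -
  obtain \<Omega> :: "real measure" and Y_seq :: "nat \<Rightarrow> real \<Rightarrow> real" and Y :: "real \<Rightarrow> real" where
    \<Omega>: "prob_space \<Omega>" and Y_seq [measurable]: "\<And>m. Y_seq m \<in> measurable \<Omega> borel"
    and dm: "\<And>m. distr \<Omega> borel (Y_seq m) = \<mu> m" and Y: "Y \<in> measurable \<Omega> lborel"
    and d: "distr \<Omega> borel Y = M" and YY: "\<And>x. x \<in> space \<Omega> \<Longrightarrow> (\<lambda>m. Y_seq m x) \<longlonglongrightarrow> Y x"
    using Skorohod[OF \<mu> M conv] by blast
  interpret prob_space \<Omega> by (rule \<Omega>)
  have Y' [measurable]: "Y \<in> measurable \<Omega> borel" using Y by simp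
  have "AE \<omega> in \<Omega>. \<forall>y. y \<longlonglongrightarrow> Y \<omega> \<longrightarrow> (\<lambda>m. g m (y m)) \<longlonglongrightarrow> g0 (Y \<omega>)"
    using lim unfolding d[symmetric] by (rule AE_distrD[OF Y'])
  then have ae: "AE \<omega> in \<Omega>. (\<lambda>m. g m (Y_seq m \<omega>)) \<longlonglongrightarrow> g0 (Y \<omega>)"
    using AE_space by eventually_elim (use YY in blast)
  have "(\<lambda>m. \<integral>\<omega>. g m (Y_seq m \<omega>) \<partial>\<Omega>) \<longlonglongrightarrow> (\<integral>\<omega>. g0 (Y \<omega>) \<partial>\<Omega>)"
    by (rule integral_dominated_convergence[where w = "\<lambda>_. K"]) (use ae bound in auto)
  then show ?thesis
    unfolding dm[symmetric] d[symmetric] by (simp add: integral_distr)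
qed

lemma nn_integral_rayleigh_interval:
  assumes "\<sigma> > 0" "x \<ge> 0"
  shows "(\<integral>\<^sup>+y. ennreal (rayleigh_density \<sigma> y) * indicator {..x} y \<partial>lborel) = ennreal (1 - exp (- x\<^sup>2 / (2 * \<sigma>\<^sup>2)))"
proof -
  have "(\<integral>\<^sup>+y. ennreal (rayleigh_density \<sigma> y) * indicator {..x} y \<partial>lborel)
      = (\<integral>\<^sup>+y. ennreal (y / \<sigma>\<^sup>2 * exp (- y\<^sup>2 / (2 * \<sigma>\<^sup>2))) * indicator {0..x} y \<partial>lborel)"
    by (rule nn_integral_cong) (auto simp: rayleigh_density_def indicator_def)
  also have "\<dots> = - exp (- x\<^sup>2 / (2 * \<sigma>\<^sup>2)) - (- exp (- 0\<^sup>2 / (2 * \<sigma>\<^sup>2)))"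
    using assms by (intro nn_integral_FTC_Icc) (auto intro!: derivative_eq_intros simp: field_simps)
  finally show ?thesis by simp
qed

lemma nn_integral_rayleigh:
  assumes "\<sigma> > 0"
  shows "(\<integral>\<^sup>+y. ennreal (rayleigh_density \<sigma> y) \<partial>lborel) = 1"
proof -
  have "(\<integral>\<^sup>+y. ennreal (rayleigh_density \<sigma> y) \<partial>lborel)
      = (\<integral>\<^sup>+y. ennreal (y / \<sigma>\<^sup>2 * exp (- y\<^sup>2 / (2 * \<sigma>\<^sup>2))) * indicator {0..} y \<partial>lborel)"
    by (rule nn_integral_cong) (auto simp: rayleigh_density_def indicator_def)
  also have "\<dots> = 0 - (- exp (- 0\<^sup>2 / (2 * \<sigma>\<^sup>2)))"
  proof (rule nn_integral_FTC_atLeast)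
    show "((\<lambda>y. - exp (- y\<^sup>2 / (2 * \<sigma>\<^sup>2))) \<longlongrightarrow> 0) at_top"
      using assms by real_asymp
  qed (use assms in \<open>auto intro!: derivative_eq_intros simp: field_simps\<close>)
  finally show ?thesis by simp
qed

lemma rayleigh_density_measurable [measurable]: "rayleigh_density \<sigma> \<in> borel_measurable borel"
  unfolding rayleigh_density_def[abs_def] by measurable

lemma rayleigh_density_nonneg: "rayleigh_density \<sigma> x \<ge> 0"
  by (simp add: rayleigh_density_def)

lemma real_distribution_rayleigh:
  assumes "\<sigma> > 0" shows "real_distribution (rayleigh \<sigma>)"
proof -
  have "emeasure (rayleigh \<sigma>) (space (rayleigh \<sigma>)) = 1"
    using nn_integral_rayleigh[OF assms] by (simp add: rayleigh_def emeasure_density)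
  then have "prob_space (rayleigh \<sigma>)" by (rule prob_spaceI)
  then show ?thesis by (auto simp: real_distribution_def real_distribution_axioms_def rayleigh_def)
qed

lemma cdf_rayleigh:
  assumes "\<sigma> > 0"
  shows "cdf (rayleigh \<sigma>) x = (if x \<ge> 0 then 1 - exp (- x\<^sup>2 / (2 * \<sigma>\<^sup>2)) else 0)"
proof (cases "x \<ge> 0")
  case True
  have "emeasure (rayleigh \<sigma>) {..x} = ennreal (1 - exp (- x\<^sup>2 / (2 * \<sigma>\<^sup>2)))"
    unfolding rayleigh_def using nn_integral_rayleigh_interval[OF assms True] by (simp add: emeasure_density)
  then show ?thesis using True by (simp add: cdf_def measure_def)
next
  case False
  have "(\<integral>\<^sup>+y. ennreal (rayleigh_density \<sigma> y) * indicator {..x} y \<partial>lborel) = (\<integral>\<^sup>+y. 0 \<partial>(lborel :: real measure))"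
    using False by (intro nn_integral_cong) (auto simp: rayleigh_density_def indicator_def)
  then have "emeasure (rayleigh \<sigma>) {..x} = 0"
    unfolding rayleigh_def by (simp add: emeasure_density)
  then show ?thesis using False by (simp add: cdf_def measure_def)
qed

lemma AE_rayleigh: "AE x in rayleigh \<sigma>. x > 0 \<and> x \<noteq> c"
  unfolding rayleigh_def
  by (subst AE_density)
     (auto simp: rayleigh_density_def intro: eventually_mono[OF AE_lborel_singleton[of c]])

lemma integral_rayleigh:
  assumes [measurable]: "f \<in> borel_measurable borel"
  shows "integral\<^sup>L (rayleigh \<sigma>) f = (LBINT x. rayleigh_density \<sigma> x * f x)"
  unfolding rayleigh_def
  by (subst integral_density) (auto simp: rayleigh_density_nonneg)

lemma real_distribution_law: "real_distribution (law p X)"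
  unfolding law_def by (intro prob_space.real_distribution_distr prob_space_measure_pmf) simp

lemma cdf_law: "cdf (law p X) x = measure_pmf.prob p {t. X t \<le> x}"
  unfolding law_def cdf_def by (subst measure_distr) (auto simp: vimage_def)

text \<open>
  A distribution function on the natural numbers is a finite sum of point probabilities.
\<close>

lemma weak_conv_nat_valued:
  fixes X :: "nat \<Rightarrow> 'a \<Rightarrow> nat" and p :: "nat \<Rightarrow> 'a pmf" and Y :: "nat pmf"
  assumes "\<And>k. (\<lambda>m. measure_pmf.prob (p m) {t. X m t = k}) \<longlonglongrightarrow> pmf Y k"
  shows "weak_conv_m (\<lambda>m. law (p m) (\<lambda>t. real (X m t))) (law Y real)"
  unfolding weak_conv_m_def weak_conv_def
proof (intro allI impI)
  fix x :: real
  have cdf_sum: "cdf (law q (\<lambda>t. real (Z t))) x = (if x < 0 then 0 else \<Sum>k\<le>nat \<lfloor>x\<rfloor>. measure_pmf.prob q {t. Z t = k})"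
    for q :: "'b pmf" and Z :: "'b \<Rightarrow> nat"
  proof (cases "x < 0")
    case True
    then have "{t. real (Z t) \<le> x} = {}" by auto
    then show ?thesis using True by (simp add: cdf_law)
  next
    case False
    then have "{t. real (Z t) \<le> x} = (\<Union>k\<in>{..nat \<lfloor>x\<rfloor>}. {t. Z t = k})"
      by (auto simp: le_nat_iff le_floor_iff)
    then have "measure_pmf.prob q {t. real (Z t) \<le> x} = (\<Sum>k\<le>nat \<lfloor>x\<rfloor>. measure_pmf.prob q {t. Z t = k})"
      by (simp only:) (rule measure_pmf.finite_measure_finite_Union, auto simp: disjoint_family_on_def)
    then show ?thesis using False by (simp add: cdf_law)
  qed
  have "measure_pmf.prob Y {t. t = k} = pmf Y k" for k by (simp add: pmf.rep_eq)
  then show "(\<lambda>m. cdf (law (p m) (\<lambda>t. real (X m t))) x) \<longlonglongrightarrow> cdf (law Y real) x"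
    unfolding cdf_sum[of _ "\<lambda>t. t"] cdf_sum by (auto intro!: tendsto_sum assms)
qed

section \<open>Limits of hypergeometric laws\<close>

lemma binomial_as_prod: "real (n choose k) = (\<Prod>i<k. real n - real i) / fact k"
  by (simp add: binomial_gbinomial gbinomial_prod_rev atLeast0LessThan)

text \<open>
  This form separates a factor with a fixed number \<open>k\<close> of terms, responsible for the Poisson weight
  \<open>\<lambda> ^ k / k!\<close>, from a product of \<open>h - k\<close> terms close to 1, responsible for \<open>exp (- \<lambda>)\<close>.
\<close>

lemma pmf_hypergeometric_factored:
  assumes "K \<le> N" "h \<le> N"
  shows "pmf (hypergeometric N K h) k
    = real (K choose k) * real (h choose k) / real (N choose k)
      * (real ((N - K) choose (h - k)) / real ((N - k) choose (h - k)))"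
proof (cases "k \<le> h")
  case True
  have "real (N choose h) * real (h choose k) = real (N choose k) * real ((N - k) choose (h - k))"
    using choose_mult[OF True assms(2)] by (simp flip: of_nat_mult)
  moreover have "real (N choose h) > 0" "real (N choose k) > 0" "real ((N - k) choose (h - k)) > 0"
    using True assms by auto
  ultimately show ?thesis using True assms
    by (simp add: pmf_hypergeometric divide_simps) (simp add: mult_ac)
qed (use assms in \<open>simp add: pmf_hypergeometric\<close>)

text \<open>
  With \<open>N \<sim> R\<^sup>2\<close> and \<open>h\<close>, \<open>K\<close> of order \<open>R\<close>, the mean \<open>h * K / N\<close> tends to \<open>a * b\<close>. The limits \<open>a\<close> and \<open>b\<close>
  may be 0, which covers the degenerate regime as well.
\<close>

lemma hypergeometric_poisson_limit:
  fixes N K h :: "nat \<Rightarrow> nat" and R :: "nat \<Rightarrow> real"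
  assumes R: "filterlim R at_top sequentially"
    and N: "(\<lambda>m. real (N m) / (R m)\<^sup>2) \<longlonglongrightarrow> 1"
    and K: "(\<lambda>m. real (K m) / R m) \<longlonglongrightarrow> b" and h: "(\<lambda>m. real (h m) / R m) \<longlonglongrightarrow> a"
  shows "(\<lambda>m. pmf (hypergeometric (N m) (K m) (h m)) k) \<longlonglongrightarrow> (a * b) ^ k / fact k * exp (- (a * b))"
proof -
  have R_inv: "(\<lambda>m. c / R m) \<longlonglongrightarrow> 0" for c
    by (rule tendsto_divide_0[OF tendsto_const filterlim_at_top_imp_at_infinity[OF R]])
  have R_pos: "eventually (\<lambda>m. R m > 0) sequentially"
    using R by (auto simp: filterlim_at_top_dense)
  have b: "b \<ge> 0"
    by (rule tendsto_lowerbound[OF K]) (use R_pos in \<open>auto elim!: eventually_mono\<close>)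
  have shift: "(\<lambda>m. (real (X m) - c) / R m) \<longlonglongrightarrow> y" if "(\<lambda>m. real (X m) / R m) \<longlonglongrightarrow> y" for X y c
    using tendsto_diff[OF that R_inv[of c]] by (simp add: diff_divide_distrib)
  have R2: "(\<lambda>m. c / (R m)\<^sup>2) \<longlonglongrightarrow> 0" for c
    using tendsto_mult[OF R_inv[of c] R_inv[of 1]] by (simp add: power2_eq_square)
  have shiftN: "(\<lambda>m. (real (N m) - c) / (R m)\<^sup>2) \<longlonglongrightarrow> 1" for c
    using tendsto_diff[OF N R2[of c]] by (simp add: diff_divide_distrib)
  have lim1: "(\<lambda>m. real (K m choose k) * real (h m choose k) / real (N m choose k)) \<longlonglongrightarrow> (a * b) ^ k / fact k"
  proof -
    have "(\<lambda>m. (\<Prod>i<k. ((real (h m) - real i) / R m) * ((real (K m) - real i) / R m) / ((real (N m) - real i) / (R m)\<^sup>2)) / fact k)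
      \<longlonglongrightarrow> (\<Prod>i<k. a * b / 1) / fact k"
      by (intro tendsto_divide tendsto_prod tendsto_mult shift h K shiftN tendsto_const) auto
    moreover have "eventually (\<lambda>m. (\<Prod>i<k. ((real (h m) - real i) / R m) * ((real (K m) - real i) / R m) / ((real (N m) - real i) / (R m)\<^sup>2)) / fact k
       = real (K m choose k) * real (h m choose k) / real (N m choose k)) sequentially"
      using R_pos
    proof eventually_elim
      case (elim m)
      then have "((real (h m) - real i) / R m) * ((real (K m) - real i) / R m) / ((real (N m) - real i) / (R m)\<^sup>2)
         = (real (h m) - real i) * (real (K m) - real i) / (real (N m) - real i)" for i
        by (simp add: power2_eq_square)
      then show ?case by (simp add: binomial_as_prod prod.distrib prod_dividef mult.commute)
    qed
    ultimately show ?thesis by (auto intro: Lim_transform_eventually)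
  qed
  \<comment> \<open>If \<open>K m < k\<close>, then \<open>K m choose k\<close> vanishes and the value of \<open>T m\<close> is irrelevant; 1 is chosen so
    that the bounds on \<open>T\<close> below, stated with the truncated difference \<open>e\<close>, hold in this case too.\<close>
  define e where "e m = max 0 (real (K m) - real k)" for m
  define T where "T m = (if k \<le> K m then real ((N m - K m) choose (h m - k)) / real ((N m - k) choose (h m - k)) else 1)" for m
  have large: "eventually (\<lambda>m. K m + h m + k < N m) sequentially"
  proof -
    have "(\<lambda>m. (real (K m) / R m) * (1 / R m) + (real (h m) / R m) * (1 / R m) + real k / (R m)\<^sup>2) \<longlonglongrightarrow> b * 0 + a * 0 + 0"
      by (intro tendsto_add tendsto_mult K h R_inv R2)
    then have "eventually (\<lambda>m. (real (K m) / R m) * (1 / R m) + (real (h m) / R m) * (1 / R m) + real k / (R m)\<^sup>2 < 1/2) sequentially"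
      by (rule order_tendstoD) simp
    moreover have "eventually (\<lambda>m. real (N m) / (R m)\<^sup>2 > 1/2) sequentially"
      by (rule order_tendstoD[OF N]) simp
    ultimately show ?thesis using R_pos
    proof eventually_elim
      case (elim m)
      have "(real (K m) + real (h m) + real k) / (R m)\<^sup>2
          = (real (K m) / R m) * (1 / R m) + (real (h m) / R m) * (1 / R m) + real k / (R m)\<^sup>2"
        by (simp add: add_divide_distrib power2_eq_square)
      with elim have "(real (K m) + real (h m) + real k) / (R m)\<^sup>2 < real (N m) / (R m)\<^sup>2"
        by linarith
      then have "real (K m) + real (h m) + real k < real (N m)"
        using elim by (simp add: divide_less_cancel)
      then show ?case by linarith
    qed
  qed
  have e: "(\<lambda>m. e m / R m) \<longlonglongrightarrow> b"
  proof -
    have "(\<lambda>m. max 0 ((real (K m) - real k) / R m)) \<longlonglongrightarrow> max 0 b"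
      by (intro tendsto_max tendsto_const shift K)
    moreover have "eventually (\<lambda>m. max 0 ((real (K m) - real k) / R m) = e m / R m) sequentially"
      using R_pos by eventually_elim (auto simp: e_def max_def field_simps)
    ultimately show ?thesis using b by (auto intro: Lim_transform_eventually simp: max_def)
  qed
  have l: "(\<lambda>m. real (h m - k) / R m) \<longlonglongrightarrow> a"
  proof (rule tendsto_sandwich[OF _ _ shift[OF h, of "real k"] h])
    show "\<forall>\<^sub>F m in sequentially. (real (h m) - real k) / R m \<le> real (h m - k) / R m"
      using R_pos by eventually_elim (auto intro!: divide_right_mono)
    show "\<forall>\<^sub>F m in sequentially. real (h m - k) / R m \<le> real (h m) / R m"
      using R_pos by eventually_elim (auto intro!: divide_right_mono)
  qed
  have pow: "(\<lambda>m. (1 + - (e m / (real (N m) - D m))) ^ (h m - k)) \<longlonglongrightarrow> exp (- (a * b))"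
    if D: "(\<lambda>m. D m / (R m)\<^sup>2) \<longlonglongrightarrow> 0" for D :: "nat \<Rightarrow> real"
  proof (rule real_power_tendsto_exp)
    have ND: "(\<lambda>m. (real (N m) - D m) / (R m)\<^sup>2) \<longlonglongrightarrow> 1 - 0"
      using tendsto_diff[OF N D] by (simp add: diff_divide_distrib)
    have "(\<lambda>m. - ((real (h m - k) / R m) * (e m / R m) / ((real (N m) - D m) / (R m)\<^sup>2))) \<longlonglongrightarrow> - (a * b / (1 - 0))"
      by (intro tendsto_minus tendsto_divide tendsto_mult l e ND) simp
    moreover have "eventually (\<lambda>m. - ((real (h m - k) / R m) * (e m / R m) / ((real (N m) - D m) / (R m)\<^sup>2))
       = real (h m - k) * - (e m / (real (N m) - D m))) sequentially"
      using R_pos by eventually_elim (simp add: power2_eq_square)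
    ultimately show "(\<lambda>m. real (h m - k) * - (e m / (real (N m) - D m))) \<longlonglongrightarrow> - (a * b)"
      by (auto intro: Lim_transform_eventually)
    have "(\<lambda>m. - ((e m / R m) * (1 / R m) / ((real (N m) - D m) / (R m)\<^sup>2))) \<longlonglongrightarrow> - (b * 0 / (1 - 0))"
      by (intro tendsto_minus tendsto_divide tendsto_mult e R_inv ND) simp
    moreover have "eventually (\<lambda>m. - ((e m / R m) * (1 / R m) / ((real (N m) - D m) / (R m)\<^sup>2))
       = - (e m / (real (N m) - D m))) sequentially"
      using R_pos by eventually_elim (simp add: power2_eq_square)
    ultimately show "(\<lambda>m. - (e m / (real (N m) - D m))) \<longlonglongrightarrow> 0"
      by (auto intro: Lim_transform_eventually)
  qed
  have "T \<longlonglongrightarrow> exp (- (a * b))"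
  proof (rule tendsto_sandwich)
    show "(\<lambda>m. (1 + - (e m / (real (N m) - (real k + real (h m))))) ^ (h m - k)) \<longlonglongrightarrow> exp (- (a * b))"
    proof (rule pow)
      have "(\<lambda>m. real k / (R m)\<^sup>2 + (real (h m) / R m) * (1 / R m)) \<longlonglongrightarrow> 0 + a * 0"
        by (intro tendsto_add tendsto_mult R2 R_inv h)
      then show "(\<lambda>m. (real k + real (h m)) / (R m)\<^sup>2) \<longlonglongrightarrow> 0"
        by (simp add: add_divide_distrib power2_eq_square)
    qed
    show "(\<lambda>m. (1 + - (e m / (real (N m) - real k))) ^ (h m - k)) \<longlonglongrightarrow> exp (- (a * b))"
      by (rule pow[OF R2])
    have T_prod: "T m = (\<Prod>i<h m - k. 1 + - (e m / (real (N m) - real k - real i)))"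
      if "K m + h m + k < N m" for m
    proof (cases "k \<le> K m")
      case True
      have "T m = (\<Prod>i<h m - k. (real (N m - K m) - real i) / (real (N m - k) - real i))"
        using True by (simp add: T_def binomial_as_prod prod_dividef)
      also have "\<dots> = (\<Prod>i<h m - k. 1 + - (e m / (real (N m) - real k - real i)))"
      proof (intro prod.cong refl)
        fix i assume "i \<in> {..<h m - k}"
        then have "real (N m) - real k - real i > 0" using that by auto
        then show "(real (N m - K m) - real i) / (real (N m - k) - real i) = 1 + - (e m / (real (N m) - real k - real i))"
          using that True by (simp add: e_def of_nat_diff field_simps)
      qed
      finally show ?thesis .
    qed (simp add: T_def e_def)
    have e_nonneg: "e m \<ge> 0" for m by (simp add: e_def)
    show "\<forall>\<^sub>F m in sequentially. (1 + - (e m / (real (N m) - (real k + real (h m))))) ^ (h m - k) \<le> T m"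
      using large
    proof eventually_elim
      case (elim m)
      have "(\<Prod>i<h m - k. 1 + - (e m / (real (N m) - (real k + real (h m))))) \<le> T m"
        unfolding T_prod[OF elim]
      proof (rule prod_mono, intro conjI)
        fix i assume i: "i \<in> {..<h m - k}"
        have pos: "real (N m) - (real k + real (h m)) > 0" using elim by linarith
        have "e m \<le> real (N m) - (real k + real (h m))" using elim by (auto simp: e_def)
        then show "0 \<le> 1 + - (e m / (real (N m) - (real k + real (h m))))" using pos by simp
        have "e m / (real (N m) - real k - real i) \<le> e m / (real (N m) - (real k + real (h m)))"
          by (rule divide_left_mono) (use i pos e_nonneg in \<open>auto intro!: mult_pos_pos\<close>)
        then show "1 + - (e m / (real (N m) - (real k + real (h m)))) \<le> 1 + - (e m / (real (N m) - real k - real i))"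
          by simp
      qed
      then show ?case by simp
    qed
    show "\<forall>\<^sub>F m in sequentially. T m \<le> (1 + - (e m / (real (N m) - real k))) ^ (h m - k)"
      using large
    proof eventually_elim
      case (elim m)
      have "T m \<le> (\<Prod>i<h m - k. 1 + - (e m / (real (N m) - real k)))"
        unfolding T_prod[OF elim]
      proof (rule prod_mono, intro conjI)
        fix i assume i: "i \<in> {..<h m - k}"
        have pos: "real (N m) - real k - real i > 0" using elim i by auto
        have "e m \<le> real (N m) - real k - real i" using elim i by (auto simp: e_def)
        then show "0 \<le> 1 + - (e m / (real (N m) - real k - real i))" using pos by simp
        have "e m / (real (N m) - real k) \<le> e m / (real (N m) - real k - real i)"
          by (rule divide_left_mono) (use i pos e_nonneg in \<open>auto intro!: mult_pos_pos\<close>)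
        then show "1 + - (e m / (real (N m) - real k - real i)) \<le> 1 + - (e m / (real (N m) - real k))"
          by simp
      qed
      then show ?case by simp
    qed
  qed
  then have "(\<lambda>m. real (K m choose k) * real (h m choose k) / real (N m choose k) * T m) \<longlonglongrightarrow> (a * b) ^ k / fact k * exp (- (a * b))"
    by (rule tendsto_mult[OF lim1])
  moreover have "eventually (\<lambda>m. real (K m choose k) * real (h m choose k) / real (N m choose k) * T m
     = pmf (hypergeometric (N m) (K m) (h m)) k) sequentially"
    using large
  proof eventually_elim
    case (elim m)
    then have "K m \<le> N m" "h m \<le> N m" by auto
    then show ?case by (simp add: pmf_hypergeometric_factored T_def binomial_eq_0)
  qed
  ultimately show ?thesis by (rule Lim_transform_eventually)
qed

lemma prob_bind_pmf:
  "measure_pmf.prob (bind_pmf p f) S = measure_pmf.expectation p (\<lambda>x. measure_pmf.prob (f x) S)"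
proof -
  have int: "integrable (measure_pmf p) (\<lambda>x. measure_pmf.prob (f x) S)"
    by (rule measure_pmf.integrable_const_bound[where B = 1]) auto
  have "emeasure (measure_pmf (bind_pmf p f)) S = (\<integral>\<^sup>+ x. ennreal (measure_pmf.prob (f x) S) \<partial>measure_pmf p)"
    by (subst emeasure_bind_pmf) (simp add: measure_pmf.emeasure_eq_measure)
  also have "\<dots> = ennreal (measure_pmf.expectation p (\<lambda>x. measure_pmf.prob (f x) S))"
    by (rule nn_integral_eq_integral[OF int]) simp
  finally show ?thesis
    by (simp add: measure_def)
qed

text \<open>
  The absorption identity for binomial coefficients: size-biasing a hypergeometric law gives another
  one. Applied once it yields the mean, applied twice the second factorial moment.
\<close>

lemma hypergeometric_size_bias:
  assumes "Suc K \<le> Suc N" "Suc h \<le> Suc N"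
  shows "real (Suc k) * pmf (hypergeometric (Suc N) (Suc K) (Suc h)) (Suc k)
    = real (Suc h) * real (Suc K) / real (Suc N) * pmf (hypergeometric N K h) k"
proof (cases "k \<le> h")
  case True
  have 1: "real (Suc k) * real (Suc K choose Suc k) = real (Suc K) * real (K choose k)"
    by (simp only: of_nat_mult[symmetric] Suc_times_binomial)
  have 2: "real (Suc h) * real (Suc N choose Suc h) = real (Suc N) * real (N choose h)"
    by (simp only: of_nat_mult[symmetric] Suc_times_binomial)
  have pos: "real (N choose h) > 0" "real (Suc N choose Suc h) > 0"
    using zero_less_binomial[of h N] zero_less_binomial[of "Suc h" "Suc N"] assms
    by (simp_all del: binomial_Suc_Suc)
  have 3: "1 / real (Suc N choose Suc h) = real (Suc h) / (real (Suc N) * real (N choose h))"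
    unfolding 2[symmetric] using pos by simp
  have "real (Suc k) * pmf (hypergeometric (Suc N) (Suc K) (Suc h)) (Suc k)
     = (real (Suc k) * real (Suc K choose Suc k)) * real ((N - K) choose (h - k)) * (1 / real (Suc N choose Suc h))"
    using True assms by (simp only: pmf_hypergeometric if_True Suc_le_mono diff_Suc_Suc) (simp only: times_divide_eq_right times_divide_eq_left mult_1_right mult.assoc)
  also have "\<dots> = real (Suc h) * real (Suc K) / real (Suc N) * pmf (hypergeometric N K h) k"
    unfolding 1 3 using True assms by (simp only: pmf_hypergeometric if_True Suc_le_mono) simp
  finally show ?thesis .
qed (use assms in \<open>simp add: pmf_hypergeometric del: of_nat_Suc\<close>)

context
  fixes N K h :: nat
  assumes KN: "K \<le> N" and hN: "h \<le> N"
begin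

lemma set_pmf_hypergeometric: "set_pmf (hypergeometric N K h) \<subseteq> {..h}"
  using KN hN by (auto simp: set_pmf_eq pmf_hypergeometric split: if_splits)

lemma integrable_hypergeometric: "integrable (measure_pmf (hypergeometric N K h)) (f :: nat \<Rightarrow> real)"
  by (rule integrable_measure_pmf_finite, rule finite_subset[OF set_pmf_hypergeometric]) simp

lemma expectation_hypergeometric:
  fixes f :: "nat \<Rightarrow> real"
  shows "measure_pmf.expectation (hypergeometric N K h) f = (\<Sum>k\<le>h. f k * pmf (hypergeometric N K h) k)"
  by (rule integral_measure_pmf_real) (use set_pmf_hypergeometric in auto)

lemma sum_pmf_hypergeometric: "(\<Sum>k\<le>h. pmf (hypergeometric N K h) k) = 1"
  by (rule sum_pmf_eq_1[OF _ set_pmf_hypergeometric]) simp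

end

lemma hypergeometric_weighted_sum:
  fixes f :: "nat \<Rightarrow> real"
  assumes "K \<le> N" "h \<le> N"
  shows "(\<Sum>k\<le>h. f k * (real k * pmf (hypergeometric N K h) k))
    = real h * real K / real N * (if h = 0 \<or> K = 0 then 0 else \<Sum>k\<le>h-1. f (Suc k) * pmf (hypergeometric (N-1) (K-1) (h-1)) k)"
proof -
  consider "h = 0" | "K = 0" | N' K' h' where "N = Suc N'" "K = Suc K'" "h = Suc h'"
    using assms by (cases h; cases K; cases N) auto
  then show ?thesis
  proof cases
    case 2
    have "real k * pmf (hypergeometric N K h) k = 0" for k
      using 2 assms by (cases k) (auto simp: pmf_hypergeometric)
    then have "(\<Sum>k\<le>h. f k * (real k * pmf (hypergeometric N K h) k)) = 0"
      by (simp only: mult_zero_right sum.neutral_const)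
    then show ?thesis using 2 by simp
  next
    case 3
    have "(\<Sum>k\<le>h. f k * (real k * pmf (hypergeometric N K h) k))
       = (\<Sum>k\<le>h'. f (Suc k) * (real (Suc k) * pmf (hypergeometric N K h) (Suc k)))"
      unfolding 3 sum.atMost_Suc_shift by simp
    also have "\<dots> = (\<Sum>k\<le>h'. real h * real K / real N * (f (Suc k) * pmf (hypergeometric N' K' h') k))"
      using assms unfolding 3 by (intro sum.cong refl, subst hypergeometric_size_bias) (simp_all only: mult_ac)
    finally show ?thesis by (simp add: 3 sum_distrib_left)
  qed simp
qed

lemma hypergeometric_mean:
  assumes "K \<le> N" "h \<le> N"
  shows "measure_pmf.expectation (hypergeometric N K h) real = real h * real K / real N"
proof -
  have "K - 1 \<le> N - 1" "h - 1 \<le> N - 1" using assms by auto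
  from sum_pmf_hypergeometric[OF this]
  show ?thesis
    using hypergeometric_weighted_sum[OF assms, of "\<lambda>_. 1"]
    by (simp only: expectation_hypergeometric[OF assms] mult_1_left) simp
qed

text \<open>
  Sampling without replacement is at most as dispersed as a Poisson variable, because
  \<open>(K - 1) / (N - 1) \<le> K / N\<close>.
\<close>

lemma hypergeometric_variance_le:
  assumes "K \<le> N" "h \<le> N"
  shows "measure_pmf.variance (hypergeometric N K h) real \<le> real h * real K / real N"
proof -
  let ?p = "hypergeometric N K h" and ?\<mu> = "real h * real K / real N"
  have "K - 1 \<le> N - 1" "h - 1 \<le> N - 1" using assms by auto
  note mean1 = hypergeometric_mean[OF this, unfolded expectation_hypergeometric[OF this]]
    and one1 = sum_pmf_hypergeometric[OF this]
  have "measure_pmf.expectation ?p (\<lambda>k. (real k)\<^sup>2) = (\<Sum>k\<le>h. real k * (real k * pmf ?p k))"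
    by (simp add: expectation_hypergeometric[OF assms] power2_eq_square mult.assoc)
  also have "\<dots> = ?\<mu> * (if h = 0 \<or> K = 0 then 0 else \<Sum>k\<le>h-1. real (Suc k) * pmf (hypergeometric (N-1) (K-1) (h-1)) k)"
    by (rule hypergeometric_weighted_sum[OF assms])
  also have "\<dots> = ?\<mu> * (if h = 0 \<or> K = 0 then 0 else 1 + real (h - 1) * real (K - 1) / real (N - 1))"
  proof -
    have "(\<Sum>k\<le>h-1. real (Suc k) * pmf (hypergeometric (N-1) (K-1) (h-1)) k)
       = (\<Sum>k\<le>h-1. pmf (hypergeometric (N-1) (K-1) (h-1)) k) + (\<Sum>k\<le>h-1. real k * pmf (hypergeometric (N-1) (K-1) (h-1)) k)"
      by (simp add: distrib_right sum.distrib)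
    then show ?thesis unfolding mean1 one1 by (simp only:)
  qed
  also have "\<dots> \<le> ?\<mu> * (1 + ?\<mu>)"
  proof (rule mult_left_mono)
    show "(if h = 0 \<or> K = 0 then 0 else 1 + real (h - 1) * real (K - 1) / real (N - 1)) \<le> 1 + ?\<mu>"
    proof (cases "h = 0 \<or> K = 0 \<or> N = 1")
      case False
      then have N: "N \<ge> 2" "h \<ge> 1" "K \<ge> 1" using assms by auto
      have "real (K - 1) / real (N - 1) \<le> real K / real N"
        using N assms by (simp add: of_nat_diff field_simps)
      then have "real (h - 1) * (real (K - 1) / real (N - 1)) \<le> real h * (real K / real N)"
        by (intro mult_mono) auto
      then show ?thesis using False by simp
    qed auto
  qed simp
  finally have "measure_pmf.expectation ?p (\<lambda>k. (real k)\<^sup>2) \<le> ?\<mu> + ?\<mu>\<^sup>2"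
    by (simp add: algebra_simps power2_eq_square)
  then show ?thesis
    by (subst measure_pmf.variance_eq) (auto simp: integrable_hypergeometric[OF assms] hypergeometric_mean[OF assms])
qed

lemma hypergeometric_chebyshev:
  assumes "K \<le> N" "h \<le> N" "a > 0"
  shows "measure_pmf.prob (hypergeometric N K h) {k. a \<le> \<bar>real k - real h * real K / real N\<bar>}
    \<le> real h * real K / real N / a\<^sup>2"
proof -
  have "measure_pmf.prob (hypergeometric N K h) {k. a \<le> \<bar>real k - real h * real K / real N\<bar>}
     \<le> measure_pmf.variance (hypergeometric N K h) real / a\<^sup>2"
    using measure_pmf.Chebyshev_inequality[of real "hypergeometric N K h" a] assms
    by (simp add: integrable_hypergeometric hypergeometric_mean)
  also have "\<dots> \<le> real h * real K / real N / a\<^sup>2"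
    by (rule divide_right_mono[OF hypergeometric_variance_le[OF assms(1,2)]]) simp
  finally show ?thesis .
qed

text \<open>
  By Chebyshev's inequality the count concentrates around its mean, since the mean of the count
  multiplied by the scale \<open>R / K\<close> converges while \<open>R / K\<close> itself tends to 0. The value \<open>x = a\<close> is the
  jump of the limit and has to be left out.
\<close>

lemma hypergeometric_law_of_large_numbers:
  fixes N K h :: "nat \<Rightarrow> nat" and R :: "nat \<Rightarrow> real"
  assumes KN: "eventually (\<lambda>m. K m \<le> N m \<and> h m \<le> N m \<and> K m > 0) sequentially"
    and R: "eventually (\<lambda>m. R m > 0) sequentially"
    and N: "(\<lambda>m. real (N m) / (R m)\<^sup>2) \<longlonglongrightarrow> 1"
    and K: "(\<lambda>m. R m / real (K m)) \<longlonglongrightarrow> 0"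
    and h: "(\<lambda>m. real (h m) / R m) \<longlonglongrightarrow> a"
    and x: "x \<noteq> a"
  shows "(\<lambda>m. measure_pmf.prob (hypergeometric (N m) (K m) (h m)) {k. R m / real (K m) * real k \<le> x})
    \<longlonglongrightarrow> (if a < x then 1 else 0)"
proof -
  define \<mu> where "\<mu> m = real (h m) * real (K m) / real (N m)" for m
  define c where "c m = R m / real (K m)" for m
  define \<epsilon> where "\<epsilon> = \<bar>x - a\<bar> / 2"
  have \<epsilon>: "\<epsilon> > 0" using x by (simp add: \<epsilon>_def)
  have c_pos: "eventually (\<lambda>m. c m > 0) sequentially"
    using R KN by eventually_elim (simp add: c_def)
  have c\<mu>: "(\<lambda>m. c m * \<mu> m) \<longlonglongrightarrow> a"
  proof -
    have "(\<lambda>m. (real (h m) / R m) / (real (N m) / (R m)\<^sup>2)) \<longlonglongrightarrow> a / 1"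
      by (intro tendsto_divide h N) simp
    moreover have "eventually (\<lambda>m. (real (h m) / R m) / (real (N m) / (R m)\<^sup>2) = c m * \<mu> m) sequentially"
      using R KN by eventually_elim (simp add: c_def \<mu>_def power2_eq_square)
    ultimately show ?thesis by (auto intro: Lim_transform_eventually)
  qed
  define q where "q m = measure_pmf.prob (hypergeometric (N m) (K m) (h m)) {k. \<epsilon> / c m \<le> \<bar>real k - \<mu> m\<bar>}" for m
  have q: "q \<longlonglongrightarrow> 0"
  proof (rule tendsto_sandwich[OF _ _ tendsto_const])
    show "eventually (\<lambda>m. 0 \<le> q m) sequentially" by (simp add: q_def)
    show "eventually (\<lambda>m. q m \<le> c m * (c m * \<mu> m) / \<epsilon>\<^sup>2) sequentially"
      using c_pos KN
    proof eventually_elim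
      case (elim m)
      then have "q m \<le> \<mu> m / (\<epsilon> / c m)\<^sup>2"
        unfolding q_def \<mu>_def using \<epsilon> by (intro hypergeometric_chebyshev) auto
      then show ?case by (simp add: power2_eq_square mult_ac)
    qed
    have "(\<lambda>m. c m * (c m * \<mu> m) / \<epsilon>\<^sup>2) \<longlonglongrightarrow> 0 * a / \<epsilon>\<^sup>2"
      using \<epsilon> by (intro tendsto_divide tendsto_mult c\<mu> tendsto_const) (use K in \<open>auto simp: c_def\<close>)
    then show "(\<lambda>m. c m * (c m * \<mu> m) / \<epsilon>\<^sup>2) \<longlonglongrightarrow> 0" by simp
  qed
  have close: "eventually (\<lambda>m. \<bar>c m * \<mu> m - a\<bar> < \<epsilon>) sequentially"
    using tendstoD[OF c\<mu> \<epsilon>] by (simp add: dist_real_def)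
  let ?G = "\<lambda>m. measure_pmf.prob (hypergeometric (N m) (K m) (h m)) {k. c m * real k \<le> x}"
  have far: "\<epsilon> / c m \<le> \<bar>real k - \<mu> m\<bar>"
    if "c m > 0" "\<bar>c m * \<mu> m - a\<bar> < \<epsilon>" "2 * \<epsilon> \<le> \<bar>c m * real k - a\<bar>" for m k
  proof -
    have "\<epsilon> \<le> \<bar>c m * real k - c m * \<mu> m\<bar>" using that(2,3) by linarith
    also have "\<dots> = c m * \<bar>real k - \<mu> m\<bar>" using that(1) by (simp add: abs_mult flip: right_diff_distrib)
    finally show ?thesis using that(1) by (simp add: field_simps)
  qed
  show ?thesis
  proof (cases "a < x")
    case True
    have "?G \<longlonglongrightarrow> 1"
    proof (rule tendsto_sandwich)
      show "eventually (\<lambda>m. 1 - q m \<le> ?G m) sequentially"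
        using c_pos close
      proof eventually_elim
        case (elim m)
        have "- {k. c m * real k \<le> x} \<subseteq> {k. \<epsilon> / c m \<le> \<bar>real k - \<mu> m\<bar>}"
          using far[OF elim] True by (auto simp: \<epsilon>_def)
        then have "measure_pmf.prob (hypergeometric (N m) (K m) (h m)) (- {k. c m * real k \<le> x}) \<le> q m"
          unfolding q_def by (rule measure_pmf.finite_measure_mono) simp
        then show ?case
          using measure_pmf.prob_compl[of "{k. c m * real k \<le> x}" "hypergeometric (N m) (K m) (h m)"]
          by (simp add: Compl_eq_Diff_UNIV)
      qed
      show "eventually (\<lambda>m. ?G m \<le> 1) sequentially" by simp
      show "(\<lambda>m. 1 - q m) \<longlonglongrightarrow> 1" using tendsto_diff[OF tendsto_const q, of 1] by simp
    qed simp
    then show ?thesis using True by (simp add: c_def)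
  next
    case False
    have "?G \<longlonglongrightarrow> 0"
    proof (rule tendsto_sandwich[OF _ _ tendsto_const q])
      show "eventually (\<lambda>m. ?G m \<le> q m) sequentially"
        using c_pos close
      proof eventually_elim
        case (elim m)
        have "{k. c m * real k \<le> x} \<subseteq> {k. \<epsilon> / c m \<le> \<bar>real k - \<mu> m\<bar>}"
          using far[OF elim] False x by (auto simp: \<epsilon>_def)
        then show ?case
          unfolding q_def by (rule measure_pmf.finite_measure_mono) simp
      qed
    qed simp
    then show ?thesis using False by (simp add: c_def)
  qed
qed

section \<open>Critical distributions: depth and inversions\<close>

lemma prob_inversions:
  assumes "\<And>l. \<phi> l \<ge> 0" "total_weight \<phi> n > 0" "j \<in> {1..n}"
  shows "measure_pmf.prob (random_tree \<phi> n) {t. inversions t j \<in> S}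
    = measure_pmf.expectation (random_tree \<phi> n) (\<lambda>t. measure_pmf.prob (hypergeometric (n - 1) (n - j) (depth t j)) S)"
proof -
  have "measure_pmf.prob (random_tree \<phi> n) {t. inversions t j \<in> S}
     = measure_pmf.prob (map_pmf (\<lambda>t. inversions t j) (random_tree \<phi> n)) S"
    by (simp add: measure_map_pmf vimage_def)
  then show ?thesis
    by (simp only: inversions_mixed_hypergeometric[OF assms] prob_bind_pmf)
qed

context critical_distribution
begin

definition s :: real where "s = sqrt s2"

lemma s_pos: "s > 0" and s_sq: "s\<^sup>2 = s2"
  using s2_pos by (auto simp: s_def)

text \<open>
  Along the sizes \<open>d * m + 1\<close>, at which trees exist for large \<open>m\<close>, and for an arbitrary choice of the
  label \<open>J m\<close>.
\<close>

context
  fixes N J :: "nat \<Rightarrow> nat"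
  assumes N: "\<And>m. N m = d * m + 1" and J: "\<And>m. J m \<in> {1..N m}"
begin

abbreviation r :: "nat \<Rightarrow> real" where "r m \<equiv> sqrt (real (N m))"

lemma N_pos: "N m \<ge> 1" and N_dvd: "d dvd N m - 1"
  by (auto simp: N)

lemma N_at_top: "filterlim N at_top sequentially"
proof (rule filterlim_at_top_mono[OF filterlim_ident])
  have "m \<le> d * m" for m using d_pos by simp
  then show "\<forall>\<^sub>F m in sequentially. m \<le> N m" by (intro always_eventually allI) (simp add: N le_SucI)
qed

lemma r_pos: "r m > 0" using N_pos[of m] by simp

lemma r_at_top: "filterlim r at_top sequentially"
  by (intro filterlim_compose[OF sqrt_at_top] filterlim_compose[OF filterlim_real_sequentially N_at_top])

lemma deep_gf_PQ:
  assumes "n \<ge> 1" "h \<le> n"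
  shows "deep_gf p h $ n = (Q ^ h * P ^ (n - h)) $ (n - 1)"
  using deep_gf_closed_form[OF assms(1), of p h] assms(2) by (simp add: P_def Q_def)

lemma h_le_N:
  assumes "(\<lambda>m. real (h m) / r m) \<longlonglongrightarrow> x"
  shows "eventually (\<lambda>m. h m < N m) sequentially"
proof -
  have "(\<lambda>m. (real (h m) / r m) * (1 / r m)) \<longlonglongrightarrow> x * 0"
    by (intro tendsto_mult assms tendsto_divide_0[OF tendsto_const filterlim_at_top_imp_at_infinity[OF r_at_top]])
  then have "(\<lambda>m. real (h m) / real (N m)) \<longlonglongrightarrow> 0"
    by simp
  then have "eventually (\<lambda>m. real (h m) / real (N m) < 1) sequentially"
    by (rule order_tendstoD) simp
  then show ?thesis
  proof eventually_elim
    case (elim m) then show ?case using N_pos[of m] by (simp add: divide_less_eq)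
  qed
qed

lemma deep_gf_asymptotics:
  assumes h: "(\<lambda>m. real (h m) / r m) \<longlonglongrightarrow> x"
  shows "(\<lambda>m. r m * deep_gf p (h m) $ N m) \<longlonglongrightarrow> d / sqrt (2 * pi * s2) * exp (- x\<^sup>2 * s2 / 2)"
proof (rule Lim_transform_eventually[OF local_limit[OF N_at_top N_pos N_dvd h]])
  show "\<forall>\<^sub>F m in sequentially. r m * (Q ^ h m * P ^ (N m - h m)) $ (N m - 1) = r m * deep_gf p (h m) $ N m"
    using h_le_N[OF h] by eventually_elim (use N_pos in \<open>simp add: deep_gf_PQ\<close>)
qed

lemma eventually_total_weight_pos: "eventually (\<lambda>m. total_weight p (N m) > 0) sequentially"
proof -
  have "(\<lambda>m. r m * deep_gf p 0 $ N m) \<longlonglongrightarrow> d / sqrt (2 * pi * s2) * exp (- 0\<^sup>2 * s2 / 2)"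
    by (rule deep_gf_asymptotics[of "\<lambda>_. 0"]) simp
  then have "eventually (\<lambda>m. r m * deep_gf p 0 $ N m > 0) sequentially"
    by (rule order_tendstoD) (use d_pos s2_pos in simp)
  then show ?thesis
  proof eventually_elim
    case (elim m)
    have "deep_gf p 0 $ N m > 0" using elim r_pos[of m] by (simp only: zero_less_mult_pos)
    moreover have "deep_gf p 0 $ N m = real (N m) * tree_gf p $ N m"
      using N_pos[of m] by (cases "N m") (simp_all add: deep_gf_0_eq)
    ultimately have "tree_gf p $ N m > 0" using N_pos[of m] by (simp add: zero_less_mult_iff)
    then show ?case by (simp add: total_weight_eq)
  qed
qed

lemma depth_tail_limit:
  assumes h: "(\<lambda>m. real (h m) / r m) \<longlonglongrightarrow> x"
  shows "(\<lambda>m. measure_pmf.prob (random_tree p (N m)) {t. h m \<le> depth t (J m)}) \<longlonglongrightarrow> exp (- x\<^sup>2 * s2 / 2)"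
proof -
  let ?C = "d / sqrt (2 * pi * s2)"
  have C: "?C > 0" using d_pos s2_pos by simp
  have "(\<lambda>m. (r m * deep_gf p (h m) $ N m) / (r m * deep_gf p 0 $ N m))
     \<longlonglongrightarrow> (?C * exp (- x\<^sup>2 * s2 / 2)) / (?C * exp (- 0\<^sup>2 * s2 / 2))"
    by (intro tendsto_divide deep_gf_asymptotics[OF h] deep_gf_asymptotics[of "\<lambda>_. 0"]) (use d_pos s2_pos in simp_all)
  moreover have "(?C * exp (- x\<^sup>2 * s2 / 2)) / (?C * exp (- 0\<^sup>2 * s2 / 2)) = exp (- x\<^sup>2 * s2 / 2)"
    using d_pos s2_pos by (subst mult_divide_mult_cancel_left) simp_all
  moreover have "eventually (\<lambda>m. (r m * deep_gf p (h m) $ N m) / (r m * deep_gf p 0 $ N m)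
     = measure_pmf.prob (random_tree p (N m)) {t. h m \<le> depth t (J m)}) sequentially"
    using eventually_total_weight_pos
  proof eventually_elim
    case (elim m)
    show ?case using r_pos[of m] by (simp add: depth_tail[OF p_nonneg elim J])
  qed
  ultimately show ?thesis by (auto intro: Lim_transform_eventually)
qed

text \<open>
  The offset \<open>k\<close> is 1 for the distribution function, where \<open>depth > x\<close> is to be written as
  \<open>h \<le> depth\<close>, and 0 where the depth is recovered from its rescaled value.
\<close>

lemma floor_ratio_limit:
  fixes y :: "nat \<Rightarrow> real"
  assumes y: "y \<longlonglongrightarrow> y0" "y0 \<ge> 0" and h: "\<And>m. h m = nat \<lfloor>y m * r m / s\<rfloor> + k"
  shows "(\<lambda>m. real (h m) / r m) \<longlonglongrightarrow> y0 / s"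
proof (rule tendsto_sandwich)
  have inv: "(\<lambda>m. c / r m) \<longlonglongrightarrow> 0" for c
    by (rule tendsto_divide_0[OF tendsto_const filterlim_at_top_imp_at_infinity[OF r_at_top]])
  show "(\<lambda>m. y m / s - 1 / r m) \<longlonglongrightarrow> y0 / s"
    using tendsto_diff[OF tendsto_divide[OF y(1) tendsto_const[of s]] inv[of 1]] s_pos by simp
  show "(\<lambda>m. max 0 (y m / s) + real k / r m) \<longlonglongrightarrow> y0 / s"
    using tendsto_add[OF tendsto_max[OF tendsto_const[of 0] tendsto_divide[OF y(1) tendsto_const[of s]]] inv[of "real k"]]
      s_pos y(2) by (simp add: max_def)
  show "\<forall>\<^sub>F m in sequentially. y m / s - 1 / r m \<le> real (h m) / r m"
  proof (intro always_eventually allI)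
    fix m
    have "y m * r m / s - 1 \<le> real (h m)" unfolding h by linarith
    then have "(y m * r m / s - 1) / r m \<le> real (h m) / r m" using r_pos[of m] by (simp add: divide_right_mono)
    then show "y m / s - 1 / r m \<le> real (h m) / r m" using r_pos[of m] by (simp add: diff_divide_distrib)
  qed
  show "\<forall>\<^sub>F m in sequentially. real (h m) / r m \<le> max 0 (y m / s) + real k / r m"
  proof (intro always_eventually allI)
    fix m
    have "real (h m) \<le> max 0 (y m * r m / s) + real k" unfolding h by linarith
    also have "max 0 (y m * r m / s) = max 0 (y m / s) * r m"
      using r_pos[of m] s_pos by (auto simp: max_def zero_le_divide_iff zero_le_mult_iff)
    finally have "real (h m) / r m \<le> (max 0 (y m / s) * r m + real k) / r m"
      using r_pos[of m] by (simp add: divide_right_mono)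
    also have "\<dots> = max 0 (y m / s) + real k / r m"
      using r_pos[of m] by (simp add: add_divide_distrib)
    finally show "real (h m) / r m \<le> max 0 (y m / s) + real k / r m" .
  qed
qed

abbreviation scaled_depth_law :: "nat \<Rightarrow> real measure" where
  "scaled_depth_law m \<equiv> law (random_tree p (N m)) (\<lambda>t. s * real (depth t (J m)) / r m)"

text \<open>
  The depth multiplied by \<open>s / sqrt n\<close> is used, so that the limit does not depend on \<open>p\<close>; its tail is
  the ratio of two local limits, \<open>exp (- x\<^sup>2 / 2)\<close>.
\<close>

theorem depth_converges_to_rayleigh: "weak_conv_m scaled_depth_law (rayleigh 1)"
  unfolding weak_conv_m_def weak_conv_def
proof (intro allI impI)
  fix x :: real
  have scale: "s * real k / r m \<le> x \<longleftrightarrow> real k \<le> x * r m / s" for k m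
    using r_pos[of m] s_pos by (simp add: field_simps)
  show "(\<lambda>m. cdf (scaled_depth_law m) x) \<longlonglongrightarrow> cdf (rayleigh 1) x"
  proof (cases "x \<ge> 0")
    case False
    have "{t. s * real (depth t (J m)) / r m \<le> x} = {}" for m
    proof -
      have "0 \<le> s * real (depth t (J m)) / r m" for t :: "nat otree"
        using s_pos r_pos[of m] by simp
      then show ?thesis using False by (auto dest: order_trans)
    qed
    then show ?thesis using False by (simp add: cdf_law cdf_rayleigh)
  next
    case True
    define h where "h m = nat \<lfloor>x * r m / s\<rfloor> + 1" for m
    have h: "(\<lambda>m. real (h m) / r m) \<longlonglongrightarrow> x / s"
      by (rule floor_ratio_limit[OF tendsto_const True h_def])
    have "cdf (scaled_depth_law m) x = 1 - measure_pmf.prob (random_tree p (N m)) {t. h m \<le> depth t (J m)}" for m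
    proof -
      have "0 \<le> x * r m / s" using True s_pos by simp
      then have "s * real k / r m \<le> x \<longleftrightarrow> \<not> h m \<le> k" for k
        unfolding scale h_def by (auto simp: not_le less_Suc_eq_le le_nat_iff le_floor_iff)
      then have "{t. s * real (depth t (J m)) / r m \<le> x} = UNIV - {t. h m \<le> depth t (J m)}"
        by auto
      then show ?thesis
        using measure_pmf.prob_compl[of "{t. h m \<le> depth t (J m)}" "random_tree p (N m)"]
        by (simp add: cdf_law)
    qed
    moreover have "(\<lambda>m. 1 - measure_pmf.prob (random_tree p (N m)) {t. h m \<le> depth t (J m)})
        \<longlonglongrightarrow> 1 - exp (- (x / s)\<^sup>2 * s2 / 2)"
      by (intro tendsto_diff tendsto_const depth_tail_limit h)
    moreover have "(x / s)\<^sup>2 * s2 = x\<^sup>2" using s2_pos by (simp add: power_divide s_sq)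
    ultimately show ?thesis using True by (simp add: cdf_rayleigh)
  qed
qed

text \<open>
  One exceptional value \<open>c\<close> is permitted, because the limit law has no atoms; this is where the limit of
  the conditional distribution functions in the first regime jumps.
\<close>

lemma depth_expectation_limit:
  fixes G :: "nat \<Rightarrow> nat \<Rightarrow> real" and g0 :: "real \<Rightarrow> real"
  assumes bound: "\<And>m h. \<bar>G m h\<bar> \<le> 1" and g0: "g0 \<in> borel_measurable borel"
    and lim: "\<And>y h. y > 0 \<Longrightarrow> y \<noteq> c \<Longrightarrow> (\<lambda>m. real (h m) / r m) \<longlonglongrightarrow> y / s \<Longrightarrow> (\<lambda>m. G m (h m)) \<longlonglongrightarrow> g0 y"
  shows "(\<lambda>m. measure_pmf.expectation (random_tree p (N m)) (\<lambda>t. G m (depth t (J m)))) \<longlonglongrightarrow> integral\<^sup>L (rayleigh 1) g0"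
proof -
  \<comment> \<open>On the values that the rescaled depth attains, the floor returns the depth itself.\<close>
  define g where "g m y = G m (nat \<lfloor>y * r m / s\<rfloor>)" for m y
  have meas: "g m \<in> borel_measurable borel" for m
  proof -
    have "(\<lambda>i. G m (nat i)) \<in> measurable (count_space UNIV) borel" by simp
    from measurable_compose[OF measurable_real_floor this]
    have "(\<lambda>y :: real. G m (nat \<lfloor>y\<rfloor>)) \<in> borel_measurable borel" .
    moreover have "(\<lambda>y. y * r m / s) \<in> borel_measurable borel" by simp
    ultimately show ?thesis unfolding g_def[abs_def] by (rule measurable_compose[rotated])
  qed
  have "(\<lambda>m. integral\<^sup>L (scaled_depth_law m) (g m)) \<longlonglongrightarrow> integral\<^sup>L (rayleigh 1) g0"
  proof (rule weak_conv_integral_varying[where K = 1])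
    show "AE y in rayleigh 1. \<forall>z. z \<longlonglongrightarrow> y \<longrightarrow> (\<lambda>m. g m (z m)) \<longlonglongrightarrow> g0 y"
      using AE_rayleigh[of c 1]
    proof eventually_elim
      case (elim y)
      show ?case
      proof (intro allI impI)
        fix z :: "nat \<Rightarrow> real" assume "z \<longlonglongrightarrow> y"
        then show "(\<lambda>m. g m (z m)) \<longlonglongrightarrow> g0 y"
          unfolding g_def using elim by (intro lim floor_ratio_limit[where k = 0]) auto
      qed
    qed
  qed (use g0 meas bound in \<open>auto simp: g_def real_distribution_law real_distribution_rayleigh depth_converges_to_rayleigh\<close>)
  moreover have "integral\<^sup>L (scaled_depth_law m) (g m) = measure_pmf.expectation (random_tree p (N m)) (\<lambda>t. G m (depth t (J m)))" for m
  proof -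
    have "s * real k / r m * r m / s = real k" for k using s_pos r_pos[of m] by simp
    then have "g m (s * real k / r m) = G m k" for k
      unfolding g_def by (simp only: floor_of_nat nat_int)
    then show ?thesis unfolding law_def by (subst integral_distr) (use meas in simp_all)
  qed
  ultimately show ?thesis by simp
qed

lemma prob_inversions_limit:
  fixes S :: "nat \<Rightarrow> nat set" and g0 :: "real \<Rightarrow> real"
  assumes g0: "g0 \<in> borel_measurable borel"
    and lim: "\<And>y h. y > 0 \<Longrightarrow> y \<noteq> c \<Longrightarrow> (\<lambda>m. real (h m) / r m) \<longlonglongrightarrow> y / s \<Longrightarrow>
      (\<lambda>m. measure_pmf.prob (hypergeometric (N m - 1) (N m - J m) (h m)) (S m)) \<longlonglongrightarrow> g0 y"
  shows "(\<lambda>m. measure_pmf.prob (random_tree p (N m)) {t. inversions t (J m) \<in> S m}) \<longlonglongrightarrow> integral\<^sup>L (rayleigh 1) g0"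
proof (rule Lim_transform_eventually)
  show "(\<lambda>m. measure_pmf.expectation (random_tree p (N m))
      (\<lambda>t. measure_pmf.prob (hypergeometric (N m - 1) (N m - J m) (depth t (J m))) (S m))) \<longlonglongrightarrow> integral\<^sup>L (rayleigh 1) g0"
    by (rule depth_expectation_limit[where c = c and G = "\<lambda>m h. measure_pmf.prob (hypergeometric (N m - 1) (N m - J m) h) (S m)"])
       (use g0 lim in auto)
  show "\<forall>\<^sub>F m in sequentially. measure_pmf.expectation (random_tree p (N m))
      (\<lambda>t. measure_pmf.prob (hypergeometric (N m - 1) (N m - J m) (depth t (J m))) (S m))
    = measure_pmf.prob (random_tree p (N m)) {t. inversions t (J m) \<in> S m}"
    using eventually_total_weight_pos
    by eventually_elim (simp only: prob_inversions[OF p_nonneg _ J])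
qed

lemma N_ratio: "(\<lambda>m. real (N m - 1) / (r m)\<^sup>2) \<longlonglongrightarrow> 1"
proof -
  have "(\<lambda>m. 1 - (1 / r m) * (1 / r m)) \<longlonglongrightarrow> 1 - 0 * 0"
    by (intro tendsto_diff tendsto_mult tendsto_const tendsto_divide_0[OF tendsto_const filterlim_at_top_imp_at_infinity[OF r_at_top]])
  moreover have "1 - (1 / r m) * (1 / r m) = real (N m - 1) / (r m)\<^sup>2" for m
    using N_pos[of m] by (simp add: of_nat_diff diff_divide_distrib)
  ultimately show ?thesis by simp
qed

text \<open>
  Given a depth of about \<open>y * sqrt n / s\<close>, the rescaled number of inversions is close to the constant
  \<open>y / s\<close>, so its law inherits the randomness of the depth only.
\<close>

theorem inversions_rayleigh:
  assumes "(\<lambda>m. r m / real (N m - J m)) \<longlonglongrightarrow> 0" and "eventually (\<lambda>m. J m < N m) sequentially"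
  shows "weak_conv_m (\<lambda>m. law (random_tree p (N m)) (\<lambda>t. r m / real (N m - J m) * real (inversions t (J m))))
    (rayleigh (1 / s))"
  unfolding weak_conv_m_def weak_conv_def
proof (intro allI impI)
  fix x :: real
  have "(\<lambda>m. measure_pmf.prob (random_tree p (N m)) {t. inversions t (J m) \<in> {k. r m / real (N m - J m) * real k \<le> x}})
      \<longlonglongrightarrow> integral\<^sup>L (rayleigh 1) (indicator {..<s * x})"
  proof (rule prob_inversions_limit[where c = "s * x"])
    fix y :: real and h :: "nat \<Rightarrow> nat"
    assume y: "y > 0" "y \<noteq> s * x" and h: "(\<lambda>m. real (h m) / r m) \<longlonglongrightarrow> y / s"
    have "eventually (\<lambda>m. N m - J m \<le> N m - 1 \<and> h m \<le> N m - 1 \<and> N m - J m > 0) sequentially"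
      using assms(2) h_le_N[OF h]
    proof eventually_elim
      case (elim m) then show ?case using J[of m] by auto
    qed
    then have "(\<lambda>m. measure_pmf.prob (hypergeometric (N m - 1) (N m - J m) (h m)) {k. r m / real (N m - J m) * real k \<le> x})
       \<longlonglongrightarrow> (if y / s < x then 1 else 0)"
      by (rule hypergeometric_law_of_large_numbers)
         (use r_pos N_ratio assms(1) h y s_pos in \<open>auto simp: field_simps\<close>)
    moreover have "(if y / s < x then 1 else 0) = (indicator {..<s * x} y :: real)"
      using s_pos by (simp add: indicator_def divide_less_eq mult.commute)
    ultimately show "(\<lambda>m. measure_pmf.prob (hypergeometric (N m - 1) (N m - J m) (h m)) {k. r m / real (N m - J m) * real k \<le> x})
       \<longlonglongrightarrow> indicator {..<s * x} y"
      by (simp only:)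
  qed simp
  moreover have "integral\<^sup>L (rayleigh 1) (indicator {..<s * x}) = cdf (rayleigh (1 / s)) x"
  proof -
    interpret R: real_distribution "rayleigh 1" by (rule real_distribution_rayleigh) simp
    have "integral\<^sup>L (rayleigh 1) (indicator {..<s * x}) = integral\<^sup>L (rayleigh 1) (indicator {..s * x} :: real \<Rightarrow> real)"
    proof (rule integral_cong_AE)
      show "AE y in rayleigh 1. indicator {..<s * x} y = (indicator {..s * x} y :: real)"
        using AE_rayleigh[of "s * x" 1] by eventually_elim (auto simp: indicator_def)
    qed simp_all
    also have "\<dots> = cdf (rayleigh 1) (s * x)" by (simp add: cdf_def)
    also have "\<dots> = cdf (rayleigh (1 / s)) x"
      using s_pos by (simp add: cdf_rayleigh zero_le_mult_iff power_mult_distrib power_divide)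
    finally show ?thesis .
  qed
  ultimately show "(\<lambda>m. cdf (law (random_tree p (N m)) (\<lambda>t. r m / real (N m - J m) * real (inversions t (J m)))) x)
      \<longlonglongrightarrow> cdf (rayleigh (1 / s)) x"
    by (simp add: cdf_law)
qed

text \<open>
  Given a depth of about \<open>y * sqrt n / s\<close>, the number of inversions is asymptotically Poisson with
  parameter \<open>\<alpha> * y / s\<close>; integrating over \<open>y\<close> gives a mixed Poisson law.
\<close>

theorem prob_inversions_poisson_limit:
  assumes "(\<lambda>m. real (N m - J m) / r m) \<longlonglongrightarrow> \<alpha>"
  shows "(\<lambda>m. measure_pmf.prob (random_tree p (N m)) {t. inversions t (J m) = k})
    \<longlonglongrightarrow> integral\<^sup>L (rayleigh 1) (\<lambda>y. (\<alpha> / s * y) ^ k / fact k * exp (- (\<alpha> / s * y)))"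
proof -
  have "(\<lambda>m. measure_pmf.prob (random_tree p (N m)) {t. inversions t (J m) \<in> {k}})
    \<longlonglongrightarrow> integral\<^sup>L (rayleigh 1) (\<lambda>y. (\<alpha> / s * y) ^ k / fact k * exp (- (\<alpha> / s * y)))"
  proof (rule prob_inversions_limit[where c = 0])
    fix y :: real and h :: "nat \<Rightarrow> nat"
    assume h: "(\<lambda>m. real (h m) / r m) \<longlonglongrightarrow> y / s"
    show "(\<lambda>m. measure_pmf.prob (hypergeometric (N m - 1) (N m - J m) (h m)) {k})
       \<longlonglongrightarrow> (\<alpha> / s * y) ^ k / fact k * exp (- (\<alpha> / s * y))"
      using hypergeometric_poisson_limit[OF r_at_top N_ratio assms h, of k]
      by (simp add: pmf.rep_eq mult.commute)
  qed simp
  then show ?thesis by simp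
qed

end

end

section \<open>Reduction to a critical distribution\<close>

text \<open>
  Every vertex except the root is the child of exactly one vertex, so the powers of \<open>\<tau>\<close> multiply to
  \<open>\<tau> ^ (|t| - 1)\<close>; the factor \<open>\<tau>\<close> on the left avoids the subtraction.
\<close>

lemma weight_tilt:
  fixes \<tau> b :: real
  assumes "\<tau> > 0" "b > 0"
  shows "\<tau> * weight (\<lambda>l. \<phi> l * \<tau> ^ l / b) t = (\<tau> / b) ^ length (vertices t) * weight \<phi> t"
proof (induction t)
  case (Node x ts)
  let ?w = "weight (\<lambda>l. \<phi> l * \<tau> ^ l / b)"
  have "\<tau> ^ length ts * prod_list (map ?w ts) = prod_list (map (\<lambda>s. \<tau> * ?w s) ts)"
    by (induction ts) (simp_all add: mult_ac)
  also have "map (\<lambda>s. \<tau> * ?w s) ts = map (\<lambda>s. (\<tau> / b) ^ length (vertices s) * weight \<phi> s) ts"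
    using Node.IH by simp
  also have "prod_list \<dots> = (\<tau> / b) ^ length (concat (map vertices ts)) * prod_list (map (weight \<phi>) ts)"
    by (induction ts) (simp_all add: power_add mult_ac)
  finally have *: "\<tau> ^ length ts * prod_list (map ?w ts)
    = (\<tau> / b) ^ length (concat (map vertices ts)) * prod_list (map (weight \<phi>) ts)" .
  have "\<tau> * ?w (Node x ts) = \<tau> / b * \<phi> (length ts) * (\<tau> ^ length ts * prod_list (map ?w ts))"
    by simp
  then show ?case unfolding * by simp
qed

text \<open>
  Tilting multiplies the weights of all trees of one size by the same constant, which cancels in the
  normalisation. If the total weight vanishes, both normalised weight functions are 0.
\<close>

lemma random_tree_tilt:
  fixes \<tau> b :: real
  assumes "\<tau> > 0" "b > 0"
  shows "random_tree (\<lambda>l. \<phi> l * \<tau> ^ l / b) n = random_tree \<phi> n"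
proof -
  let ?p = "\<lambda>l. \<phi> l * \<tau> ^ l / b"
  define c where "c = (\<tau> / b) ^ n / \<tau>"
  have c: "c \<noteq> 0" using assms by (simp add: c_def)
  have w: "weight ?p t = c * weight \<phi> t" if "t \<in> labelled_trees n" for t
  proof -
    have "length (vertices t) = n"
      using that distinct_card[of "vertices t"] by (simp add: labelled_trees_def)
    then show ?thesis using weight_tilt[OF assms, of \<phi> t] assms by (simp add: c_def field_simps)
  qed
  have "total_weight ?p n = c * total_weight \<phi> n"
    unfolding total_weight_def sum_distrib_left by (intro sum.cong refl w)
  then have "(if t \<in> labelled_trees n then weight ?p t / total_weight ?p n else 0)
      = (if t \<in> labelled_trees n then weight \<phi> t / total_weight \<phi> n else 0)" for t
    using c w by simp
  then show ?thesis unfolding random_tree_def by simp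
qed

lemma gen_fun_eq_eval_fps: "gen_fun \<phi> = eval_fps (Abs_fps \<phi>)"
  by (simp add: gen_fun_def eval_fps_def fun_eq_iff)

text \<open>
  For each \<open>y > 0\<close> the integrands are Poisson weights and sum to 1, so by monotone convergence the
  integrals do as well.
\<close>

lemma mixed_poisson_exists:
  assumes \<gamma>: "\<gamma> \<ge> 0"
  shows "\<exists>Y. \<forall>k. pmf Y k = integral\<^sup>L (rayleigh 1) (\<lambda>y. (\<gamma> * y) ^ k / fact k * exp (- (\<gamma> * y)))"
proof -
  interpret R: real_distribution "rayleigh 1" by (rule real_distribution_rayleigh) simp
  define f where "f k y = (\<gamma> * y) ^ k / fact k * exp (- (\<gamma> * y))" for k :: nat and y :: real
  have meas [measurable]: "f k \<in> borel_measurable borel" for k unfolding f_def[abs_def] by measurable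
  have sums: "(\<lambda>k. f k y) sums 1" for y
    using sums_mult2[OF exp_converges[of "\<gamma> * y"], of "exp (- (\<gamma> * y))"]
    by (simp add: f_def divide_inverse scaleR_conv_of_real mult_ac flip: exp_add)
  have nonneg: "f k y \<ge> 0" if "y > 0" for k y using that \<gamma> by (simp add: f_def)
  have ae: "AE y in rayleigh 1. y > 0" using AE_rayleigh[of 0 1] by eventually_elim simp
  have le1: "f k y \<le> 1" if "y > 0" for k y
    using sum_le_suminf[of "\<lambda>k. f k y" "{k}"] sums[of y] nonneg[OF that] by (auto simp: sums_iff)
  have int: "integrable (rayleigh 1) (f k)" for k
  proof (rule R.integrable_const_bound[where B = 1])
    show "AE y in rayleigh 1. norm (f k y) \<le> 1"
      using ae by eventually_elim (simp add: nonneg le1)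
  qed simp
  let ?q = "\<lambda>k. integral\<^sup>L (rayleigh 1) (f k)"
  have q: "(\<integral>\<^sup>+ k. ennreal (?q k) \<partial>count_space UNIV) = 1"
  proof -
    have "(\<integral>\<^sup>+ k. ennreal (?q k) \<partial>count_space UNIV) = (\<Sum>k. ennreal (?q k))"
      by (rule nn_integral_count_space_nat)
    also have "\<dots> = (\<Sum>k. \<integral>\<^sup>+ y. ennreal (f k y) \<partial>rayleigh 1)"
    proof (rule suminf_cong)
      fix k
      have "AE y in rayleigh 1. 0 \<le> f k y" using ae by eventually_elim (rule nonneg)
      then show "ennreal (?q k) = (\<integral>\<^sup>+ y. ennreal (f k y) \<partial>rayleigh 1)"
        by (rule nn_integral_eq_integral[OF int, symmetric])
    qed
    also have "\<dots> = (\<integral>\<^sup>+ y. (\<Sum>k. ennreal (f k y)) \<partial>rayleigh 1)"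
      by (rule nn_integral_suminf[symmetric]) simp
    also have "\<dots> = (\<integral>\<^sup>+ y. 1 \<partial>rayleigh 1)"
    proof (rule nn_integral_cong_AE)
      show "AE y in rayleigh 1. (\<Sum>k. ennreal (f k y)) = 1"
        using ae
      proof eventually_elim
        case (elim y)
        have "(\<Sum>k. ennreal (f k y)) = ennreal (\<Sum>k. f k y)"
          by (rule suminf_ennreal2[OF nonneg[OF elim] sums_summable[OF sums]])
        then show ?case unfolding sums_unique[OF sums, symmetric] by simp
      qed
    qed
    also have "\<dots> = 1" using R.emeasure_space_1 by simp
    finally show ?thesis .
  qed
  have "?q k \<ge> 0" for k
    by (rule integral_nonneg_AE) (use ae in \<open>eventually_elim, simp add: nonneg\<close>)
  then have "pmf (embed_pmf ?q) k = ?q k" for k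
    by (rule pmf_embed_pmf[OF _ q])
  then show ?thesis unfolding f_def by blast
qed

lemma integral_mixed_poisson:
  "integral\<^sup>L (rayleigh 1) (\<lambda>y. (\<gamma> * y) ^ k / fact k * exp (- (\<gamma> * y)))
    = \<gamma> ^ k / fact k * (LBINT x:{0..}. x ^ (k + 1) * exp (- x\<^sup>2 / 2 - \<gamma> * x))"
proof -
  have "integral\<^sup>L (rayleigh 1) (\<lambda>y. (\<gamma> * y) ^ k / fact k * exp (- (\<gamma> * y)))
     = (LBINT x. rayleigh_density 1 x * ((\<gamma> * x) ^ k / fact k * exp (- (\<gamma> * x))))"
    by (rule integral_rayleigh) simp
  also have "\<dots> = (LBINT x. \<gamma> ^ k / fact k * (indicator {0..} x *\<^sub>R (x ^ (k + 1) * exp (- x\<^sup>2 / 2 - \<gamma> * x))))"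
  proof (rule Bochner_Integration.integral_cong[OF refl])
    fix x :: real
    have "exp (- x\<^sup>2 / 2 - \<gamma> * x) = exp (- x\<^sup>2 / 2) * exp (- (\<gamma> * x))"
      by (simp flip: exp_add)
    then show "rayleigh_density 1 x * ((\<gamma> * x) ^ k / fact k * exp (- (\<gamma> * x)))
       = \<gamma> ^ k / fact k * (indicator {0..} x *\<^sub>R (x ^ (k + 1) * exp (- x\<^sup>2 / 2 - \<gamma> * x)))"
      by (auto simp: rayleigh_density_def indicator_def power_mult_distrib mult_ac)
  qed
  finally show ?thesis by (simp add: set_lebesgue_integral_def)
qed

text \<open>
  The equation \<open>\<tau> * \<phi>'(\<tau>) = \<phi>(\<tau>)\<close> says that the tilted distribution has mean 1, and \<open>\<tau> < R\<close> that its
  generating function converges beyond 1. Its variance is the constant \<open>\<rho> * \<tau> * \<phi>''(\<tau>)\<close> of the theorem.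
\<close>

lemma critical_tilt:
  fixes \<phi> :: "nat \<Rightarrow> real" and \<tau> :: real
  defines "b \<equiv> gen_fun \<phi> \<tau>"
  assumes nonneg: "\<And>l. \<phi> l \<ge> 0" and pos: "\<phi> 0 > 0"
    and \<tau>: "\<tau> > 0" "ereal \<tau> < conv_radius \<phi>"
    and eq: "\<tau> * deriv (gen_fun \<phi>) \<tau> = gen_fun \<phi> \<tau>"
  shows "b > 0" and "critical_distribution (\<lambda>l. \<phi> l * \<tau> ^ l / b)"
    and "critical_distribution.s2 (\<lambda>l. \<phi> l * \<tau> ^ l / b) = \<tau>\<^sup>2 * deriv (deriv (gen_fun \<phi>)) \<tau> / b"
proof -
  let ?p = "\<lambda>l. \<phi> l * \<tau> ^ l / b" and ?F = "Abs_fps \<phi>"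
  have rad: "ereal (norm \<tau>) < fps_conv_radius ?F" using \<tau> by (simp add: fps_conv_radius_def)
  have rad1: "ereal (norm \<tau>) < fps_conv_radius (fps_deriv ?F)"
    using rad fps_conv_radius_deriv[of ?F] by (rule less_le_trans)
  have rad2: "ereal (norm \<tau>) < fps_conv_radius (fps_deriv (fps_deriv ?F))"
    using rad1 fps_conv_radius_deriv[of "fps_deriv ?F"] by (rule less_le_trans)
  have s0: "(\<lambda>l. \<phi> l * \<tau> ^ l) sums b"
    using sums_eval_fps[OF rad] by (simp add: b_def gen_fun_eq_eval_fps)
  have D1: "eval_fps (fps_deriv ?F) \<tau> = deriv (gen_fun \<phi>) \<tau>"
    unfolding gen_fun_eq_eval_fps by (rule eval_fps_deriv[OF rad])
  have D2: "eval_fps (fps_deriv (fps_deriv ?F)) \<tau> = deriv (deriv (gen_fun \<phi>)) \<tau>"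
  proof -
    have "eval_fps (fps_deriv (fps_deriv ?F)) \<tau> = deriv (eval_fps (fps_deriv ?F)) \<tau>"
      by (rule eval_fps_deriv[OF rad1])
    also have "\<dots> = deriv (deriv (gen_fun \<phi>)) \<tau>"
    proof (rule deriv_cong_ev[OF _ refl])
      have "eventually (\<lambda>z. z \<in> eball 0 (fps_conv_radius ?F)) (nhds \<tau>)"
        using rad by (intro eventually_nhds_in_open) auto
      then show "eventually (\<lambda>z. eval_fps (fps_deriv ?F) z = deriv (gen_fun \<phi>) z) (nhds \<tau>)"
        unfolding gen_fun_eq_eval_fps by eventually_elim (auto intro!: eval_fps_deriv)
    qed
    finally show ?thesis .
  qed
  have X: "ereal (norm \<tau>) < fps_conv_radius (fps_X :: real fps)" by simp
  have s1: "(\<lambda>l. real l * \<phi> l * \<tau> ^ l) sums b"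
  proof -
    have "(\<lambda>l. (fps_X * fps_deriv ?F) $ l * \<tau> ^ l) sums eval_fps (fps_X * fps_deriv ?F) \<tau>"
      by (rule sums_eval_fps, rule fps_conv_radius_mult_gt[OF X rad1])
    moreover have "(fps_X * fps_deriv ?F) $ l = real l * \<phi> l" for l by (cases l) auto
    moreover have "eval_fps (fps_X * fps_deriv ?F) \<tau> = b"
      using eq by (subst eval_fps_mult[OF X rad1]) (simp add: D1 b_def)
    ultimately show ?thesis by simp
  qed
  have s2: "(\<lambda>l. real l * (real l - 1) * \<phi> l * \<tau> ^ l) sums (\<tau>\<^sup>2 * deriv (deriv (gen_fun \<phi>)) \<tau>)"
  proof -
    have X2: "ereal (norm \<tau>) < fps_conv_radius (fps_X\<^sup>2 :: real fps)" by simp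
    have "(\<lambda>l. (fps_X\<^sup>2 * fps_deriv (fps_deriv ?F)) $ l * \<tau> ^ l) sums eval_fps (fps_X\<^sup>2 * fps_deriv (fps_deriv ?F)) \<tau>"
      by (rule sums_eval_fps, rule fps_conv_radius_mult_gt[OF X2 rad2])
    moreover have "(fps_X\<^sup>2 * fps_deriv (fps_deriv ?F)) $ l = real l * (real l - 1) * \<phi> l" for l
    proof -
      consider "l = 0" | "l = 1" | k where "l = Suc (Suc k)" by (cases l; cases "l - 1") auto
      then show ?thesis by cases (simp_all add: fps_X_power_mult_nth)
    qed
    moreover have "eval_fps (fps_X\<^sup>2 * fps_deriv (fps_deriv ?F)) \<tau> = \<tau>\<^sup>2 * deriv (deriv (gen_fun \<phi>)) \<tau>"
      by (subst eval_fps_mult[OF X2 rad2]) (simp add: D2)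
    ultimately show ?thesis by simp
  qed
  show b: "b > 0"
    unfolding sums_unique[OF s0]
    by (rule suminf_pos2[of _ 0]) (use s0 nonneg pos \<tau> in \<open>auto simp: sums_iff\<close>)
  show crit: "critical_distribution ?p"
  proof
    show "?p k \<ge> 0" for k using nonneg \<tau> b by simp
    show "?p 0 > 0" using pos b by simp
    have "conv_radius ?p = conv_radius \<phi> / ereal \<tau>"
      using conv_radius_cmult_right[of "1 / b" "\<lambda>l. \<phi> l * \<tau> ^ l"] conv_radius_mult_power_right[of \<tau> \<phi>] b \<tau>
      by simp
    moreover have "1 < conv_radius \<phi> / ereal \<tau>"
      using \<tau> by (subst ereal_less_divide_pos) auto
    ultimately show "1 < conv_radius ?p" by simp
    show "?p sums 1" using sums_divide[OF s0, of b] b by simp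
    show "(\<lambda>k. real k * ?p k) sums 1" using sums_divide[OF s1, of b] b by (simp add: mult.assoc)
  qed
  \<comment> \<open>\<open>(l - 1)\<^sup>2 = l * (l - 1) - l + 1\<close>, and the last two contributions cancel.\<close>
  have "(\<lambda>l. (real l * (real l - 1) * \<phi> l * \<tau> ^ l - real l * \<phi> l * \<tau> ^ l + \<phi> l * \<tau> ^ l) / b)
      sums ((\<tau>\<^sup>2 * deriv (deriv (gen_fun \<phi>)) \<tau> - b + b) / b)"
    by (intro sums_divide sums_add sums_diff s0 s1 s2)
  moreover have "(real l * (real l - 1) * \<phi> l * \<tau> ^ l - real l * \<phi> l * \<tau> ^ l + \<phi> l * \<tau> ^ l) / b
      = (real l - 1)\<^sup>2 * ?p l" for l
    by (simp add: power2_eq_square algebra_simps add_divide_distrib diff_divide_distrib)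
  ultimately have "(\<lambda>l. (real l - 1)\<^sup>2 * ?p l) sums (\<tau>\<^sup>2 * deriv (deriv (gen_fun \<phi>)) \<tau> / b)" by simp
  then show "critical_distribution.s2 ?p = \<tau>\<^sup>2 * deriv (deriv (gen_fun \<phi>)) \<tau> / b"
    using critical_distribution.variance_sums[OF crit] by (rule sums_unique2[symmetric])
qed

theorem theorem3p6:
  fixes \<phi> :: "nat \<Rightarrow> real" and \<tau> \<rho> :: real and d :: nat and j N :: "nat \<Rightarrow> nat"
  assumes phi_nonneg: "\<And>l. \<phi> l \<ge> 0" and phi_0: "\<phi> 0 > 0"
    and radius: "conv_radius \<phi> > 0"
    and tau_pos: "\<tau> > 0" and tau_radius: "ereal \<tau> < conv_radius \<phi>"
    and tau_eq: "\<tau> * deriv (gen_fun \<phi>) \<tau> = gen_fun \<phi> \<tau>"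
    and tau_minimal: "\<And>t. 0 < t \<Longrightarrow> t < \<tau> \<Longrightarrow> t * deriv (gen_fun \<phi>) t \<noteq> gen_fun \<phi> t"
    and rho: "\<rho> = \<tau> / gen_fun \<phi> \<tau>"
    and d: "d = Gcd {l. \<phi> l > 0}"
    and j_range: "\<And>n. n \<ge> 1 \<Longrightarrow> 1 \<le> j n \<and> j n \<le> n"
    \<comment> \<open>\<open>N\<close> enumerates the \<open>n \<ge> 1\<close> in the residue class of 1 modulo \<open>d\<close>\<close>
    and N: "\<And>m. N m = d * m + 1"
  shows
    "((\<lambda>m. sqrt (real (N m))) \<in> o(\<lambda>m. real (N m) - real (j (N m))) \<longrightarrow>
       weak_conv_m
         (\<lambda>m. law (random_tree \<phi> (N m))
            (\<lambda>t. sqrt (real (N m)) / (real (N m) - real (j (N m))) * real (inversions t (j (N m)))))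
         (rayleigh (1 / sqrt (\<rho> * \<tau> * deriv (deriv (gen_fun \<phi>)) \<tau>))))
   \<and> (\<forall>\<alpha>>0. (\<lambda>m. real (N m) - real (j (N m))) \<sim>[sequentially] (\<lambda>m. \<alpha> * sqrt (real (N m))) \<longrightarrow>
       (let \<gamma> = \<alpha> / sqrt (\<rho> * \<tau> * deriv (deriv (gen_fun \<phi>)) \<tau>) in
        \<exists>Y :: nat pmf.
          (\<forall>k. pmf Y k = \<gamma> ^ k / fact k *
             (LBINT x:{0..}. x ^ (k + 1) * exp (- x\<^sup>2 / 2 - \<gamma> * x))) \<and>
          weak_conv_m
            (\<lambda>m. law (random_tree \<phi> (N m)) (\<lambda>t. real (inversions t (j (N m)))))
            (law Y real)))
   \<and> ((\<lambda>m. real (N m) - real (j (N m))) \<in> o(\<lambda>m. sqrt (real (N m))) \<longrightarrow>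
       weak_conv_m
         (\<lambda>m. law (random_tree \<phi> (N m)) (\<lambda>t. real (inversions t (j (N m)))))
         (return borel 0))"
  proof -
  define b where "b = gen_fun \<phi> \<tau>"
  define p where "p = (\<lambda>l. \<phi> l * \<tau> ^ l / b)"
  note tilt = critical_tilt[OF phi_nonneg phi_0 tau_pos tau_radius tau_eq, folded b_def, folded p_def]
  interpret critical_distribution p by (rule tilt(2))
  define J where "J m = j (N m)" for m
  have d_eq: "d = critical_distribution.d p"
  proof -
    have "p k > 0 \<longleftrightarrow> \<phi> k > 0" for k
      using tau_pos tilt(1) by (simp add: p_def zero_less_mult_iff zero_less_divide_iff)
    then show ?thesis by (simp add: d d_def)
  qed
  have N': "N m = critical_distribution.d p * m + 1" for m by (simp add: N d_eq)
  have J: "J m \<in> {1..N m}" for m using j_range[of "N m"] by (simp add: J_def N)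
  have tree: "random_tree \<phi> n = random_tree p n" for n
    unfolding p_def by (rule random_tree_tilt[symmetric]) (use tau_pos tilt(1) in auto)
  have s: "sqrt (\<rho> * \<tau> * deriv (deriv (gen_fun \<phi>)) \<tau>) = s"
    by (simp add: s_def tilt(3) rho b_def power2_eq_square)
  have diff: "real (N m) - real (J m) = real (N m - J m)" for m
    using J[of m] by (simp add: of_nat_diff)
  have r_pos: "sqrt (real (N m)) > 0" for m using J[of m] by auto
  note poisson = prob_inversions_poisson_limit[OF N' J]
  show ?thesis
    unfolding tree s J_def[symmetric] diff
  proof (intro conjI impI allI)
    assume o: "(\<lambda>m. sqrt (real (N m))) \<in> o(\<lambda>m. real (N m - J m))"
    have "eventually (\<lambda>m. norm (sqrt (real (N m))) \<le> 1 * norm (real (N m - J m))) sequentially"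
      by (rule landau_o.smallD[OF o]) simp
    then have "eventually (\<lambda>m. J m < N m) sequentially"
    proof eventually_elim
      case (elim m)
      then have "sqrt (real (N m)) \<le> real (N m - J m)" by simp
      then have "real (N m - J m) > 0" by (rule less_le_trans[OF r_pos])
      then show ?case by simp
    qed
    with smalloD_tendsto[OF o]
    show "weak_conv_m (\<lambda>m. law (random_tree p (N m)) (\<lambda>t. sqrt (real (N m)) / real (N m - J m) * real (inversions t (J m))))
        (rayleigh (1 / s))"
      by (rule inversions_rayleigh[OF N' J])
  next
    fix \<alpha> :: real
    assume \<alpha>: "\<alpha> > 0" and equiv: "(\<lambda>m. real (N m - J m)) \<sim>[sequentially] (\<lambda>m. \<alpha> * sqrt (real (N m)))"
    define \<gamma> where "\<gamma> = \<alpha> / s"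
    have "(\<lambda>m. real (N m - J m) / (\<alpha> * sqrt (real (N m)))) \<longlonglongrightarrow> 1"
      by (rule asymp_equivD_strong[OF equiv]) (use \<alpha> r_pos in \<open>auto simp: less_imp_neq[THEN not_sym]\<close>)
    from tendsto_mult_left[OF this, of \<alpha>]
    have lim: "(\<lambda>m. real (N m - J m) / sqrt (real (N m))) \<longlonglongrightarrow> \<alpha>"
      using \<alpha> by simp
    have "\<gamma> \<ge> 0" using \<alpha> s_pos by (simp add: \<gamma>_def)
    then obtain Y where Y: "\<And>k. pmf Y k = integral\<^sup>L (rayleigh 1) (\<lambda>y. (\<gamma> * y) ^ k / fact k * exp (- (\<gamma> * y)))"
      using mixed_poisson_exists by blast
    have "weak_conv_m (\<lambda>m. law (random_tree p (N m)) (\<lambda>t. real (inversions t (J m)))) (law Y real)"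
      by (rule weak_conv_nat_valued) (simp only: Y \<gamma>_def poisson[OF lim])
    then show "let \<gamma> = \<alpha> / s in \<exists>Y :: nat pmf.
        (\<forall>k. pmf Y k = \<gamma> ^ k / fact k * (LBINT x:{0..}. x ^ (k + 1) * exp (- x\<^sup>2 / 2 - \<gamma> * x))) \<and>
        weak_conv_m (\<lambda>m. law (random_tree p (N m)) (\<lambda>t. real (inversions t (J m)))) (law Y real)"
      unfolding Let_def \<gamma>_def[symmetric] integral_mixed_poisson[symmetric] using Y by blast
  next
    assume "(\<lambda>m. real (N m - J m)) \<in> o(\<lambda>m. sqrt (real (N m)))"
    then have lim: "(\<lambda>m. real (N m - J m) / sqrt (real (N m))) \<longlonglongrightarrow> 0"
      by (rule smalloD_tendsto)
    interpret R: real_distribution "rayleigh 1" by (rule real_distribution_rayleigh) simp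
    \<comment> \<open>This is the Poisson regime with \<open>\<alpha> = 0\<close>: the mixed Poisson law degenerates.\<close>
    have "weak_conv_m (\<lambda>m. law (random_tree p (N m)) (\<lambda>t. real (inversions t (J m)))) (law (return_pmf 0) real)"
    proof (rule weak_conv_nat_valued)
      fix k
      have "integral\<^sup>L (rayleigh 1) (\<lambda>y. (0 / s * y) ^ k / fact k * exp (- (0 / s * y))) = pmf (return_pmf 0) k"
        using R.prob_space by (cases k) simp_all
      then show "(\<lambda>m. measure_pmf.prob (random_tree p (N m)) {t. inversions t (J m) = k}) \<longlonglongrightarrow> pmf (return_pmf 0) k"
        using poisson[OF lim, of k] by simp
    qed
    moreover have "law (return_pmf 0) real = return borel 0"
      unfolding law_def return_pmf.rep_eq by (subst distr_return) simp_all
    ultimately show "weak_conv_m (\<lambda>m. law (random_tree p (N m)) (\<lambda>t. real (inversions t (J m)))) (return borel 0)"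
      by simp
  qed
qed

end
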